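(* Let $\Omega$ be the Koenigs domain of a non-elliptic semigroup in $\mathbb D$. Suppose $\Omega\subseteq D$, where $D=e^{i\theta}D_0$ for some $\theta\in\mathbb R$ and some logarithmic starlike at infinity domain $D_0$ with $p$-frequencies. If $\operatorname{Int}(\overline\Omega)=\Omega$ and $\mathbb C\setminus\overline\Omega$ is connected, then $\mathcal E_p(D)$ (restricted to $\Omega$), and hence also $\mathcal E_p(\Omega)$, is dense in $H^p(\Omega)$ for all $p\in[1,\infty)$.
   Context: A logarithmic starlike at infinity domain is $\{x+iy:x>\psi(y)\}$ where $\psi:\mathbb R\to\mathbb R$ is differentiable with $|\psi'|\le K$ for some $K>0$ and there exist $R>0$, $0<a<1$ with $\psi(y)\ge-a\log|y|$ for $|y|\ge R$; it has $p$-frequencies if there is $p_0\ge1$ with $e^{\lambda z}\in H^{p_0}(D_0)$ for all $\lambda\le0$. A semigroup in $\mathbb D$ is a family $(\varphi_t)_{t\ge0}$ of holomorphic self-maps of the unit disc with $\varphi_0=\mathrm{id}$, $\varphi_t\circ\varphi_s=\varphi_{t+s}$, continuous in $t$; non-elliptic if no $\varphi_t$, $t>0$, has an interior fixed point. Its Koenigs function is a univalent $h:\mathbb D\to\mathbb C$ with $h\circ\varphi_t=h+t$ and $\bigcup_{t\ge0}(h(\mathbb D)-t)$ equal to $\mathbb C$, a horizontal half-plane or a horizontal strip; the Koenigs domain is $\Omega=h(\mathbb D)$. For simply connected $G\subsetneq\mathbb C$ and $1\le p<\infty$, $H^p(G)$ is the space of holomorphic $f$ with $|f|^p$ having a harmonic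 majorant; $\Lambda_p(G)=\{\lambda:e^{\lambda z}\in H^p(G)\}$ and $\mathcal E_p(G)=\operatorname{span}\{e^{\lambda z}:\lambda\in\Lambda_p(G)\}$. *)

theory Defs
  imports "HOL-Complex_Analysis.Complex_Analysis"
begin

definition unit_disc :: "complex set" where
  "unit_disc = ball 0 1"

definition harmonic_on :: "(complex \<Rightarrow> real) \<Rightarrow> complex set \<Rightarrow> bool" where
  "harmonic_on u G \<longleftrightarrow> open G \<and>
     (\<forall>z\<in>G. \<exists>r>0. ball z r \<subseteq> G \<and> (\<exists>g. g holomorphic_on ball z r \<and> (\<forall>w\<in>ball z r. u w = Re (g w))))"

definition harmonic_majorant :: "(complex \<Rightarrow> real) \<Rightarrow> (complex \<Rightarrow> real) \<Rightarrow> complex set \<Rightarrow> bool" where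
  "harmonic_majorant u v G \<longleftrightarrow> harmonic_on u G \<and> (\<forall>z\<in>G. v z \<le> u z)"

definition hardy :: "real \<Rightarrow> complex set \<Rightarrow> (complex \<Rightarrow> complex) set" where
  "hardy p G = {f. f holomorphic_on G \<and> (\<exists>u. harmonic_majorant u (\<lambda>z. norm (f z) powr p) G)}"

text \<open>p-th power of the H^p(G) norm with base point z0: value at z0 of the least harmonic
  majorant of |f|^p (computed as the infimum over all harmonic majorants).\<close>
definition hardy_normp :: "real \<Rightarrow> complex set \<Rightarrow> complex \<Rightarrow> (complex \<Rightarrow> complex) \<Rightarrow> real" where
  "hardy_normp p G z0 f = Inf {u z0 | u. harmonic_majorant u (\<lambda>z. norm (f z) powr p) G}"

definition Lambda_p :: "real \<Rightarrow> complex set \<Rightarrow> complex set" where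
  "Lambda_p p G = {l. (\<lambda>z. exp (l * z)) \<in> hardy p G}"

definition exp_span :: "complex set \<Rightarrow> (complex \<Rightarrow> complex) set" where
  "exp_span S = {g. \<exists>(n::nat) c l. (\<forall>k<n. l k \<in> S) \<and> g = (\<lambda>z. \<Sum>k<n. c k * exp (l k * z))}"

definition E_p :: "real \<Rightarrow> complex set \<Rightarrow> (complex \<Rightarrow> complex) set" where
  "E_p p G = exp_span (Lambda_p p G)"

definition dense_in_hardy :: "(complex \<Rightarrow> complex) set \<Rightarrow> real \<Rightarrow> complex set \<Rightarrow> bool" where
  "dense_in_hardy F p G \<longleftrightarrow>
     (\<forall>z0\<in>G. \<forall>f\<in>hardy p G. \<forall>\<epsilon>>0. \<exists>g\<in>F. hardy_normp p G z0 (\<lambda>z. f z - g z) < \<epsilon>)"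

definition log_starlike_at_infinity :: "complex set \<Rightarrow> bool" where
  "log_starlike_at_infinity D0 \<longleftrightarrow>
     (\<exists>\<psi> :: real \<Rightarrow> real. \<psi> differentiable_on UNIV \<and>
        (\<exists>K>0. \<forall>y. \<bar>deriv \<psi> y\<bar> \<le> K) \<and>
        (\<exists>R>0. \<exists>a. 0 < a \<and> a < 1 \<and> (\<forall>y. \<bar>y\<bar> \<ge> R \<longrightarrow> \<psi> y \<ge> - a * ln \<bar>y\<bar>)) \<and>
        D0 = {z. Re z > \<psi> (Im z)})"

definition has_p_frequencies :: "complex set \<Rightarrow> bool" where
  "has_p_frequencies D0 \<longleftrightarrow>
     (\<exists>p0\<ge>1. \<forall>l::real. l \<le> 0 \<longrightarrow> (\<lambda>z. exp (complex_of_real l * z)) \<in> hardy p0 D0)"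

definition semigroup_disc :: "(real \<Rightarrow> complex \<Rightarrow> complex) \<Rightarrow> bool" where
  "semigroup_disc \<phi> \<longleftrightarrow>
     (\<forall>t\<ge>0. \<phi> t holomorphic_on unit_disc \<and> \<phi> t ` unit_disc \<subseteq> unit_disc) \<and>
     (\<forall>z\<in>unit_disc. \<phi> 0 z = z) \<and>
     (\<forall>t\<ge>0. \<forall>s\<ge>0. \<forall>z\<in>unit_disc. \<phi> t (\<phi> s z) = \<phi> (t + s) z) \<and>
     (\<forall>z\<in>unit_disc. continuous_on {0..} (\<lambda>t. \<phi> t z))"

definition non_elliptic :: "(real \<Rightarrow> complex \<Rightarrow> complex) \<Rightarrow> bool" where
  "non_elliptic \<phi> \<longleftrightarrow> (\<forall>t>0. \<forall>z\<in>unit_disc. \<phi> t z \<noteq> z)"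

definition koenigs_function :: "(real \<Rightarrow> complex \<Rightarrow> complex) \<Rightarrow> (complex \<Rightarrow> complex) \<Rightarrow> bool" where
  "koenigs_function \<phi> h \<longleftrightarrow>
     h holomorphic_on unit_disc \<and> inj_on h unit_disc \<and>
     (\<forall>t\<ge>0. \<forall>z\<in>unit_disc. h (\<phi> t z) = h z + of_real t) \<and>
     (let U = (\<Union>t\<in>{0::real..}. (\<lambda>w. w - of_real t) ` (h ` unit_disc)) in
        U = UNIV \<or>
        (\<exists>a. U = {w. Im w > a} \<or> U = {w. Im w < a}) \<or>
        (\<exists>a b. a < b \<and> U = {w. a < Im w \<and> Im w < b}))"

end

theory Submission
  imports Defs
begin

text \<open>
  Fix \<open>z0\<close> in the Koenigs domain \<open>\<Omega>\<close> and let \<open>X\<close> be the set of functions that lie, for every \<open>p \<ge> 1\<close>,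
  in the \<open>H\<^sup>p(\<Omega>)\<close>-closure of the span of the exponentials \<open>exp (- s u)\<close>, \<open>s \<ge> 0\<close>, where
  \<open>u z = cnj e * z - c\<close> with \<open>e = exp (i \<theta>)\<close> and \<open>c\<close> real and very negative. By Cauchy-Schwarz
  \<open>X\<close> is an algebra, closed under limits.

  First, \<open>1 / u\<close> is in \<open>X\<close>: the function \<open>g = (1 - exp (- u)) / u\<close>, an integral of exponentials, satisfies
  \<open>|g| \<le> 11/12\<close> on \<open>\<Omega>\<close>, because \<open>|exp (- u)|\<close> grows there at most like \<open>|u|\<close>; and \<open>(1 - g ^ N) / u\<close> is in
  \<open>X\<close> and converges uniformly to \<open>1 / u\<close>. Hence polynomials in \<open>v = 1 / u\<close> are in \<open>X\<close>.

  Next, the Riemann map \<open>\<phi>\<close> of \<open>\<Omega>\<close> with \<open>\<phi> z0 = 0\<close> is in \<open>X\<close>. The compact set \<open>K = {0} \<union> v(closure \<Omega>)\<close> has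
  connected complement and interior \<open>v(\<Omega>)\<close>, so by a normal family argument the Riemann maps of shrinking simply
  connected neighbourhoods of \<open>K\<close> converge to that of \<open>v(\<Omega>)\<close>, and by Runge's theorem they are uniform limits of
  polynomials on \<open>K\<close>. Read in the disc, such an approximation is \<open>w q(w)\<close> with \<open>|q| \<le> 1\<close> and \<open>q(0)\<close> close to \<open>1\<close>;
  since \<open>|w - w q(w)|\<^sup>2 \<le> 2 - 2 Re q(w)\<close> is harmonically majorized, convergence holds in the Hardy norm.

  Finally, polynomials are dense in \<open>H\<^sup>p\<close> of the disc for every \<open>p \<ge> 1\<close>, so polynomials in \<open>\<phi>\<close> are dense in
  \<open>H\<^sup>p(\<Omega>)\<close>. Boundary values are avoided as follows: \<open>|F| powr (p/2)\<close> has a majorant \<open>Re P\<close> with \<open>P\<close> in \<open>H\<^sup>2\<close>,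
  and then the bounded functions \<open>F / (1 + \<epsilon> P)\<^sup>2\<close> converge to \<open>F\<close>, as \<open>|F|\<^sup>p \<le> |P|\<^sup>2\<close> and \<open>P\<close> is a polynomial plus a
  remainder small in \<open>H\<^sup>2\<close>.
\<close>

section \<open>Harmonic majorants and algebras of approximable functions\<close>

lemma harmonic_on_Re:
  assumes "open G" "f holomorphic_on G"
  shows "harmonic_on (\<lambda>z. Re (f z)) G"
  unfolding harmonic_on_def
proof (intro conjI ballI)
  fix z assume "z \<in> G"
  then obtain r where "r > 0" "ball z r \<subseteq> G" using assms(1) openE by blast
  then show "\<exists>r>0. ball z r \<subseteq> G \<and> (\<exists>g. g holomorphic_on ball z r \<and> (\<forall>w\<in>ball z r. Re (f w) = Re (g w)))"
    using assms(2) holomorphic_on_subset by blast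
qed (fact assms)

lemma harmonic_on_const: "open G \<Longrightarrow> harmonic_on (\<lambda>_. c) G"
  using harmonic_on_Re[of G "\<lambda>_. complex_of_real c"] by simp

lemma harmonic_on_open: "harmonic_on u G \<Longrightarrow> open G"
  by (simp add: harmonic_on_def)

lemma harmonic_onE:
  assumes "harmonic_on u G" "z \<in> G"
  obtains r g where "r > 0" "ball z r \<subseteq> G" "g holomorphic_on ball z r" "\<And>w. w \<in> ball z r \<Longrightarrow> u w = Re (g w)"
  using assms unfolding harmonic_on_def by blast

lemma harmonic_on_add:
  assumes "harmonic_on u G" "harmonic_on v G"
  shows "harmonic_on (\<lambda>z. u z + v z) G"
  unfolding harmonic_on_def
proof (intro conjI ballI)
  fix z assume z: "z \<in> G"
  obtain r g where 1: "r > 0" "ball z r \<subseteq> G" "g holomorphic_on ball z r" "\<And>w. w \<in> ball z r \<Longrightarrow> u w = Re (g w)"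
    using harmonic_onE[OF assms(1) z] by blast
  obtain s h where 2: "s > 0" "ball z s \<subseteq> G" "h holomorphic_on ball z s" "\<And>w. w \<in> ball z s \<Longrightarrow> v w = Re (h w)"
    using harmonic_onE[OF assms(2) z] by blast
  show "\<exists>r>0. ball z r \<subseteq> G \<and> (\<exists>g. g holomorphic_on ball z r \<and> (\<forall>w\<in>ball z r. u w + v w = Re (g w)))"
  proof (intro exI conjI ballI)
    show "min r s > 0" using 1 2 by simp
    show "ball z (min r s) \<subseteq> G" using 1(2) by auto
    show "(\<lambda>w. g w + h w) holomorphic_on ball z (min r s)"
      using 1(3) 2(3) by (intro holomorphic_on_add) (auto elim: holomorphic_on_subset)
    show "u w + v w = Re (g w + h w)" if "w \<in> ball z (min r s)" for w
      using that 1(4) 2(4) by simp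
  qed
qed (use assms harmonic_on_open in blast)

lemma harmonic_on_cmult:
  assumes "harmonic_on u G"
  shows "harmonic_on (\<lambda>z. c * u z) G"
  unfolding harmonic_on_def
proof (intro conjI ballI)
  fix z assume z: "z \<in> G"
  obtain r g where 1: "r > 0" "ball z r \<subseteq> G" "g holomorphic_on ball z r" "\<And>w. w \<in> ball z r \<Longrightarrow> u w = Re (g w)"
    using harmonic_onE[OF assms(1) z] by blast
  show "\<exists>r>0. ball z r \<subseteq> G \<and> (\<exists>g. g holomorphic_on ball z r \<and> (\<forall>w\<in>ball z r. c * u w = Re (g w)))"
    using 1 by (intro exI[of _ r] conjI exI[of _ "\<lambda>w. complex_of_real c * g w"] holomorphic_intros) auto
qed (use assms harmonic_on_open in blast)

lemma harmonic_on_diff: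
  assumes "harmonic_on u G" "harmonic_on v G"
  shows "harmonic_on (\<lambda>z. u z - v z) G"
  using harmonic_on_add[OF assms(1) harmonic_on_cmult[OF assms(2), of "-1"]] by simp

lemma harmonic_on_subset:
  assumes "harmonic_on u G" "open H" "H \<subseteq> G"
  shows "harmonic_on u H"
  unfolding harmonic_on_def
proof (intro conjI ballI)
  fix z assume z: "z \<in> H"
  obtain r g where 1: "r > 0" "ball z r \<subseteq> G" "g holomorphic_on ball z r" "\<And>w. w \<in> ball z r \<Longrightarrow> u w = Re (g w)"
    using harmonic_onE[OF assms(1)] z assms(3) by blast
  obtain s where s: "s > 0" "ball z s \<subseteq> H" using assms(2) z openE by blast
  show "\<exists>r>0. ball z r \<subseteq> H \<and> (\<exists>g. g holomorphic_on ball z r \<and> (\<forall>w\<in>ball z r. u w = Re (g w)))"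
    using 1 s by (intro exI[of _ "min r s"] conjI exI[of _ g]) (auto elim: holomorphic_on_subset)
qed (fact assms)

lemma harmonic_on_compose:
  assumes "harmonic_on u G" "open H" "f holomorphic_on H" "f ` H \<subseteq> G"
  shows "harmonic_on (\<lambda>z. u (f z)) H"
  unfolding harmonic_on_def
proof (intro conjI ballI)
  fix z assume z: "z \<in> H"
  obtain r g where 1: "r > 0" "ball (f z) r \<subseteq> G" "g holomorphic_on ball (f z) r"
      "\<And>w. w \<in> ball (f z) r \<Longrightarrow> u w = Re (g w)"
    using harmonic_onE[OF assms(1)] z assms(4) by blast
  have "open (H \<inter> f -` ball (f z) r)"
    using assms(2,3) holomorphic_on_imp_continuous_on continuous_open_preimage open_ball by blast
  moreover have "z \<in> H \<inter> f -` ball (f z) r" using z 1 by simp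
  ultimately obtain s where s: "s > 0" "ball z s \<subseteq> H \<inter> f -` ball (f z) r" using openE by blast
  have "(g \<circ> f) holomorphic_on ball z s"
    using s(2) by (intro holomorphic_on_compose_gen[OF _ 1(3)]) (use assms(3) holomorphic_on_subset in auto)
  then show "\<exists>r>0. ball z r \<subseteq> H \<and> (\<exists>g. g holomorphic_on ball z r \<and> (\<forall>w\<in>ball z r. u (f w) = Re (g w)))"
    using 1 s by (intro exI[of _ s] conjI exI[of _ "g \<circ> f"]) auto
qed (fact assms)

lemma harmonic_on_imp_continuous_on:
  assumes "harmonic_on u G"
  shows "continuous_on G u"
proof -
  have "isCont u z" if z: "z \<in> G" for z
  proof -
    obtain r g where 1: "r > 0" "ball z r \<subseteq> G" "g holomorphic_on ball z r" "\<And>w. w \<in> ball z r \<Longrightarrow> u w = Re (g w)"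
      using harmonic_onE[OF assms z] by blast
    have "continuous_on (ball z r) u"
      using 1(3,4) by (subst continuous_on_cong[OF refl 1(4)]) (auto intro!: continuous_intros holomorphic_on_imp_continuous_on)
    then show ?thesis using 1(1) by (simp add: continuous_on_eq_continuous_at)
  qed
  then show ?thesis by (simp add: continuous_at_imp_continuous_on)
qed

text \<open>A zero-free holomorphic function has a holomorphic logarithm on each ball. This supplies
  a harmonic function that tends to infinity together with \<open>norm (f z)\<close>.\<close>

lemma harmonic_on_ln_norm:
  assumes "open G" "f holomorphic_on G" "\<And>z. z \<in> G \<Longrightarrow> f z \<noteq> 0"
  shows "harmonic_on (\<lambda>z. ln (norm (f z))) G"
  unfolding harmonic_on_def
proof (intro conjI ballI)
  fix z assume "z \<in> G"
  then obtain r where r: "r > 0" "ball z r \<subseteq> G" using assms(1) openE by blast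
  have "contractible (ball z r)" by (simp add: convex_imp_contractible)
  then obtain g where g: "g holomorphic_on ball z r" "\<And>w. w \<in> ball z r \<Longrightarrow> f w = exp (g w)"
    using contractible_imp_holomorphic_log[of f "ball z r"] assms r holomorphic_on_subset by (metis subsetD)
  then show "\<exists>r>0. ball z r \<subseteq> G \<and> (\<exists>g. g holomorphic_on ball z r \<and> (\<forall>w\<in>ball z r. ln (norm (f w)) = Re (g w)))"
    using r by (intro exI[of _ r] conjI exI[of _ g]) auto
qed (fact assms)

text \<open>In contrast to \<open>hardy_normp p G z0 f < e\<close>, this entails that \<open>|f|\<^sup>p\<close> has a harmonic majorant;
  the infimum in \<open>hardy_normp\<close> may range over the empty set.\<close>
definition hsmall :: "complex set \<Rightarrow> complex \<Rightarrow> real \<Rightarrow> (complex \<Rightarrow> complex) \<Rightarrow> real \<Rightarrow> bool" where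
  "hsmall G z0 p f e \<longleftrightarrow> (\<exists>u. harmonic_majorant u (\<lambda>z. norm (f z) powr p) G \<and> u z0 < e)"

lemma hsmallI:
  assumes "harmonic_on u G" "\<And>z. z \<in> G \<Longrightarrow> norm (f z) powr p \<le> u z" "u z0 < e"
  shows "hsmall G z0 p f e"
  using assms unfolding hsmall_def harmonic_majorant_def by blast

lemma hsmallE:
  assumes "hsmall G z0 p f e"
  obtains u where "harmonic_on u G" "\<And>z. z \<in> G \<Longrightarrow> norm (f z) powr p \<le> u z" "u z0 < e"
  using assms unfolding hsmall_def harmonic_majorant_def by blast

lemma hsmall_mono:
  assumes "hsmall G z0 p f e" "e \<le> e'" "\<And>z. z \<in> G \<Longrightarrow> norm (g z) \<le> norm (f z)" "p \<ge> 0"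
  shows "hsmall G z0 p g e'"
proof -
  obtain u where u: "harmonic_on u G" "\<And>z. z \<in> G \<Longrightarrow> norm (f z) powr p \<le> u z" "u z0 < e"
    using hsmallE[OF assms(1)] by blast
  show ?thesis
  proof (rule hsmallI[OF u(1)])
    show "norm (g z) powr p \<le> u z" if "z \<in> G" for z
      using u(2)[OF that] assms(3)[OF that] powr_mono2[OF assms(4) norm_ge_zero] by (meson order_trans)
  qed (use u assms in auto)
qed

lemma hsmall_const:
  assumes "open G" "\<And>z. z \<in> G \<Longrightarrow> norm (f z) \<le> c" "c powr p < e" "p \<ge> 0"
  shows "hsmall G z0 p f e"
  using assms by (intro hsmallI[OF harmonic_on_const[OF assms(1), of "c powr p"]]) (auto intro: powr_mono2)

lemma powr_add_le:
  fixes a b p :: real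
  assumes "a \<ge> 0" "b \<ge> 0" "p \<ge> 0"
  shows "(a + b) powr p \<le> 2 powr p * (a powr p + b powr p)"
proof -
  have "(a + b) powr p \<le> (2 * max a b) powr p"
    using assms by (intro powr_mono2) auto
  also have "\<dots> = 2 powr p * (max a b) powr p" using assms by (subst powr_mult) auto
  also have "(max a b) powr p \<le> a powr p + b powr p" by (auto simp: max_def)
  finally show ?thesis by simp
qed

lemma hsmall_add:
  assumes "hsmall G z0 p f e" "hsmall G z0 p g e'" "p \<ge> 0"
  shows "hsmall G z0 p (\<lambda>z. f z + g z) (2 powr p * (e + e'))"
proof -
  obtain u where u: "harmonic_on u G" "\<And>z. z \<in> G \<Longrightarrow> norm (f z) powr p \<le> u z" "u z0 < e"
    using hsmallE[OF assms(1)] by blast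
  obtain v where v: "harmonic_on v G" "\<And>z. z \<in> G \<Longrightarrow> norm (g z) powr p \<le> v z" "v z0 < e'"
    using hsmallE[OF assms(2)] by blast
  show ?thesis
  proof (rule hsmallI[OF harmonic_on_cmult[OF harmonic_on_add[OF u(1) v(1)], of "2 powr p"]])
    fix z assume z: "z \<in> G"
    have "norm (f z + g z) powr p \<le> (norm (f z) + norm (g z)) powr p"
      using assms by (intro powr_mono2) (auto intro: norm_triangle_ineq)
    also have "\<dots> \<le> 2 powr p * (norm (f z) powr p + norm (g z) powr p)"
      using assms by (intro powr_add_le) auto
    also have "\<dots> \<le> 2 powr p * (u z + v z)"
      using u(2)[OF z] v(2)[OF z] by (intro mult_left_mono) auto
    finally show "norm (f z + g z) powr p \<le> 2 powr p * (u z + v z)" .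
  qed (use u v in auto)
qed

text \<open>The inequality \<open>a * b \<le> t * a^2 + b^2 / t\<close> stands in for
  Cauchy-Schwarz. The free weight \<open>t\<close> lets a very small first factor be balanced
  against a second one that is only finite.\<close>

lemma hsmall_mult:
  assumes "hsmall G z0 (2 * p) f e" "hsmall G z0 (2 * p) g e'" "t > 0"
  shows "hsmall G z0 p (\<lambda>z. f z * g z) (t * e + e' / t)"
proof -
  obtain u where u: "harmonic_on u G" "\<And>z. z \<in> G \<Longrightarrow> norm (f z) powr (2*p) \<le> u z" "u z0 < e"
    using hsmallE[OF assms(1)] by blast
  obtain v where v: "harmonic_on v G" "\<And>z. z \<in> G \<Longrightarrow> norm (g z) powr (2*p) \<le> v z" "v z0 < e'"
    using hsmallE[OF assms(2)] by blast
  show ?thesis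
  proof (rule hsmallI[OF harmonic_on_add[OF harmonic_on_cmult[OF u(1), of t] harmonic_on_cmult[OF v(1), of "1/t"]]])
    fix z assume z: "z \<in> G"
    define a b where "a = norm (f z) powr p" and "b = norm (g z) powr p"
    have [simp]: "a \<ge> 0" "b \<ge> 0" by (auto simp: a_def b_def)
    have sq: "norm (f z) powr (2*p) = a\<^sup>2" "norm (g z) powr (2*p) = b\<^sup>2"
      by (auto simp: a_def b_def power2_eq_square powr_add[symmetric])
    have "0 \<le> (t * a - b)\<^sup>2" by simp
    then have "2 * (t * (a * b)) \<le> t\<^sup>2 * a\<^sup>2 + b\<^sup>2" by (simp add: power2_eq_square algebra_simps)
    then have "t * (a * b) \<le> t\<^sup>2 * a\<^sup>2 + b\<^sup>2"
      using assms(3) by (smt (verit) zero_le_mult_iff \<open>a \<ge> 0\<close> \<open>b \<ge> 0\<close>)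
    then have "a * b \<le> t * a\<^sup>2 + 1 / t * b\<^sup>2"
      using assms(3) by (simp add: field_simps power2_eq_square)
    also have "\<dots> \<le> t * u z + 1/t * v z"
      using u(2)[OF z] v(2)[OF z] assms(3) unfolding sq by (intro add_mono mult_left_mono) auto
    finally show "norm (f z * g z) powr p \<le> t * u z + 1/t * v z"
      by (simp add: a_def b_def norm_mult powr_mult)
  next
    show "t * u z0 + 1 / t * v z0 < t * e + e' / t"
      using u(3) v(3) assms(3) by (intro add_strict_mono) (auto simp: divide_strict_right_mono)
  qed
qed

text \<open>A Chebyshev argument: where \<open>norm (f z) powr p\<close> exceeds \<open>e/2\<close>,
  the square of \<open>norm (f z)\<close> is at least the fixed threshold
  \<open>(e/2) powr (2/p)\<close>, so there \<open>m powr p\<close> is at most a constant multiple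
  of the majorant for exponent 2. For bounded functions, smallness in H^2 thus gives smallness for
  every exponent.\<close>

lemma hsmall_bounded_exponent:
  assumes "open G" "m \<ge> 0" "\<And>z. z \<in> G \<Longrightarrow> norm (f z) \<le> m" "p > 0" "e > 0"
    and "hsmall G z0 2 f d" "d > 0" "(m powr p) * d \<le> (e/2) * (e/2) powr (2/p)"
  shows "hsmall G z0 p f e"
proof -
  obtain u where u: "harmonic_on u G" "\<And>z. z \<in> G \<Longrightarrow> norm (f z) powr 2 \<le> u z" "u z0 < d"
    using hsmallE[OF assms(6)] by blast
  define C where "C = m powr p / (e/2) powr (2/p)"
  have C0: "C \<ge> 0" using assms by (simp add: C_def)
  show ?thesis
  proof (rule hsmallI[OF harmonic_on_add[OF harmonic_on_const[OF assms(1), of "e/2"] harmonic_on_cmult[OF u(1), of C]]])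
    fix z assume z: "z \<in> G"
    have u0: "u z \<ge> 0" using u(2)[OF z] powr_ge_zero order_trans by blast
    show "norm (f z) powr p \<le> e/2 + C * u z"
    proof (cases "norm (f z) powr p \<le> e/2")
      case True then show ?thesis using C0 u0 by (simp add: add_increasing2)
    next
      case False
      then have "(norm (f z) powr p) powr (2/p) \<ge> (e/2) powr (2/p)"
        using assms by (intro powr_mono2) auto
      then have 1: "norm (f z) powr 2 \<ge> (e/2) powr (2/p)" using assms(4) by (simp add: powr_powr)
      have "norm (f z) powr p \<le> m powr p" using assms z by (intro powr_mono2) auto
      also have "\<dots> = C * (e/2) powr (2/p)" using assms(5) by (simp add: C_def)
      also have "\<dots> \<le> C * norm (f z) powr 2" using 1 C0 by (rule mult_left_mono)
      also have "\<dots> \<le> C * u z" using u(2)[OF z] C0 by (rule mult_left_mono)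
      finally show ?thesis using assms(5) by simp
    qed
  next
    have "C * d \<le> e/2" using assms(5,8) by (simp add: C_def field_simps)
    \<comment> \<open>Multiplying \<open>u z0 < d\<close> by \<open>C\<close> keeps it strict only
      for \<open>C > 0\<close>, hence the separate case.\<close>
    show "e / 2 + C * u z0 < e"
    proof (cases "C = 0")
      case False
      then have "C * u z0 < C * d" using C0 u(3) by simp
      then show ?thesis using \<open>C * d \<le> e/2\<close> by linarith
    qed (use assms in simp)
  qed
qed

section \<open>Closures in all Hardy spaces at once\<close>

text \<open>All exponents are required at once, although the approximant may depend on
  \<open>p\<close>: a product at exponent \<open>p\<close> needs its factors approximated at
  \<open>2 * p\<close>, so the closure for a single exponent need not be an algebra.\<close>

definition hclos :: "complex set \<Rightarrow> complex \<Rightarrow> (complex \<Rightarrow> complex) set \<Rightarrow> (complex \<Rightarrow> complex) set" where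
  "hclos G z0 E = {f. \<forall>p\<ge>1. \<forall>e>0. \<exists>g\<in>E. hsmall G z0 p (\<lambda>z. f z - g z) e}"

definition hfin :: "complex set \<Rightarrow> complex \<Rightarrow> (complex \<Rightarrow> complex) \<Rightarrow> bool" where
  "hfin G z0 f \<longleftrightarrow> (\<forall>p\<ge>1. \<exists>M. hsmall G z0 p f M)"

lemma hfin_add: "hfin G z0 f \<Longrightarrow> hfin G z0 g \<Longrightarrow> hfin G z0 (\<lambda>z. f z + g z)"
  unfolding hfin_def using hsmall_add[of G z0 _ f _ g] by (meson order_trans zero_le_one)

lemma hfin_cmult:
  assumes "hfin G z0 f" shows "hfin G z0 (\<lambda>z. c * f z)"
  unfolding hfin_def
proof (intro allI impI)
  fix p :: real assume "p \<ge> 1"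
  then obtain M where "hsmall G z0 p f M" using assms unfolding hfin_def by blast
  then obtain u where u: "harmonic_on u G" "\<And>z. z \<in> G \<Longrightarrow> norm (f z) powr p \<le> u z"
    using hsmallE by blast
  have "hsmall G z0 p (\<lambda>z. c * f z) (norm c powr p * u z0 + 1)"
    by (rule hsmallI[OF harmonic_on_cmult[OF u(1), of "norm c powr p"]])
       (use u(2) in \<open>auto simp: norm_mult powr_mult intro: mult_left_mono\<close>)
  then show "\<exists>M. hsmall G z0 p (\<lambda>z. c * f z) M" by blast
qed

lemma hsmall_compose:
  assumes "hsmall H w0 p f e" "open G" "g holomorphic_on G" "g ` G \<subseteq> H" "g z0 = w0"
  shows "hsmall G z0 p (\<lambda>z. f (g z)) e"
proof -
  obtain u where u: "harmonic_on u H" "\<And>z. z \<in> H \<Longrightarrow> norm (f z) powr p \<le> u z" "u w0 < e"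
    using hsmallE[OF assms(1)] by blast
  show ?thesis
    by (rule hsmallI[OF harmonic_on_compose[OF u(1) assms(2,3,4)]]) (use u assms in auto)
qed

text \<open>The members of \<open>E\<close> are finite in every exponent; this is what makes
  \<open>hclos G z0 E\<close> an algebra again.\<close>

locale hardy_algebra =
  fixes G z0 E
  assumes opG: "open G"
    and add: "f \<in> E \<Longrightarrow> g \<in> E \<Longrightarrow> (\<lambda>z. f z + g z) \<in> E"
    and mult: "f \<in> E \<Longrightarrow> g \<in> E \<Longrightarrow> (\<lambda>z. f z * g z) \<in> E"
    and const: "(\<lambda>_. c) \<in> E"
    and fin: "f \<in> E \<Longrightarrow> hfin G z0 f"
    and z0: "z0 \<in> G"
begin

lemma hsmall_zero: "e > 0 \<Longrightarrow> hsmall G z0 p (\<lambda>z. 0) e"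
  by (rule hsmallI[OF harmonic_on_const[OF opG, of 0]]) auto

lemma hclos_base: "f \<in> E \<Longrightarrow> f \<in> hclos G z0 E"
  unfolding hclos_def using hsmall_zero by (auto intro!: bexI[of _ f])

lemma hclos_closed:
  assumes "\<And>p e. p \<ge> 1 \<Longrightarrow> e > 0 \<Longrightarrow> \<exists>g\<in>hclos G z0 E. hsmall G z0 p (\<lambda>z. f z - g z) e"
  shows "f \<in> hclos G z0 E"
  unfolding hclos_def
proof (intro CollectI allI impI)
  fix p e :: real assume p: "p \<ge> 1" and e: "e > 0"
  define d where "d = e / (2 * 2 powr p)"
  have d: "d > 0" using e by (simp add: d_def)
  obtain g where g: "g \<in> hclos G z0 E" "hsmall G z0 p (\<lambda>z. f z - g z) d" using assms[OF p d] by blast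
  obtain h where h: "h \<in> E" "hsmall G z0 p (\<lambda>z. g z - h z) d" using g(1) p d unfolding hclos_def by blast
  have "hsmall G z0 p (\<lambda>z. (f z - g z) + (g z - h z)) (2 powr p * (d + d))"
    using hsmall_add[OF g(2) h(2)] p by simp
  moreover have "2 powr p * (d + d) = e" by (simp add: d_def)
  ultimately show "\<exists>g\<in>E. hsmall G z0 p (\<lambda>z. f z - g z) e" using h(1) by auto
qed

lemma hclos_add:
  assumes "f \<in> hclos G z0 E" "g \<in> hclos G z0 E"
  shows "(\<lambda>z. f z + g z) \<in> hclos G z0 E"
  unfolding hclos_def
proof (intro CollectI allI impI)
  fix p e :: real assume p: "p \<ge> 1" and e: "e > 0"
  define d where "d = e / (2 * 2 powr p)"
  have d: "d > 0" using e by (simp add: d_def)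
  obtain a where a: "a \<in> E" "hsmall G z0 p (\<lambda>z. f z - a z) d" using assms(1) p d unfolding hclos_def by blast
  obtain b where b: "b \<in> E" "hsmall G z0 p (\<lambda>z. g z - b z) d" using assms(2) p d unfolding hclos_def by blast
  have "hsmall G z0 p (\<lambda>z. (f z - a z) + (g z - b z)) (2 powr p * (d + d))"
    using hsmall_add[OF a(2) b(2)] p by simp
  moreover have "2 powr p * (d + d) = e" by (simp add: d_def)
  ultimately show "\<exists>h\<in>E. hsmall G z0 p (\<lambda>z. f z + g z - h z) e"
    using add[OF a(1) b(1)] by (intro bexI[of _ "\<lambda>z. a z + b z"]) (auto simp: algebra_simps)
qed

lemma hclos_fin:
  assumes "f \<in> hclos G z0 E"
  shows "hfin G z0 f"
  unfolding hfin_def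
proof (intro allI impI)
  fix p :: real assume p: "p \<ge> 1"
  obtain a where a: "a \<in> E" "hsmall G z0 p (\<lambda>z. f z - a z) 1" using assms(1) p zero_less_one[where ?'a=real] unfolding hclos_def mem_Collect_eq by blast
  obtain M where "hsmall G z0 p a M" using fin[OF a(1)] p unfolding hfin_def by blast
  from hsmall_add[OF a(2) this] p show "\<exists>M. hsmall G z0 p f M" by auto
qed

lemma hsmall_pos:
  assumes "hsmall G z0 p f M" shows "M > 0"
proof -
  obtain u where u: "harmonic_on u G" "\<And>z. z \<in> G \<Longrightarrow> norm (f z) powr p \<le> u z" "u z0 < M"
    using hsmallE[OF assms(1)] by blast
  from u(2)[OF z0] u(3) show ?thesis by (smt (verit) powr_ge_zero)
qed

text \<open>\<open>t = 2 * M / e\<close> makes the share \<open>M / t\<close> of the fixed factor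
  equal to \<open>e / 2\<close>, and \<open>d = e / (2 * t)\<close> does the same for the share
  \<open>t * d\<close> of the small one.\<close>

lemma mult_small:
  assumes "hfin G z0 g" "p \<ge> 1" "e > 0"
  obtains d where "d > 0" "\<And>f. hsmall G z0 (2 * p) f d \<Longrightarrow> hsmall G z0 p (\<lambda>z. f z * g z) e"
proof -
  have "2 * p \<ge> 1" using assms by simp
  then obtain M where M: "hsmall G z0 (2*p) g M" using assms(1) unfolding hfin_def by blast
  have M0: "M > 0" using hsmall_pos[OF M] .
  define t where "t = 2 * M / e"
  have t: "t > 0" using M0 assms by (simp add: t_def)
  show thesis
  proof (rule that[of "e / (2 * t)"])
    show "e / (2*t) > 0" using t assms by simp
    fix f assume f: "hsmall G z0 (2 * p) f (e / (2 * t))"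
    have "t * (e / (2 * t)) + M / t = e" using t assms M0 by (simp add: t_def field_simps)
    with hsmall_mult[OF f M t] show "hsmall G z0 p (\<lambda>z. f z * g z) e" by simp
  qed
qed

text \<open>Write \<open>f g - a b = (f - a) g + (g - b) a\<close>. The tolerance for
  \<open>b\<close> depends on \<open>a\<close>, so \<open>a\<close> is chosen first.\<close>

lemma hclos_mult:
  assumes "f \<in> hclos G z0 E" "g \<in> hclos G z0 E"
  shows "(\<lambda>z. f z * g z) \<in> hclos G z0 E"
  unfolding hclos_def
proof (intro CollectI allI impI)
  fix p e :: real assume p: "p \<ge> 1" and e: "e > 0"
  have p2: "2 * p \<ge> 1" using p by simp
  define e1 where "e1 = e / (2 * 2 powr p)"
  have e1: "e1 > 0" using e by (simp add: e1_def)
  obtain d where d: "d > 0" "\<And>f. hsmall G z0 (2 * p) f d \<Longrightarrow> hsmall G z0 p (\<lambda>z. f z * g z) e1"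
    using mult_small[OF hclos_fin[OF assms(2)] p e1] by blast
  obtain a where a: "a \<in> E" "hsmall G z0 (2*p) (\<lambda>z. f z - a z) d" using assms(1) p2 d(1) unfolding hclos_def by blast
  obtain d' where d': "d' > 0" "\<And>f. hsmall G z0 (2 * p) f d' \<Longrightarrow> hsmall G z0 p (\<lambda>z. f z * a z) e1"
    using mult_small[OF fin[OF a(1)] p e1] by blast
  obtain b where b: "b \<in> E" "hsmall G z0 (2*p) (\<lambda>z. g z - b z) d'" using assms(2) p2 d'(1) unfolding hclos_def by blast
  have "hsmall G z0 p (\<lambda>z. (f z - a z) * g z + (g z - b z) * a z) (2 powr p * (e1 + e1))"
    using hsmall_add[OF d(2)[OF a(2)] d'(2)[OF b(2)]] p by simp
  moreover have "2 powr p * (e1 + e1) = e" by (simp add: e1_def)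
  ultimately show "\<exists>h\<in>E. hsmall G z0 p (\<lambda>z. f z * g z - h z) e"
    using mult[OF a(1) b(1)] by (intro bexI[of _ "\<lambda>z. a z * b z"]) (auto simp: algebra_simps)
qed

lemma hclos_const: "(\<lambda>_. c) \<in> hclos G z0 E" by (rule hclos_base[OF const])

lemma hclos_cmult: "f \<in> hclos G z0 E \<Longrightarrow> (\<lambda>z. c * f z) \<in> hclos G z0 E"
  using hclos_mult[OF hclos_const] by blast

lemma hclos_sum: "(\<And>i. i \<in> I \<Longrightarrow> f i \<in> hclos G z0 E) \<Longrightarrow> (\<lambda>z. \<Sum>i\<in>I. f i z) \<in> hclos G z0 E"
  by (induction I rule: infinite_finite_induct) (auto intro: hclos_const hclos_add)

lemma hclos_power: "f \<in> hclos G z0 E \<Longrightarrow> (\<lambda>z. f z ^ n) \<in> hclos G z0 E"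
  by (induction n) (auto intro: hclos_const hclos_mult)

lemma hclos_poly: "f \<in> hclos G z0 E \<Longrightarrow> (\<lambda>z. poly P (f z)) \<in> hclos G z0 E"
  by (induction P) (auto intro: hclos_const hclos_mult hclos_add)

lemma hclos_cong: "f \<in> hclos G z0 E \<Longrightarrow> (\<And>z. z \<in> G \<Longrightarrow> f z = g z) \<Longrightarrow> g \<in> hclos G z0 E"
  by (rule hclos_closed) (auto intro!: bexI[of _ f] hsmallI[OF harmonic_on_const[OF opG, of 0]])

lemma hclos_uniform:
  assumes "\<And>e. e > 0 \<Longrightarrow> \<exists>g\<in>hclos G z0 E. \<forall>z\<in>G. norm (f z - g z) \<le> e"
  shows "f \<in> hclos G z0 E"
proof (rule hclos_closed)
  fix p e :: real assume p: "p \<ge> 1" and e: "e > 0"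
  define d where "d = (e/2) powr (1/p)"
  have "d > 0" using e by (simp add: d_def)
  then obtain g where g: "g \<in> hclos G z0 E" "\<forall>z\<in>G. norm (f z - g z) \<le> d" using assms by blast
  have "d powr p < e" using p e by (simp add: d_def powr_powr)
  then show "\<exists>g\<in>hclos G z0 E. hsmall G z0 p (\<lambda>z. f z - g z) e"
    using g p by (intro bexI[of _ g] hsmall_const[OF opG, of _ d]) auto
qed

end

section \<open>The maximum principle and trigonometric polynomials\<close>

text \<open>The maximum modulus principle for \<open>exp (f z)\<close>, whose modulus is
  \<open>exp (Re (f z))\<close>.\<close>

lemma Re_max_imp_const:
  assumes "f holomorphic_on ball a r" "r > 0" "\<And>z. z \<in> ball a r \<Longrightarrow> Re (f z) \<le> Re (f a)" "z \<in> ball a r"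
  shows "Re (f z) = Re (f a)"
proof -
  have "(\<lambda>z. exp (f z)) constant_on ball a r"
    by (rule maximum_modulus_principle[of _ "ball a r" "ball a r" a])
       (use assms in \<open>auto intro!: holomorphic_intros\<close>)
  then have "exp (f z) = exp (f a)" using assms(2,4) unfolding constant_on_def by (metis centre_in_ball)
  then show ?thesis by (metis exp_inj_iff norm_exp_eq_Re)
qed

text \<open>Subharmonicity of \<open>norm (F z) powr q\<close>, without integral means. If the
  difference \<open>w\<close> had a positive maximum, take a point \<open>a\<close> of largest
  modulus at which it is attained. Near \<open>a\<close> the difference is bounded below by the real
  part of a holomorphic function that agrees with it at \<open>a\<close>. That real part has a local
  maximum there, so it is constant and \<open>w\<close> stays maximal near \<open>a\<close>, also at
  points farther from 0.\<close>

lemma norm_powr_le_harmonic: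
  assumes F: "F holomorphic_on ball 0 1" "continuous_on (cball 0 1) F"
    and u: "harmonic_on u (ball 0 1)" "continuous_on (cball 0 1) u" and q: "q > 0"
    and bd: "\<And>z. norm z = 1 \<Longrightarrow> norm (F z) powr q \<le> u z"
    and z: "z \<in> cball 0 (1::real)"
  shows "norm (F z) powr q \<le> u z"
proof (rule ccontr)
  define w where "w z = norm (F z) powr q - u z" for z
  assume "\<not> ?thesis"
  then have wz: "w z > 0" by (simp add: w_def)
  have contw: "continuous_on (cball 0 1) w"
    unfolding w_def using F(2) u(2) q by (intro continuous_intros continuous_on_powr') auto
  obtain a0 where a0: "a0 \<in> cball 0 1" "\<And>y. y \<in> cball 0 1 \<Longrightarrow> w y \<le> w a0"
    using continuous_attains_sup[OF compact_cball _ contw] by (metis z empty_iff)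
  define m where "m = w a0"
  have m0: "m > 0" using a0(2)[OF z] wz by (simp add: m_def)
  define T where "T = cball 0 1 \<inter> w -` {m}"
  have "closed T" unfolding T_def by (rule continuous_on_closed_vimage[THEN iffD1, rule_format, of "cball 0 1" w, simplified Int_commute])
      (auto simp: contw Int_commute)
  then have "compact T" unfolding T_def by (metis compact_Int_closed compact_cball T_def inf_left_idem)
  moreover have "T \<noteq> {}" using a0 by (auto simp: T_def m_def)
  ultimately obtain a where a: "a \<in> T" "\<And>y. y \<in> T \<Longrightarrow> norm y \<le> norm a"
    using continuous_attains_sup[of T norm] by (auto intro: continuous_intros)
  have wa: "w a = m" and "norm a \<le> 1" using a(1) by (auto simp: T_def)
  have "norm a \<noteq> 1" using bd[of a] m0 wa by (auto simp: w_def)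
  then have a1: "a \<in> ball 0 1" using \<open>norm a \<le> 1\<close> by simp
  obtain r g where g: "r > 0" "ball a r \<subseteq> ball 0 1" "g holomorphic_on ball a r" "\<And>w. w \<in> ball a r \<Longrightarrow> u w = Re (g w)"
    using harmonic_onE[OF u(1) a1] by blast
  \<comment> \<open>Near \<open>a\<close>, a holomorphic \<open>B\<close> whose real part supports \<open>|F|^q\<close> from below at \<open>a\<close>.\<close>
  obtain s B where s: "s > 0" "s \<le> r" "B holomorphic_on ball a s"
    "\<And>y. y \<in> ball a s \<Longrightarrow> Re (B y) \<le> norm (F y) powr q" "Re (B a) = norm (F a) powr q"
  proof (cases "F a = 0")
    case True
    then show ?thesis using that[of r "\<lambda>_. 0"] g by simp
  next
    case False
    have "continuous_on (ball a r) F" using F(1) g(2) holomorphic_on_imp_continuous_on holomorphic_on_subset by blast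
    then have "isCont F a" using g(1) by (simp add: continuous_on_eq_continuous_at)
    then obtain s where s: "s > 0" "\<And>y. y \<in> ball a s \<Longrightarrow> F y \<noteq> 0"
      using continuous_at_avoid[of a F 0] False by (auto simp: mem_ball)
    define t where "t = min r s"
    have t: "t > 0" "t \<le> r" using s g by (auto simp: t_def)
    have "contractible (ball a t)" by (simp add: convex_imp_contractible)
    moreover have "ball a t \<subseteq> ball 0 1" using g(2) by (auto simp: t_def)
    then have "F holomorphic_on ball a t" using F(1) holomorphic_on_subset by blast
    moreover have "\<And>y. y \<in> ball a t \<Longrightarrow> F y \<noteq> 0" using s by (auto simp: t_def)
    ultimately obtain L where L: "L holomorphic_on ball a t" "\<And>y. y \<in> ball a t \<Longrightarrow> F y = exp (L y)"
      using contractible_imp_holomorphic_log by metis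
    \<comment> \<open>A branch of the \<open>q\<close>-th power of \<open>F\<close>, rotated so that
      its value at \<open>a\<close> is real and positive.\<close>
    define B where "B y = exp (of_real q * L y - \<i> * of_real (q * Im (L a)))" for y
    have nB: "norm (B y) = norm (F y) powr q" if "y \<in> ball a t" for y
      using L(2)[OF that] by (simp add: B_def powr_def)
    show ?thesis
    proof (rule that[of t B])
      show "B holomorphic_on ball a t" unfolding B_def by (intro holomorphic_intros L)
      show "Re (B y) \<le> norm (F y) powr q" if "y \<in> ball a t" for y
        using nB[OF that] complex_Re_le_cmod[of "B y"] by simp
      have "Im (of_real q * L a - \<i> * of_real (q * Im (L a))) = 0" by simp
      then show "Re (B a) = norm (F a) powr q" using nB[of a] t(1) by (simp add: B_def Re_exp)
    qed (use t in auto)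
  qed
  have sub: "ball a s \<subseteq> ball a r" using s by auto
  have le: "Re (B y - g y) \<le> w y \<and> w y \<le> m" if "y \<in> ball a s" for y
    using s(4)[OF that] g(4)[of y] sub that a0(2)[of y] g(2) by (force simp: w_def m_def)
  have eq: "Re (B a - g a) = m" using s(1,5) g(1,4) wa by (simp add: w_def)
  have const: "Re (B y - g y) = Re (B a - g a)" if "y \<in> ball a s" for y
  proof (rule Re_max_imp_const[of _ a s])
    show "(\<lambda>z. B z - g z) holomorphic_on ball a s"
      using s(3) g(3) sub holomorphic_on_subset by (intro holomorphic_intros) auto
  qed (use s le eq that in \<open>auto simp del: minus_complex.sel\<close>, force)
  \<comment> \<open>A point of \<open>ball a s\<close> that lies farther out than \<open>a\<close>,
    on the same ray if \<open>a\<close> is not 0.\<close>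
  define y where "y = (if a = 0 then of_real (s/2) else a + of_real (s / (2 * norm a)) * a)"
  have "dist a y = s / 2" using s(1) by (auto simp: y_def dist_norm norm_mult norm_divide)
  then have yb: "y \<in> ball a s" using s(1) by simp
  have "norm y = norm a + s / 2"
  proof (cases "a = 0")
    case False
    have "y = of_real (1 + s / (2 * norm a)) * a" using False by (simp add: y_def algebra_simps)
    then have "norm y = (1 + s / (2 * norm a)) * norm a"
      using s(1) by (simp only: norm_mult norm_of_real) (simp add: add_pos_nonneg)
    also have "\<dots> = norm a + s / 2" using False by (simp add: distrib_right)
    finally show ?thesis .
  qed (use s(1) in \<open>simp add: y_def\<close>)
  moreover have "y \<in> T"
  proof -
    have "w y = m" using le[OF yb] const[OF yb] eq by simp
    moreover have "y \<in> cball 0 1" using yb sub g(2) ball_subset_cball by blast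
    ultimately show ?thesis by (simp add: T_def)
  qed
  ultimately show False using a(2)[of y] s(1) by simp
qed

corollary harmonic_nonneg:
  assumes "harmonic_on u (ball 0 1)" "continuous_on (cball 0 1) u"
    and "\<And>z. norm z = 1 \<Longrightarrow> 0 \<le> u z" and "z \<in> cball 0 (1::real)"
  shows "0 \<le> u z"
  using norm_powr_le_harmonic[of "\<lambda>_. 0" u 1 z] assms by simp

text \<open>The product \<open>A * cnj B\<close> on the unit circle, with the negative powers of \<open>z\<close> reflected to their
  conjugates, which does not change the real part.\<close>
definition cross_poly :: "nat \<Rightarrow> (nat \<Rightarrow> complex) \<Rightarrow> nat \<Rightarrow> (nat \<Rightarrow> complex) \<Rightarrow> complex poly" where
  "cross_poly N a M b = (\<Sum>i<N. \<Sum>j<M. if j \<le> i then monom (a i * cnj (b j)) (i - j)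
      else monom (cnj (a i) * b j) (j - i))"

lemma Re_cross_poly:
  assumes "norm z = 1"
  shows "Re (poly (cross_poly N a M b) z) = Re ((\<Sum>i<N. a i * z ^ i) * cnj (\<Sum>j<M. b j * z ^ j))"
proof -
  have zz: "z * cnj z = 1" using assms by (simp add: complex_norm_square[symmetric])
  have pw: "z ^ k * cnj z ^ k = 1" for k using zz by (simp add: power_mult_distrib[symmetric])
  have "Re (poly (if j \<le> i then monom (a i * cnj (b j)) (i - j) else monom (cnj (a i) * b j) (j - i)) z)
     = Re (a i * z ^ i * cnj (b j * z ^ j))" for i j
  proof (cases "j \<le> i")
    case True
    then obtain k where k: "i = j + k" using le_Suc_ex by blast
    have "a i * z ^ i * cnj (b j * z ^ j) = (a i * cnj (b j) * z ^ k) * (z ^ j * cnj z ^ j)"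
      by (simp add: k power_add algebra_simps)
    then have "Re (a i * z ^ i * cnj (b j * z ^ j)) = Re (a i * cnj (b j) * z ^ k)"
      by (simp only: pw mult_1_right)
    then show ?thesis using True k by (simp add: poly_monom)
  next
    case False
    then obtain k where k: "j = i + k" using le_Suc_ex nat_le_linear by metis
    have "a i * z ^ i * cnj (b j * z ^ j) = cnj (cnj (a i) * b j * z ^ k) * (z ^ i * cnj z ^ i)"
      by (simp add: k power_add algebra_simps)
    then have "Re (a i * z ^ i * cnj (b j * z ^ j)) = Re (cnj (a i) * b j * z ^ k)"
      by (simp only: pw mult_1_right cnj.sel)
    then show ?thesis using False k by (simp add: poly_monom)
  qed
  then show ?thesis
    unfolding cross_poly_def poly_sum Re_sum sum_product cnj_sum by simp
qed

text \<open>Parseval's identity in disguise: the real part of the polynomial is the harmonic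
  extension of the squared modulus from the circle, and its value at 0 is the mean over the circle.
  Only the diagonal terms have exponent 0.\<close>

lemma cross_poly_0: "poly (cross_poly N a N a) 0 = of_real (\<Sum>i<N. (norm (a i))\<^sup>2)"
proof -
  have "poly (if j \<le> i then monom (a i * cnj (a j)) (i - j) else monom (cnj (a i) * a j) (j - i)) 0
      = (if j = i then of_real ((norm (a i))\<^sup>2) else 0)" for i j
    by (auto simp: poly_monom power_0_left complex_norm_square simp del: of_real_power)
  then show ?thesis unfolding cross_poly_def poly_sum by simp
qed

text \<open>Both sides agree on the circle by \<open>Re_cross_poly\<close>, so the maximum principle
  applies with exponent 2.\<close>

lemma norm_square_le_cross_poly:
  assumes "z \<in> cball 0 1"
  shows "(norm (\<Sum>i<N. a i * z ^ i))\<^sup>2 \<le> Re (poly (cross_poly N a N a) z)"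
proof -
  have "norm (\<Sum>i<N. a i * z ^ i) powr 2 \<le> Re (poly (cross_poly N a N a) z)"
  proof (rule norm_powr_le_harmonic[OF _ _ _ _ _ _ assms])
    show "harmonic_on (\<lambda>z. Re (poly (cross_poly N a N a) z)) (ball 0 1)"
      by (intro harmonic_on_Re holomorphic_intros) auto
    show "norm (\<Sum>i<N. a i * z ^ i) powr 2 \<le> Re (poly (cross_poly N a N a) z)" if "norm z = 1" for z
      unfolding Re_cross_poly[OF that] complex_norm_square[symmetric] by simp
  qed (auto intro!: holomorphic_intros continuous_intros)
  then show ?thesis by simp
qed

text \<open>Stone-Weierstrass: real parts of polynomials form an algebra on the circle, since
  \<open>Re P * Re Q\<close> is half the real part of \<open>P * Q + P * cnj Q\<close>, and
  \<open>cross_poly\<close> replaces the second summand by a polynomial. The normalization at 0,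
  reached by subtracting an imaginary constant, makes the square of \<open>poly P 0\<close>
  nonnegative.\<close>

lemma circle_Re_poly_approx:
  assumes "continuous_on (sphere 0 1) b" "e > 0"
  obtains P where "\<And>z. norm z = 1 \<Longrightarrow> \<bar>b z - Re (poly P z)\<bar> < e" "Im (poly P 0) = 0"
proof -
  define R where "R = {f. \<exists>P. \<forall>z. norm z = 1 \<longrightarrow> f z = Re (poly P z)}"
  interpret function_ring_on R "sphere (0::complex) 1"
  proof
    show "continuous_on (sphere 0 1) f" if fR: "f \<in> R" for f
    proof -
      obtain P where P: "\<forall>z. norm z = 1 \<longrightarrow> f z = Re (poly P z)" using fR by (auto simp: R_def)
      show ?thesis by (subst continuous_on_cong[OF refl, of _ f "\<lambda>z. Re (poly P z)"])
           (use P in \<open>auto intro!: continuous_intros\<close>)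
    qed
    show "(\<lambda>x. f x + g x) \<in> R" if fg: "f \<in> R" "g \<in> R" for f g
    proof -
      obtain P Q where "\<forall>z. norm z = 1 \<longrightarrow> f z = Re (poly P z)" "\<forall>z. norm z = 1 \<longrightarrow> g z = Re (poly Q z)"
        using fg by (auto simp: R_def)
      then show ?thesis unfolding R_def by (auto intro!: exI[of _ "P + Q"])
    qed
    show "(\<lambda>x. f x * g x) \<in> R" if fg: "f \<in> R" "g \<in> R" for f g
    proof -
      obtain P Q where PQ: "\<forall>z. norm z = 1 \<longrightarrow> f z = Re (poly P z)" "\<forall>z. norm z = 1 \<longrightarrow> g z = Re (poly Q z)"
        using fg by (auto simp: R_def)
      define C where "C = cross_poly (Suc (degree P)) (coeff P) (Suc (degree Q)) (coeff Q)"
      have "f z * g z = Re (poly (smult (1/2) (P * Q + C)) z)" if z: "norm z = 1" for z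
      proof -
        have "Re (poly C z) = Re (poly P z * cnj (poly Q z))"
          unfolding C_def Re_cross_poly[OF z]
          by (simp only: poly_altdef[of P z] poly_altdef[of Q z] lessThan_Suc_atMost)
        then show ?thesis using PQ z by (simp add: field_simps)
      qed
      then show ?thesis unfolding R_def by blast
    qed
    show "(\<lambda>_. c) \<in> R" for c unfolding R_def by (auto intro!: exI[of _ "[:of_real c:]"])
    show "\<exists>f\<in>R. f x \<noteq> f y" if "x \<noteq> y" for x y
    proof (cases "Re x = Re y")
      case False
      then show ?thesis unfolding R_def by (intro bexI[of _ Re]) (auto intro!: exI[of _ "[:0,1:]"])
    next
      case True
      then have "Im x \<noteq> Im y" using that complex_eq_iff by blast
      then show ?thesis unfolding R_def by (intro bexI[of _ Im]) (auto intro!: exI[of _ "[:0,-\<i>:]"])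
    qed
  qed auto
  obtain g where "g \<in> R" and "\<forall>z\<in>sphere 0 1. \<bar>b z - g z\<bar> < e"
    using Stone_Weierstrass_basic[OF assms] by blast
  moreover from \<open>g \<in> R\<close> obtain P where "\<forall>z. norm z = 1 \<longrightarrow> g z = Re (poly P z)" by (auto simp: R_def)
  ultimately have P: "\<And>z. norm z = 1 \<Longrightarrow> \<bar>b z - Re (poly P z)\<bar> < e" by simp
  show thesis
    by (rule that[of "P - [:\<i> * of_real (Im (poly P 0)):]"]) (use P in auto)
qed

text \<open>Montel's theorem is applied to \<open>exp (- G n z)\<close>, which is bounded by 1
  because \<open>Re (G n z) \<ge> 0\<close>. The bound at 0 keeps the limit nonzero there, Hurwitz's
  theorem makes it zero-free, and minus its logarithm is the required \<open>g\<close>.\<close>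

lemma harmonic_majorant_limit:
  assumes hol: "\<And>n::nat. G n holomorphic_on ball 0 1"
    and v: "\<And>n z. z \<in> ball 0 1 \<Longrightarrow> 0 \<le> v n z" "\<And>n z. z \<in> ball 0 1 \<Longrightarrow> v n z \<le> Re (G n z)"
    and lim: "\<And>z. z \<in> ball 0 1 \<Longrightarrow> (\<lambda>n. v n z) \<longlonglongrightarrow> w z"
    and M: "\<And>n. Re (G n 0) \<le> M"
  obtains g where "g holomorphic_on ball 0 (1::real)" "\<And>z. z \<in> ball 0 1 \<Longrightarrow> w z \<le> Re (g z)" "Re (g 0) \<le> M"
proof -
  define E where "E n z = exp (- G n z)" for n z
  have E1: "norm (E n z) \<le> exp (- v n z)" "exp (- v n z) \<le> 1" if "z \<in> ball 0 1" for n z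
    using v[OF that, of n] by (simp_all add: E_def)
  have E1': "norm (E n z) \<le> 1" if "z \<in> ball 0 1" for n z using E1[OF that] order_trans by blast
  have holE: "E n holomorphic_on ball 0 1" for n unfolding E_def by (intro holomorphic_intros hol)
  obtain e r where e: "e holomorphic_on ball 0 1" "strict_mono (r :: nat \<Rightarrow> nat)"
    "\<And>x. x \<in> ball 0 1 \<Longrightarrow> (\<lambda>n. E (r n) x) \<longlonglongrightarrow> e x"
    "\<And>K. compact K \<Longrightarrow> K \<subseteq> ball 0 1 \<Longrightarrow> uniform_limit K (E \<circ> r) e sequentially"
  proof (rule Montel[of "ball 0 1" "range E" E])
    show "\<exists>B. \<forall>h\<in>range E. \<forall>z\<in>K. norm (h z) \<le> B" if "K \<subseteq> ball 0 1" for K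
      using that E1' by (intro exI[of _ 1]) blast
  qed (use holE in auto)
  have E0: "exp (- M) \<le> norm (e 0)"
  proof (rule tendsto_lowerbound[OF tendsto_norm[OF e(3)]])
    show "\<forall>\<^sub>F n in sequentially. exp (- M) \<le> norm (E (r n) 0)" using M by (simp add: E_def)
  qed auto
  \<comment> \<open>Hurwitz's theorem needs a nonconstant limit; a constant limit equals its value
    at 0, which is nonzero by \<open>E0\<close>.\<close>
  have nz: "e z \<noteq> 0" if z: "z \<in> ball 0 1" for z
  proof (cases "e constant_on ball 0 1")
    case True
    then have "e z = e 0" using z unfolding constant_on_def by (metis centre_in_ball zero_less_one)
    then show ?thesis using E0 by (metis exp_gt_zero norm_zero not_le)
  next
    case False
    show ?thesis
      by (rule Hurwitz_no_zeros[of "ball 0 1" "E \<circ> r" e]) (use holE e False z in \<open>auto simp: E_def\<close>)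
  qed
  have "contractible (ball (0::complex) 1)" by (simp add: convex_imp_contractible)
  then obtain l where l: "l holomorphic_on ball 0 1" "\<And>z. z \<in> ball 0 1 \<Longrightarrow> e z = exp (l z)"
    using contractible_imp_holomorphic_log[OF e(1)] nz by metis
  show thesis
  proof (rule that[of "\<lambda>z. - l z"])
    show "(\<lambda>z. - l z) holomorphic_on ball 0 1" by (intro holomorphic_intros l)
    show "Re (- l 0) \<le> M" using E0 l(2)[of 0] by simp
    show "w z \<le> Re (- l z)" if z: "z \<in> ball 0 1" for z
    proof -
      have 1: "(\<lambda>n. norm (E (r n) z)) \<longlonglongrightarrow> norm (e z)" by (intro tendsto_norm e(3) z)
      have 2: "(\<lambda>n. exp (- v (r n) z)) \<longlonglongrightarrow> exp (- w z)"
        using LIMSEQ_subseq_LIMSEQ[OF lim[OF z] e(2)] by (intro tendsto_intros) (simp add: o_def)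
      have "norm (e z) \<le> exp (- w z)"
        by (rule tendsto_le[OF _ 2 1]) (use E1[OF z] in auto)
      then show ?thesis using l(2)[OF z] by simp
    qed
  qed
qed

section \<open>Square-integrable majorants\<close>

text \<open>The direction of H^2 theory that leads from coefficients to majorants; the converse is
  \<open>taylor_coeffs_square_le\<close>. The squared partial sums are majorized by the real parts
  of their cross polynomials, whose values at 0 are at most \<open>M\<close>, and majorants pass to
  the limit.\<close>

lemma square_summable_power_series_majorant:
  assumes f: "\<And>z. z \<in> ball 0 1 \<Longrightarrow> (\<lambda>n. a n * z ^ n) sums f z"
    and M: "\<And>N. (\<Sum>n<N. (norm (a n))\<^sup>2) \<le> M"
  obtains g where "g holomorphic_on ball 0 (1::real)" "\<And>z. z \<in> ball 0 1 \<Longrightarrow> (norm (f z))\<^sup>2 \<le> Re (g z)" "Re (g 0) \<le> M"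
proof -
  define G where "G N z = poly (cross_poly N a N a) z" for N z
  define v where "v N z = (norm (\<Sum>i<N. a i * z ^ i))\<^sup>2" for N z
  show thesis
  proof (rule harmonic_majorant_limit[of G v "\<lambda>z. (norm (f z))\<^sup>2" M])
    show "G n holomorphic_on ball 0 1" for n unfolding G_def by (intro holomorphic_intros)
    show "v n z \<le> Re (G n z)" if "z \<in> ball 0 1" for n z
      using norm_square_le_cross_poly[of z a n] that unfolding v_def G_def by simp
    show "(\<lambda>n. v n z) \<longlonglongrightarrow> (norm (f z))\<^sup>2" if "z \<in> ball 0 1" for z
      using f[OF that] unfolding v_def sums_def by (intro tendsto_intros)
    show "Re (G n 0) \<le> M" for n using M[of n] by (simp add: G_def cross_poly_0)
  qed (use that in \<open>auto simp: v_def\<close>)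
qed

lemma taylor_sums_ball:
  assumes "f holomorphic_on ball 0 1" "z \<in> ball 0 (1::real)"
  shows "(\<lambda>n. (deriv ^^ n) f 0 / fact n * z ^ n) sums f z"
  using holomorphic_power_series[OF assms] by simp

lemma taylor_uniform_cball:
  assumes f: "f holomorphic_on ball 0 (1::real)" and r: "r < 1" and e: "e > 0"
  obtains K where "\<And>n z. n \<ge> K \<Longrightarrow> z \<in> cball 0 r \<Longrightarrow>
    norm ((\<Sum>i<n. (deriv ^^ i) f 0 / fact i * z ^ i) - f z) < e"
proof -
  define a where "a n = (deriv ^^ n) f 0 / fact n" for n
  have sums: "(\<lambda>n. a n * z ^ n) sums f z" if "z \<in> ball 0 1" for z
    using taylor_sums_ball[OF f that] by (simp add: a_def)
  have "ereal r < conv_radius a"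
  proof -
    \<comment> \<open>The series converges at the point \<open>R\<close> between \<open>r\<close>
      and 1, so its radius of convergence exceeds \<open>r\<close>. The \<open>max\<close> covers
      negative \<open>r\<close>.\<close>
    define R where "R = (1 + max 0 r) / 2"
    have R: "r < R" "0 < R" "R < 1" using r by (auto simp: R_def)
    then have "complex_of_real R \<in> ball 0 1" by simp
    then have "summable (\<lambda>n. a n * of_real R ^ n)" by (rule sums_summable[OF sums])
    then have "ereal (norm (complex_of_real R)) \<le> conv_radius a" by (rule conv_radius_geI)
    moreover have "ereal r < ereal (norm (complex_of_real R))" using R by simp
    ultimately show ?thesis by order
  qed
  then have "uniform_limit (cball 0 r) (\<lambda>n z. \<Sum>i<n. a i * (z - 0) ^ i) (\<lambda>z. \<Sum>i. a i * (z - 0) ^ i) sequentially"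
    by (rule powser_uniform_limit)
  then have "\<forall>\<^sub>F n in sequentially. \<forall>z\<in>cball 0 r. dist (\<Sum>i<n. a i * (z - 0) ^ i) (\<Sum>i. a i * (z - 0) ^ i) < e"
    using e unfolding uniform_limit_iff by blast
  then obtain K where K: "\<And>n z. n \<ge> K \<Longrightarrow> z \<in> cball 0 r \<Longrightarrow> dist (\<Sum>i<n. a i * (z - 0) ^ i) (\<Sum>i. a i * (z - 0) ^ i) < e"
    unfolding eventually_sequentially by blast
  show thesis
  proof (rule that[of K])
    fix n and z :: complex assume nz: "n \<ge> K" "z \<in> cball 0 r"
    then have "(\<Sum>i. a i * z ^ i) = f z" using sums[of z] r by (intro sums_unique[symmetric]) auto
    then show "norm ((\<Sum>i<n. (deriv ^^ i) f 0 / fact i * z ^ i) - f z) < e"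
      using K[OF nz] by (simp add: dist_norm a_def)
  qed
qed

text \<open>On the circle of radius \<open>r\<close> a long Taylor polynomial is uniformly close to
  \<open>f\<close>, so its squared modulus is at most \<open>u + d\<close> there. The harmonic
  extension of that square has at 0 the sum of the squared coefficients, damped by powers of
  \<open>r\<close>, as its value. Finally \<open>d\<close> tends to 0 and \<open>r\<close> to
  1.\<close>

lemma taylor_coeffs_square_le:
  assumes f: "f holomorphic_on ball 0 (1::real)" and u: "harmonic_on u (ball 0 1)"
    and fu: "\<And>z. z \<in> ball 0 1 \<Longrightarrow> (norm (f z))\<^sup>2 \<le> u z"
  shows "(\<Sum>n<N. (norm ((deriv ^^ n) f 0 / fact n))\<^sup>2) \<le> u 0"
proof -
  define a where "a n = (deriv ^^ n) f 0 / fact n" for n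
  have sums: "(\<lambda>n. a n * z ^ n) sums f z" if "z \<in> ball 0 1" for z
    using taylor_sums_ball[OF f that] by (simp add: a_def)
  have 1: "(\<Sum>n<N. (norm (a n * of_real (r ^ n)))\<^sup>2) \<le> u 0 + d" if r: "0 < r" "r < 1" and d: "d > 0" for r d
  proof -
    have rb: "of_real r * z \<in> ball 0 1" if "z \<in> cball 0 1" for z :: complex
    proof -
      have "r * norm z \<le> r * 1" using that r by (intro mult_left_mono) auto
      then have "r * norm z < 1" using r by linarith
      then show ?thesis using r by (simp add: norm_mult)
    qed
    have contf: "continuous_on (ball 0 1) f" using f holomorphic_on_imp_continuous_on by blast
    have "compact (f ` cball 0 r)"
      using contf r by (intro compact_continuous_image continuous_on_subset[OF contf]) auto
    then obtain B where B: "\<And>z. z \<in> cball 0 r \<Longrightarrow> norm (f z) \<le> B" "B > 0"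
      using compact_imp_bounded bounded_pos by (metis imageI)
    \<comment> \<open>Squaring \<open>norm f + e\<close> adds at most \<open>e * (2 * B + 1)\<close>
      when \<open>e \<le> 1\<close> and \<open>norm f \<le> B\<close>.\<close>
    define e where "e = min 1 (d / (2 * B + 1))"
    have "e \<le> d / (2 * B + 1)" by (simp add: e_def)
    then have "e * (2 * B + 1) \<le> d" using B(2) by (subst (asm) pos_le_divide_eq) auto
    moreover have "e > 0" "e \<le> 1" using d B(2) by (auto simp: e_def)
    ultimately have e: "e > 0" "e \<le> 1" "e * (2 * B + 1) \<le> d" by auto
    obtain K where K: "\<And>n z. n \<ge> K \<Longrightarrow> z \<in> cball 0 r \<Longrightarrow> norm ((\<Sum>i<n. a i * z ^ i) - f z) < e"
      using taylor_uniform_cball[OF f r(2) e(1)] unfolding a_def by blast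
    \<comment> \<open>At least \<open>K\<close> for the approximation, and at least \<open>N\<close>
      so that all coefficients of the claim occur.\<close>
    define n where "n = max K N"
    define b where "b i = a i * of_real (r ^ i)" for i
    have bs: "(\<Sum>i<n. b i * z ^ i) = (\<Sum>i<n. a i * (of_real r * z) ^ i)" for z
      by (simp add: b_def power_mult_distrib algebra_simps)
    have bd: "Re (poly (cross_poly n b n b) z) \<le> u (of_real r * z) + d" if z: "norm z = 1" for z
    proof -
      have zr: "of_real r * z \<in> cball 0 r" "of_real r * z \<in> ball 0 1" using z r by (auto simp: norm_mult)
      have "norm (\<Sum>i<n. b i * z ^ i) \<le> norm (f (of_real r * z)) + e"
        using K[of n, OF _ zr(1)] norm_triangle_sub[of "\<Sum>i<n. a i * (of_real r * z) ^ i" "f (of_real r * z)"]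
        unfolding bs by (simp add: n_def)
      then have "(norm (\<Sum>i<n. b i * z ^ i))\<^sup>2 \<le> (norm (f (of_real r * z)) + e)\<^sup>2"
        by (rule power_mono) simp
      also have "\<dots> = (norm (f (of_real r * z)))\<^sup>2 + e * (2 * norm (f (of_real r * z)) + e)"
        by (simp add: power2_eq_square algebra_simps)
      also have "\<dots> \<le> u (of_real r * z) + e * (2 * B + 1)"
        using e B(1)[OF zr(1)] by (intro add_mono fu zr mult_left_mono) auto
      also have "\<dots> \<le> u (of_real r * z) + d" using e by simp
      finally show ?thesis
        unfolding Re_cross_poly[OF z] complex_norm_square[symmetric] by simp
    qed
    have "0 \<le> u (of_real r * 0) + d - Re (poly (cross_poly n b n b) 0)"
    proof (rule harmonic_nonneg[where u="\<lambda>z. u (of_real r * z) + d - Re (poly (cross_poly n b n b) z)"])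
      have h: "harmonic_on (\<lambda>z. u (of_real r * z)) (ball 0 1)"
        by (rule harmonic_on_compose[OF u]) (use rb in \<open>auto intro!: holomorphic_intros\<close>)
      show "harmonic_on (\<lambda>z. u (of_real r * z) + d - Re (poly (cross_poly n b n b) z)) (ball 0 1)"
        by (intro harmonic_on_diff harmonic_on_add h harmonic_on_const harmonic_on_Re holomorphic_intros) auto
      have "continuous_on (cball 0 1) (\<lambda>z. u (of_real r * z))"
        by (rule continuous_on_compose2[OF harmonic_on_imp_continuous_on[OF u]])
           (use rb in \<open>auto intro!: continuous_intros simp del: mem_ball\<close>)
      then show "continuous_on (cball 0 1) (\<lambda>z. u (of_real r * z) + d - Re (poly (cross_poly n b n b) z))"
        by (intro continuous_intros)
    qed (use bd in \<open>auto simp: algebra_simps\<close>)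
    then have "(\<Sum>i<n. (norm (b i))\<^sup>2) \<le> u 0 + d" by (simp add: cross_poly_0)
    moreover have "(\<Sum>i<N. (norm (b i))\<^sup>2) \<le> (\<Sum>i<n. (norm (b i))\<^sup>2)"
      by (intro sum_mono2) (auto simp: n_def)
    ultimately show ?thesis by (simp add: b_def)
  qed
  have 2: "(\<Sum>n<N. (norm (a n * of_real (r ^ n)))\<^sup>2) \<le> u 0" if r: "0 < r" "r < 1" for r
    using 1[OF r] field_le_epsilon by blast
  have "((\<lambda>r. \<Sum>n<N. (norm (a n * of_real (r ^ n)))\<^sup>2) \<longlongrightarrow> (\<Sum>n<N. (norm (a n * of_real (1 ^ n)))\<^sup>2)) (at_left 1)"
    by (intro tendsto_intros)
  moreover have "\<forall>\<^sub>F r in at_left 1. (\<Sum>n<N. (norm (a n * of_real (r ^ n)))\<^sup>2) \<le> u 0"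
    by (rule eventually_mono[OF eventually_at_left_real[of 0 1]]) (use 2 in auto)
  ultimately have "(\<Sum>n<N. (norm (a n * of_real (1 ^ n)))\<^sup>2) \<le> u 0"
    by (intro tendsto_upperbound) auto
  then show ?thesis by (simp add: a_def)
qed

lemma powr_half_square: "(x::real) \<ge> 0 \<Longrightarrow> (x powr (p/2))\<^sup>2 = x powr p"
  by (simp add: power2_eq_square powr_add[symmetric])

text \<open>On the circle \<open>(Re A)\<^sup>2\<close> is at most \<open>2 u + 8\<close> and is the real part of half the sum of \<open>A\<^sup>2\<close> and the
  polynomial representing \<open>|A|\<^sup>2\<close>; comparing values at \<open>0\<close> bounds the coefficients.\<close>
lemma circle_majorant_poly:
  assumes F: "F holomorphic_on ball 0 (1::real)" and u: "harmonic_on u (ball 0 1)" and p: "p > 0"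
    and Fu: "\<And>z. z \<in> ball 0 1 \<Longrightarrow> norm (F z) powr p \<le> u z" and r: "0 < r" "r < 1"
  obtains A where "\<And>z. z \<in> ball 0 1 \<Longrightarrow> norm (F (of_real r * z)) powr (p/2) \<le> Re (poly A z)"
    "(\<Sum>i\<le>degree A. (norm (coeff A i))\<^sup>2) \<le> 4 * u 0 + 16"
proof -
  have rb: "of_real r * z \<in> ball 0 1" if "z \<in> cball 0 1" for z :: complex
  proof -
    have "r * norm z \<le> r * 1" using that r by (intro mult_left_mono) auto
    then have "r * norm z < 1" using r by linarith
    then show ?thesis using r by (simp add: norm_mult)
  qed
  have contF: "continuous_on (cball 0 1) (\<lambda>z. F (of_real r * z))"
    by (rule continuous_on_compose2[OF holomorphic_on_imp_continuous_on[OF F]])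
       (use rb in \<open>auto intro!: continuous_intros simp del: mem_ball\<close>)
  have contu: "continuous_on (cball 0 1) (\<lambda>z. u (of_real r * z))"
    by (rule continuous_on_compose2[OF harmonic_on_imp_continuous_on[OF u]])
       (use rb in \<open>auto intro!: continuous_intros simp del: mem_ball\<close>)
  have holF: "(\<lambda>z. F (of_real r * z)) holomorphic_on ball 0 1"
    using holomorphic_on_compose_gen[of "\<lambda>z. of_real r * z" "ball 0 1" F "ball 0 1"] F rb
    by (force intro!: holomorphic_intros simp: o_def)
  have h: "harmonic_on (\<lambda>z. u (of_real r * z)) (ball 0 1)"
    by (rule harmonic_on_compose[OF u]) (use rb in \<open>auto intro!: holomorphic_intros\<close>)
  \<comment> \<open>The summand 1 outweighs the approximation error, so \<open>Re (poly A z)\<close>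
    still dominates the power of \<open>norm F\<close> on the circle.\<close>
  define b where "b z = norm (F (of_real r * z)) powr (p/2) + 1" for z
  have "continuous_on (sphere 0 1) b" unfolding b_def
    using continuous_on_subset[OF contF, of "sphere 0 1"] p
    by (intro continuous_intros continuous_on_powr') auto
  then obtain A where A: "\<And>z. norm z = 1 \<Longrightarrow> \<bar>b z - Re (poly A z)\<bar> < 1" and A0: "Im (poly A 0) = 0"
    using circle_Re_poly_approx[of b 1] by auto
  define C where "C = cross_poly (Suc (degree A)) (coeff A) (Suc (degree A)) (coeff A)"
  show thesis
  proof (rule that)
    show "norm (F (of_real r * z)) powr (p/2) \<le> Re (poly A z)" if "z \<in> ball 0 1" for z
    proof (rule norm_powr_le_harmonic[where q="p/2" and F="\<lambda>z. F (of_real r * z)" and u="\<lambda>z. Re (poly A z)"])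
      show "norm (F (of_real r * z)) powr (p/2) \<le> Re (poly A z)" if "norm z = 1" for z
        using A[OF that] by (simp add: b_def)
    qed (use holF contF p that in \<open>auto intro!: harmonic_on_Re holomorphic_intros continuous_intros\<close>)
    have "0 \<le> 2 * u (of_real r * 0) + 8 - Re (poly (smult (1/2) (C + A * A)) 0)"
    proof (rule harmonic_nonneg[where u="\<lambda>z. 2 * u (of_real r * z) + 8 - Re (poly (smult (1/2) (C + A * A)) z)"])
      show "harmonic_on (\<lambda>z. 2 * u (of_real r * z) + 8 - Re (poly (smult (1/2) (C + A * A)) z)) (ball 0 1)"
        by (intro harmonic_on_diff harmonic_on_add harmonic_on_cmult h harmonic_on_const harmonic_on_Re holomorphic_intros) auto
      show "continuous_on (cball 0 1) (\<lambda>z. 2 * u (of_real r * z) + 8 - Re (poly (smult (1/2) (C + A * A)) z))"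
        by (intro continuous_intros contu)
      fix z :: complex assume z: "norm z = 1"
      have zr: "of_real r * z \<in> ball 0 1" using rb[of z] z by simp
      define c where "c = norm (F (of_real r * z)) powr (p/2)"
      have c: "c \<ge> 0" "c \<le> Re (poly A z)" "Re (poly A z) \<le> c + 2" using A[OF z] by (auto simp: c_def b_def)
      have "Re (poly C z) = Re (poly A z * cnj (poly A z))"
        unfolding C_def Re_cross_poly[OF z] by (simp only: poly_altdef[of A z] lessThan_Suc_atMost)
      then have "Re (poly (smult (1/2) (C + A * A)) z) = (Re (poly A z))\<^sup>2"
        by (simp add: power2_eq_square)
      also have "\<dots> \<le> (c + 2)\<^sup>2" using c by (intro power_mono) auto
      also have "\<dots> \<le> 2 * c\<^sup>2 + 8"
        using zero_le_power2[of "c - 2"] by (simp add: power2_eq_square algebra_simps)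
      also have "c\<^sup>2 \<le> u (of_real r * z)" using Fu[OF zr] by (simp add: c_def powr_half_square)
      finally show "0 \<le> 2 * u (of_real r * z) + 8 - Re (poly (smult (1/2) (C + A * A)) z)" by simp
    qed auto
    moreover have "Re (poly A 0 * poly A 0) \<ge> 0" using A0 by simp
    moreover have "Re (poly C 0) = (\<Sum>i\<le>degree A. (norm (coeff A i))\<^sup>2)"
      unfolding C_def cross_poly_0 lessThan_Suc_atMost by simp
    ultimately show "(\<Sum>i\<le>degree A. (norm (coeff A i))\<^sup>2) \<le> 4 * u 0 + 16" by simp
  qed
qed

text \<open>\<open>P\<close> replaces the Poisson extension of the boundary values of
  \<open>norm F powr (p/2)\<close>. The polynomials found for radii tending to 1 have coefficients
  bounded by \<open>sqrt M\<close>, so they form a normal family. A limit \<open>P\<close> inherits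
  the inequality, and the limit of the majorants of the squared polynomials bounds the coefficients
  of \<open>P\<close>.\<close>

lemma square_integrable_majorant:
  assumes F: "F holomorphic_on ball 0 (1::real)" and u: "harmonic_on u (ball 0 1)" and p: "p > 0"
    and Fu: "\<And>z. z \<in> ball 0 1 \<Longrightarrow> norm (F z) powr p \<le> u z"
  obtains P M where "P holomorphic_on ball 0 1" "\<And>z. z \<in> ball 0 1 \<Longrightarrow> norm (F z) powr (p/2) \<le> Re (P z)"
    "\<And>N. (\<Sum>n<N. (norm ((deriv ^^ n) P 0 / fact n))\<^sup>2) \<le> M"
proof -
  define M where "M = 4 * u 0 + 16"
  \<comment> \<open>Two successors, because a single one would give radius 0 for
    \<open>n = 0\<close>.\<close>
  define \<rho> where "\<rho> n = 1 - inverse (real (Suc (Suc n)))" for n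
  have \<rho>: "0 < \<rho> n" "\<rho> n < 1" for n by (auto simp: \<rho>_def field_simps)
  have "\<exists>A. (\<forall>z\<in>ball 0 1. norm (F (of_real (\<rho> n) * z)) powr (p/2) \<le> Re (poly A z)) \<and>
     (\<Sum>i\<le>degree A. (norm (coeff A i))\<^sup>2) \<le> M" for n
    using circle_majorant_poly[OF F u p Fu \<rho>[of n]] unfolding M_def by metis
  then obtain A where A: "\<And>n z. z \<in> ball 0 1 \<Longrightarrow> norm (F (of_real (\<rho> n) * z)) powr (p/2) \<le> Re (poly (A n) z)"
     "\<And>n. (\<Sum>i\<le>degree (A n). (norm (coeff (A n) i))\<^sup>2) \<le> M" by metis
  have M0: "M \<ge> 0" using A(2)[of 0] by (meson order_trans sum_nonneg zero_le_power2)
  have coeff: "norm (coeff (A n) i) \<le> sqrt M" for n i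
  proof (cases "i \<le> degree (A n)")
    case True
    then have "(norm (coeff (A n) i))\<^sup>2 \<le> (\<Sum>i\<le>degree (A n). (norm (coeff (A n) i))\<^sup>2)"
      by (intro member_le_sum) auto
    then show ?thesis using A(2)[of n] real_le_rsqrt order_trans by blast
  qed (use M0 in \<open>simp add: coeff_eq_0\<close>)
  have bound: "norm (poly (A n) z) \<le> sqrt M * (1 / (1 - R))" if z: "norm z \<le> R" "R < 1" for n z R
  proof -
    have R0: "R \<ge> 0" using z(1) norm_ge_zero order_trans by blast
    have "norm (poly (A n) z) \<le> (\<Sum>i\<le>degree (A n). norm (coeff (A n) i * z ^ i))"
      unfolding poly_altdef by (rule norm_sum)
    also have "\<dots> \<le> (\<Sum>i\<le>degree (A n). sqrt M * R ^ i)"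
      using z M0 by (intro sum_mono) (auto simp: norm_mult norm_power intro!: mult_mono coeff power_mono)
    also have "\<dots> = sqrt M * (\<Sum>i\<le>degree (A n). R ^ i)" by (simp add: sum_distrib_left)
    also have "(\<Sum>i\<le>degree (A n). R ^ i) \<le> (\<Sum>i. R ^ i)"
      using R0 z(2) by (intro sum_le_suminf summable_geometric) auto
    also have "(\<Sum>i. R ^ i) = 1 / (1 - R)" using R0 z(2) by (intro suminf_geometric) auto
    finally show ?thesis using M0 by (simp add: mult_left_mono)
  qed
  obtain P s where P: "P holomorphic_on ball 0 1" "strict_mono (s :: nat \<Rightarrow> nat)"
    "\<And>x. x \<in> ball 0 1 \<Longrightarrow> (\<lambda>n. poly (A (s n)) x) \<longlonglongrightarrow> P x"
  proof (rule Montel[of "ball 0 1" "range (\<lambda>n. poly (A n))" "\<lambda>n. poly (A n)"])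
    fix K :: "complex set" assume K: "compact K" "K \<subseteq> ball 0 1"
    obtain R where R: "R < 1" "\<And>z. z \<in> K \<Longrightarrow> norm z \<le> R"
    proof (cases "K = {}")
      case False
      then obtain a where "a \<in> K" "\<And>z. z \<in> K \<Longrightarrow> norm z \<le> norm a"
        using continuous_attains_sup[OF K(1), of norm] by (auto intro: continuous_intros)
      then show ?thesis using that[of "norm a"] K(2) by auto
    qed (use that[of 0] in auto)
    then show "\<exists>B. \<forall>h\<in>range (\<lambda>n. poly (A n)). \<forall>z\<in>K. norm (h z) \<le> B"
      using bound[OF R(2) R(1)] by blast
  qed (auto intro!: holomorphic_intros)
  have \<rho>lim: "\<rho> \<longlonglongrightarrow> 1"
    using tendsto_diff[OF tendsto_const LIMSEQ_Suc[OF LIMSEQ_inverse_real_of_nat], of 1]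
    unfolding \<rho>_def[abs_def] by simp
  obtain g where g: "g holomorphic_on ball 0 (1::real)" "\<And>z. z \<in> ball 0 1 \<Longrightarrow> (norm (P z))\<^sup>2 \<le> Re (g z)"
  proof (rule harmonic_majorant_limit[of
        "\<lambda>n z. poly (cross_poly (Suc (degree (A (s n)))) (coeff (A (s n))) (Suc (degree (A (s n)))) (coeff (A (s n)))) z"
        "\<lambda>n z. (norm (poly (A (s n)) z))\<^sup>2" "\<lambda>z. (norm (P z))\<^sup>2" M])
    show "(norm (poly (A (s n)) z))\<^sup>2 \<le> Re (poly (cross_poly (Suc (degree (A (s n)))) (coeff (A (s n))) (Suc (degree (A (s n)))) (coeff (A (s n)))) z)"
      if "z \<in> ball 0 1" for n z
      using norm_square_le_cross_poly[of z "coeff (A (s n))" "Suc (degree (A (s n)))"] that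
      by (simp only: poly_altdef[of "A (s n)" z] lessThan_Suc_atMost) (simp add: dist_norm)
    show "(\<lambda>n. (norm (poly (A (s n)) z))\<^sup>2) \<longlonglongrightarrow> (norm (P z))\<^sup>2" if "z \<in> ball 0 1" for z
      by (intro tendsto_intros P that)
    show "Re (poly (cross_poly (Suc (degree (A (s n)))) (coeff (A (s n))) (Suc (degree (A (s n)))) (coeff (A (s n)))) 0) \<le> M" for n
      using A(2)[of "s n"] unfolding cross_poly_0 lessThan_Suc_atMost by simp
  qed (auto intro!: holomorphic_intros)
  show thesis
  proof (rule that[OF P(1)])
    show "norm (F z) powr (p/2) \<le> Re (P z)" if z: "z \<in> ball 0 1" for z
    proof (rule tendsto_le[OF _ tendsto_Re[OF P(3)[OF z]]])
      have "isCont F z" using F z holomorphic_on_imp_continuous_on continuous_on_eq_continuous_at open_ball by blast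
      moreover have "(\<lambda>n. of_real (\<rho> (s n)) * z) \<longlonglongrightarrow> of_real 1 * z"
        using LIMSEQ_subseq_LIMSEQ[OF \<rho>lim P(2)] by (intro tendsto_intros) (simp add: o_def)
      then have "(\<lambda>n. of_real (\<rho> (s n)) * z) \<longlonglongrightarrow> z" by simp
      ultimately have "(\<lambda>n. F (of_real (\<rho> (s n)) * z)) \<longlonglongrightarrow> F z"
        by (rule isCont_tendsto_compose)
      then show "(\<lambda>n. norm (F (of_real (\<rho> (s n)) * z)) powr (p/2)) \<longlonglongrightarrow> norm (F z) powr (p/2)"
        using p by (intro tendsto_powr' tendsto_intros) auto
      show "\<forall>\<^sub>F n in sequentially. norm (F (of_real (\<rho> (s n)) * z)) powr (p/2) \<le> Re (poly (A (s n)) z)"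
        using A(1)[OF z] by simp
    qed simp
    show "(\<Sum>n<N. (norm ((deriv ^^ n) P 0 / fact n))\<^sup>2) \<le> Re (g 0)" for N
      by (rule taylor_coeffs_square_le[OF P(1) harmonic_on_Re[OF _ g(1)] g(2)]) auto
  qed
qed

section \<open>Polynomial approximation in Hardy spaces of the disc\<close>

lemma bounded_sums_small_tail:
  fixes x :: "nat \<Rightarrow> real"
  assumes x: "\<And>n. x n \<ge> 0" and M: "\<And>N. (\<Sum>n<N. x n) \<le> M" and e: "e > 0"
  obtains K where "\<And>N. (\<Sum>n<N. if n < K then 0 else x n) \<le> e"
proof -
  have sx: "summable x" by (rule summableI_nonneg_bounded[OF x M])
  then obtain K where K: "norm (\<Sum>i. x (i + K)) < e" using suminf_exist_split[OF e sx] by blast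
  have "(\<Sum>n<N. if n < K then 0 else x n) \<le> e" for N
  proof -
    have "(\<Sum>n<N. if n < K then 0 else x n) = (\<Sum>n\<in>{K..<N}. x n)"
      by (intro sum.mono_neutral_cong_right) auto
    also have "\<dots> \<le> (\<Sum>n\<in>{K..<N+K}. x n)" by (intro sum_mono2 x) auto
    also have "\<dots> = (\<Sum>i<N. x (i + K))"
      using sum.shift_bounds_nat_ivl[of x 0 K N] by (simp add: lessThan_atLeast0)
    also have "\<dots> \<le> (\<Sum>i. x (i + K))"
      using x sx by (intro sum_le_suminf) (simp_all add: summable_iff_shift)
    finally show ?thesis using K by simp
  qed
  then show thesis by (rule that)
qed

text \<open>With \<open>W = 1 + e * P\<close> and \<open>Re P \<ge> 0\<close>, both 1 and
  \<open>e * norm F powr (p/2)\<close> are at most \<open>norm W\<close>; since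
  \<open>2 / p \<le> 2\<close>, the quotient of \<open>F\<close> by the square of \<open>W\<close>
  is bounded. The \<open>p\<close>-th power of the error is at most a constant times
  \<open>norm P ^ 2 * min 1 (e * norm P)\<close>. Against the bounded initial part \<open>P1\<close>
  of \<open>P\<close> the second entry of the minimum is used, with small \<open>e\<close>; against
  the tail \<open>P2\<close>, small in H^2, the first one suffices.\<close>

lemma hardy_disc_bounded_approx:
  assumes F: "F holomorphic_on ball 0 (1::real)" and u: "harmonic_on u (ball 0 1)" and p: "p \<ge> 1"
    and Fu: "\<And>z. z \<in> ball 0 1 \<Longrightarrow> norm (F z) powr p \<le> u z" and \<epsilon>: "\<epsilon> > 0"
  obtains B m where "B holomorphic_on ball 0 1" "\<And>z. z \<in> ball 0 1 \<Longrightarrow> norm (B z) \<le> m"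
    "hsmall (ball 0 1) 0 p (\<lambda>z. F z - B z) \<epsilon>"
proof -
  obtain P M where P: "P holomorphic_on ball 0 1" "\<And>z. z \<in> ball 0 1 \<Longrightarrow> norm (F z) powr (p/2) \<le> Re (P z)"
    and M: "\<And>N. (\<Sum>n<N. (norm ((deriv ^^ n) P 0 / fact n))\<^sup>2) \<le> M"
    using square_integrable_majorant[OF F u _ Fu] p by auto
  define a where "a n = (deriv ^^ n) P 0 / fact n" for n
  have Psums: "(\<lambda>n. a n * z ^ n) sums P z" if "z \<in> ball 0 1" for z
    using taylor_sums_ball[OF P(1) that] by (simp add: a_def)
  have aM: "(\<Sum>n<N. (norm (a n))\<^sup>2) \<le> M" for N using M by (simp add: a_def)
  have M0: "M \<ge> 0" using aM[of 0] by simp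
  \<comment> \<open>\<open>U 0\<close> will be at most \<open>4 * 2 powr p * \<eta>\<close>, which
    this makes \<open>\<epsilon> / 2\<close>.\<close>
  define \<eta> where "\<eta> = \<epsilon> / (8 * 2 powr p)"
  have \<eta>: "\<eta> > 0" using \<epsilon> by (simp add: \<eta>_def)
  obtain K where K: "\<And>N. (\<Sum>n<N. if n < K then 0 else (norm (a n))\<^sup>2) \<le> \<eta>"
    using bounded_sums_small_tail[OF _ aM \<eta>] by auto
  define P1 where "P1 z = (\<Sum>n<K. a n * z ^ n)" for z
  define P2 where "P2 z = P z - P1 z" for z
  define m where "m = (\<Sum>n<K. norm (a n))"
  have m0: "m \<ge> 0" by (simp add: m_def sum_nonneg)
  have P1m: "norm (P1 z) \<le> m" if "z \<in> ball 0 1" for z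
    unfolding P1_def m_def using that
    by (intro sum_norm_le) (auto simp: norm_mult norm_power intro!: mult_left_le power_le_one)
  obtain g where g: "g holomorphic_on ball 0 1" "\<And>z. z \<in> ball 0 1 \<Longrightarrow> (norm (P z))\<^sup>2 \<le> Re (g z)" "Re (g 0) \<le> M"
    using square_summable_power_series_majorant[OF Psums aM] by blast
  have P2sums: "(\<lambda>n. (if n < K then 0 else a n) * z ^ n) sums P2 z" if "z \<in> ball 0 1" for z
  proof -
    have "(\<lambda>n. if n \<in> {..<K} then a n * z ^ n else 0) sums P1 z"
      unfolding P1_def by (rule sums_If_finite_set) simp
    from sums_diff[OF Psums[OF that] this] show ?thesis
      unfolding P2_def by (rule sums_cong[THEN iffD1, rotated]) auto
  qed
  obtain g2 where g2: "g2 holomorphic_on ball 0 1" "\<And>z. z \<in> ball 0 1 \<Longrightarrow> (norm (P2 z))\<^sup>2 \<le> Re (g2 z)" "Re (g2 0) \<le> \<eta>"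
  proof (rule square_summable_power_series_majorant[OF P2sums])
    show "(\<Sum>n<N. (norm (if n < K then 0 else a n))\<^sup>2) \<le> \<eta>" for N
    proof -
      have "(\<Sum>n<N. (norm (if n < K then 0 else a n))\<^sup>2) = (\<Sum>n<N. if n < K then 0 else (norm (a n))\<^sup>2)"
        by (intro sum.cong) auto
      then show ?thesis using K[of N] by simp
    qed
  qed auto
  \<comment> \<open>Makes the contribution \<open>m^2 * e * (1 + M)\<close> of \<open>P1\<close> at
    0 at most \<open>\<eta>\<close>.\<close>
  define e where "e = \<eta> / ((m\<^sup>2 + 1) * (1 + M))"
  have e: "e > 0" using \<eta> M0 by (simp add: e_def add_nonneg_pos)
  have em: "m\<^sup>2 * (e * (1 + M)) \<le> \<eta>"
  proof -
    have "m\<^sup>2 * (e * (1 + M)) = \<eta> * (m\<^sup>2 / (m\<^sup>2 + 1))" using M0 by (simp add: e_def)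
    also have "\<dots> \<le> \<eta> * 1" using \<eta> by (intro mult_left_mono) (auto simp: divide_le_eq_1 add_nonneg_pos)
    finally show ?thesis by simp
  qed
  define W where "W z = 1 + of_real e * P z" for z
  have ReP: "Re (P z) \<ge> 0" if "z \<in> ball 0 1" for z using P(2)[OF that] powr_ge_zero order_trans by blast
  have W1: "norm (W z) \<ge> 1" if "z \<in> ball 0 1" for z
    using complex_Re_le_cmod[of "W z"] ReP[OF that] e by (simp add: W_def) (smt (verit) mult_nonneg_nonneg)
  have W0: "W z \<noteq> 0" if "z \<in> ball 0 1" for z using W1[OF that] by auto
  define B where "B z = F z / (W z)\<^sup>2" for z
  show thesis
  proof (rule that[of B "(1/e) powr (2/p)"])
    show "B holomorphic_on ball 0 1" unfolding B_def W_def
      using W0 by (intro holomorphic_intros F P) (auto simp: W_def)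
    show "norm (B z) \<le> (1/e) powr (2/p)" if z: "z \<in> ball 0 1" for z
    proof -
      have "norm (F z) powr (p/2) \<le> norm (W z) / e"
      proof -
        have "e * Re (P z) \<le> norm (W z)" using complex_Re_le_cmod[of "W z"] by (simp add: W_def)
        then show ?thesis using P(2)[OF z] e by (simp add: field_simps) (smt (verit) mult_left_mono)
      qed
      then have "(norm (F z) powr (p/2)) powr (2/p) \<le> (norm (W z) / e) powr (2/p)"
        using p by (intro powr_mono2) auto
      then have "norm (F z) \<le> norm (W z) powr (2/p) * (1/e) powr (2/p)"
        using p e by (simp add: powr_powr powr_divide)
      also have "\<dots> \<le> (norm (W z))\<^sup>2 * (1/e) powr (2/p)"
        using powr_mono[of "2/p" 2 "norm (W z)"] W1[OF z] p
        by (intro mult_right_mono) (auto simp: divide_le_eq)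
      finally show ?thesis using W0[OF z] by (simp add: B_def norm_divide norm_power divide_le_eq mult.commute)
    qed
    define U where "U z = 2 * 2 powr p * (m\<^sup>2 * e * (1 + Re (g z)) + Re (g2 z))" for z
    show "hsmall (ball 0 1) 0 p (\<lambda>z. F z - B z) \<epsilon>"
    proof (rule hsmallI)
      show "harmonic_on U (ball 0 1)" unfolding U_def
        by (intro harmonic_on_cmult harmonic_on_add harmonic_on_const harmonic_on_Re g g2) auto
      fix z :: complex assume z: "z \<in> ball 0 1"
      define t where "t = norm (1 - 1 / (W z)\<^sup>2)"
      have w: "norm (W z) \<ge> 1" "W z \<noteq> 0" using W1 W0 z by auto
      have iw: "norm (1 / (W z)\<^sup>2) \<le> 1" using one_le_power[OF w(1), of 2] by (simp add: norm_divide norm_power divide_le_eq_1)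
      have t2: "t \<le> 2" unfolding t_def using norm_triangle_ineq4[of 1 "1 / (W z)\<^sup>2"] iw by simp
      have tP: "t \<le> 2 * (e * norm (P z))"
      proof -
        have "1 - 1 / (W z)\<^sup>2 = of_real e * P z * ((1 / W z) * (1 + 1 / W z))"
        proof -
          have "of_real e * P z = W z - 1" by (simp add: W_def)
          moreover have "1 - 1 / (W z)\<^sup>2 = (W z - 1) * ((1 / W z) * (1 + 1 / W z))"
            using w(2) by (simp add: field_simps power2_eq_square)
          ultimately show ?thesis by simp
        qed
        then have "t = e * norm (P z) * norm ((1 / W z) * (1 + 1 / W z))"
          using e by (simp only: t_def norm_mult norm_of_real abs_of_pos)
        moreover have "norm ((1 / W z) * (1 + 1 / W z)) \<le> 1 * (1 + 1)"
          unfolding norm_mult using w(1)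
          by (intro mult_mono order_trans[OF norm_triangle_ineq] add_mono) (auto simp: norm_divide divide_le_eq_1)
        ultimately show ?thesis
          using e mult_left_mono[of "norm ((1 / W z) * (1 + 1 / W z))" 2 "e * norm (P z)"] by simp
      qed
      have t0: "t \<ge> 0" by (simp add: t_def)
      define s where "s = min 1 (e * norm (P z))"
      have s: "s \<le> 1" "s \<le> e * norm (P z)" "s \<ge> 0" using e by (auto simp: s_def)
      have ts: "t powr p \<le> 2 powr p * s"
      proof -
        have "t / 2 \<le> s" using t2 tP by (simp add: s_def)
        have "t powr p = (2 * (t/2)) powr p" by simp
        also have "\<dots> = 2 powr p * (t/2) powr p" using t0 by (subst powr_mult) auto
        also have "(t/2) powr p \<le> (t/2) powr 1" using t0 t2 p by (intro powr_mono') auto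
        also have "(t/2) powr 1 = t / 2" using t0 by simp
        also have "t / 2 \<le> s" by fact
        finally show ?thesis by simp
      qed
      have FP: "norm (F z) powr p \<le> (norm (P z))\<^sup>2"
        using power_mono[OF P(2)[OF z], of 2] power_mono[OF complex_Re_le_cmod[of "P z"] ReP[OF z], of 2]
        by (simp add: powr_half_square)
      have "F z - B z = F z * (1 - 1 / (W z)\<^sup>2)" by (simp add: B_def algebra_simps)
      then have "norm (F z - B z) powr p = norm (F z) powr p * t powr p"
        by (simp add: norm_mult t_def powr_mult)
      also have "\<dots> \<le> (norm (P z))\<^sup>2 * (2 powr p * s)"
        using FP ts by (intro mult_mono) auto
      also have "(norm (P z))\<^sup>2 \<le> 2 * (norm (P1 z))\<^sup>2 + 2 * (norm (P2 z))\<^sup>2"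
      proof -
        have "norm (P z) \<le> norm (P1 z) + norm (P2 z)"
          using norm_triangle_ineq[of "P1 z" "P2 z"] by (simp add: P2_def)
        then have "(norm (P z))\<^sup>2 \<le> (norm (P1 z) + norm (P2 z))\<^sup>2" by (intro power_mono) auto
        also have "\<dots> \<le> 2 * (norm (P1 z))\<^sup>2 + 2 * (norm (P2 z))\<^sup>2"
          using zero_le_power2[of "norm (P1 z) - norm (P2 z)"] by (simp add: power2_eq_square algebra_simps)
        finally show ?thesis .
      qed
      also have "(2 * (norm (P1 z))\<^sup>2 + 2 * (norm (P2 z))\<^sup>2) * (2 powr p * s)
          = 2 * 2 powr p * ((norm (P1 z))\<^sup>2 * s + (norm (P2 z))\<^sup>2 * s)" by (simp add: algebra_simps)
      also have "\<dots> \<le> U z" unfolding U_def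
      proof (intro mult_left_mono add_mono)
        \<comment> \<open>The linear term in \<open>norm (P z)\<close> is traded for the square,
          which has the harmonic majorant \<open>Re (g z)\<close>.\<close>
        have "2 * norm (P z) \<le> 1 + (norm (P z))\<^sup>2"
          using zero_le_power2[of "norm (P z) - 1"] by (simp add: power2_eq_square algebra_simps)
        then have "norm (P z) \<le> 1 + (norm (P z))\<^sup>2" using norm_ge_zero[of "P z"] by linarith
        then have "e * norm (P z) \<le> e * (1 + (norm (P z))\<^sup>2)"
          using e by (intro mult_left_mono) auto
        also have "\<dots> \<le> e * (1 + Re (g z))" using g(2)[OF z] e by simp
        finally have "s \<le> e * (1 + Re (g z))" using s by linarith
        moreover have "(norm (P1 z))\<^sup>2 \<le> m\<^sup>2" using P1m[OF z] by (intro power_mono) auto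
        ultimately have "(norm (P1 z))\<^sup>2 * s \<le> m\<^sup>2 * (e * (1 + Re (g z)))"
          using s by (intro mult_mono) auto
        then show "(norm (P1 z))\<^sup>2 * s \<le> m\<^sup>2 * e * (1 + Re (g z))" by (simp add: mult.assoc)
        have "(norm (P2 z))\<^sup>2 * s \<le> (norm (P2 z))\<^sup>2 * 1" using s by (intro mult_left_mono) auto
        then show "(norm (P2 z))\<^sup>2 * s \<le> Re (g2 z)" using g2(2)[OF z] by simp
      qed auto
      finally show "norm (F z - B z) powr p \<le> U z" using s by (auto simp: mult_right_mono)
    next
      have "m\<^sup>2 * e * (1 + Re (g 0)) \<le> m\<^sup>2 * e * (1 + M)" using e g(3) by (intro mult_left_mono) auto
      then have "m\<^sup>2 * e * (1 + Re (g 0)) + Re (g2 0) \<le> \<eta> + \<eta>" using em g2(3) by (simp add: mult.assoc)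
      then have "U 0 \<le> 2 * 2 powr p * (\<eta> + \<eta>)" unfolding U_def by (intro mult_left_mono) auto
      also have "\<dots> = \<epsilon> / 2" by (simp add: \<eta>_def)
      finally show "U 0 < \<epsilon>" using \<epsilon> by simp
    qed
  qed
qed

text \<open>Dilation comes first: \<open>B z - B (r * z)\<close> has coefficients
  \<open>b n * (1 - r ^ n)\<close>. Their squares have a small sum, because finitely many tend to 0
  as \<open>r\<close> tends to 1 and the others form a small tail. Boundedness carries this from H^2
  to exponent \<open>p\<close>, and the dilate is a uniform limit of its Taylor polynomials.\<close>

lemma bounded_disc_poly_approx:
  assumes B: "B holomorphic_on ball 0 (1::real)" and m: "\<And>z. z \<in> ball 0 1 \<Longrightarrow> norm (B z) \<le> m"
    and p: "p \<ge> 1" and \<epsilon>: "\<epsilon> > 0"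
  obtains Q where "hsmall (ball 0 1) 0 p (\<lambda>z. B z - poly Q z) \<epsilon>"
proof -
  have m0: "m \<ge> 0" using order_trans[OF norm_ge_zero m[of 0]] by simp
  define \<epsilon>1 where "\<epsilon>1 = \<epsilon> / (2 * 2 powr p)"
  have \<epsilon>1: "\<epsilon>1 > 0" using \<epsilon> by (simp add: \<epsilon>1_def)
  \<comment> \<open>The summand 1 keeps the denominator of \<open>\<delta>\<close> positive when
    \<open>m = 0\<close>.\<close>
  define L where "L = (2 * m) powr p + 1"
  have L: "L > 0" by (simp add: L_def add_nonneg_pos)
  define \<delta> where "\<delta> = (\<epsilon>1/2) * (\<epsilon>1/2) powr (2/p) / (2 * L)"
  have \<delta>: "\<delta> > 0" using \<epsilon>1 L by (simp add: \<delta>_def)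
  have \<delta>m: "(2 * m) powr p * (2 * \<delta>) \<le> (\<epsilon>1/2) * (\<epsilon>1/2) powr (2/p)"
  proof -
    have "(2 * m) powr p * (2 * \<delta>) \<le> L * (2 * \<delta>)" using \<delta> by (intro mult_right_mono) (auto simp: L_def)
    also have "\<dots> = (\<epsilon>1/2) * (\<epsilon>1/2) powr (2/p)"
      using L by (simp add: \<delta>_def)
    finally show ?thesis .
  qed
  define b where "b n = (deriv ^^ n) B 0 / fact n" for n
  have Bsums: "(\<lambda>n. b n * z ^ n) sums B z" if "z \<in> ball 0 1" for z
    using taylor_sums_ball[OF B that] by (simp add: b_def)
  have bM: "(\<Sum>n<N. (norm (b n))\<^sup>2) \<le> m\<^sup>2" for N
    unfolding b_def by (rule taylor_coeffs_square_le[OF B harmonic_on_const]) (auto intro!: power_mono m)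
  obtain K where K: "\<And>N. (\<Sum>n<N. if n < K then 0 else (norm (b n))\<^sup>2) \<le> \<delta>/2"
    using bounded_sums_small_tail[OF _ bM, of "\<delta>/2"] \<delta> by auto
  have "((\<lambda>r. \<Sum>n<K. (norm (b n * of_real (1 - r ^ n)))\<^sup>2) \<longlongrightarrow> (\<Sum>n<K. (norm (b n * of_real (1 - 1 ^ n)))\<^sup>2)) (at_left 1)"
    by (intro tendsto_intros)
  then have "((\<lambda>r. \<Sum>n<K. (norm (b n * of_real (1 - r ^ n)))\<^sup>2) \<longlongrightarrow> 0) (at_left 1)" by simp
  then have "\<forall>\<^sub>F r in at_left 1. (\<Sum>n<K. (norm (b n * of_real (1 - r ^ n)))\<^sup>2) < \<delta>/2"
    using \<delta> by (intro order_tendstoD(2)) auto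
  moreover have "\<forall>\<^sub>F r in at_left (1::real). r \<in> {0<..<1}" using eventually_at_left_real[of 0 1] by simp
  ultimately have "\<forall>\<^sub>F r in at_left (1::real). (\<Sum>n<K. (norm (b n * of_real (1 - r ^ n)))\<^sup>2) < \<delta>/2 \<and> r \<in> {0<..<1}"
    by (rule eventually_conj)
  then obtain r where r: "(\<Sum>n<K. (norm (b n * of_real (1 - r ^ n)))\<^sup>2) < \<delta>/2" "0 < r" "r < 1"
    using eventually_happens[of _ "at_left (1::real)"] by auto
  have rb: "of_real r * z \<in> ball 0 1 \<and> of_real r * z \<in> cball 0 r" if "z \<in> ball 0 1" for z :: complex
  proof -
    have "r * norm z \<le> r * 1" using that r by (intro mult_left_mono) auto
    then have "norm (of_real r * z) \<le> r" using r by (simp only: norm_mult norm_of_real abs_of_pos mult_1_right)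
    then show ?thesis using r(3) by simp
  qed
  define c where "c n = b n * of_real (1 - r ^ n)" for n
  have csums: "(\<lambda>n. c n * z ^ n) sums (B z - B (of_real r * z))" if "z \<in> ball 0 1" for z
    using sums_diff[OF Bsums[OF that] Bsums[of "of_real r * z"]] rb[OF that]
    by (simp add: c_def algebra_simps power_mult_distrib)
  have cM: "(\<Sum>n<N. (norm (c n))\<^sup>2) \<le> \<delta>" for N
  proof -
    have cb: "(norm (c n))\<^sup>2 \<le> (norm (b n))\<^sup>2" for n
    proof -
      have "\<bar>1 - r ^ n\<bar> \<le> 1" using r power_le_one[of r n] zero_le_power[of r n] by auto
      then have "norm (c n) \<le> norm (b n)"
        unfolding c_def norm_mult norm_of_real by (intro mult_left_le) auto
      then show ?thesis by (intro power_mono) auto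
    qed
    have "(\<Sum>n<N. (norm (c n))\<^sup>2) = (\<Sum>n<N. (if n < K then (norm (c n))\<^sup>2 else 0) + (if n < K then 0 else (norm (c n))\<^sup>2))"
      by (intro sum.cong) auto
    also have "\<dots> = (\<Sum>n<N. (if n < K then (norm (c n))\<^sup>2 else 0)) + (\<Sum>n<N. (if n < K then 0 else (norm (c n))\<^sup>2))"
      by (rule sum.distrib)
    also have "(\<Sum>n<N. (if n < K then (norm (c n))\<^sup>2 else 0)) \<le> (\<Sum>n<max N K. (if n < K then (norm (c n))\<^sup>2 else 0))"
      by (intro sum_mono2) auto
    also have "\<dots> = (\<Sum>n<K. (norm (c n))\<^sup>2)" by (intro sum.mono_neutral_cong_right) auto
    also have "\<dots> \<le> \<delta> / 2" using r(1) by (simp add: c_def)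
    also have "(\<Sum>n<N. (if n < K then 0 else (norm (c n))\<^sup>2)) \<le> (\<Sum>n<N. (if n < K then 0 else (norm (b n))\<^sup>2))"
      using cb by (intro sum_mono) auto
    also have "\<dots> \<le> \<delta> / 2" by (rule K)
    finally show ?thesis by simp
  qed
  obtain g where g: "g holomorphic_on ball 0 1" "\<And>z. z \<in> ball 0 1 \<Longrightarrow> (norm (B z - B (of_real r * z)))\<^sup>2 \<le> Re (g z)" "Re (g 0) \<le> \<delta>"
    using square_summable_power_series_majorant[OF csums cM] by blast
  \<comment> \<open>At 0 the majorant is only known to be \<open>\<le> \<delta>\<close>; doubling
    gives the strict inequality.\<close>
  have "hsmall (ball 0 1) 0 2 (\<lambda>z. B z - B (of_real r * z)) (2 * \<delta>)"
    by (rule hsmallI[OF harmonic_on_Re[OF _ g(1)]]) (use g \<delta> in auto)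
  then have s1: "hsmall (ball 0 1) 0 p (\<lambda>z. B z - B (of_real r * z)) \<epsilon>1"
  proof (rule hsmall_bounded_exponent[rotated 5])
    show "norm (B z - B (of_real r * z)) \<le> 2 * m" if "z \<in> ball 0 1" for z
      using norm_triangle_ineq4[of "B z" "B (of_real r * z)"] m[OF that] m[of "of_real r * z"] rb[OF that] by linarith
  qed (use m0 p \<epsilon>1 \<delta> \<delta>m in auto)
  define e where "e = (\<epsilon>1/2) powr (1/p)"
  have e: "e > 0" "e powr p < \<epsilon>1" using \<epsilon>1 p by (auto simp: e_def powr_powr)
  obtain n where n: "\<And>k z. k \<ge> n \<Longrightarrow> z \<in> cball 0 r \<Longrightarrow>
      norm ((\<Sum>i<k. (deriv ^^ i) B 0 / fact i * z ^ i) - B z) < e"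
    using taylor_uniform_cball[OF B r(3) e(1)] by blast
  define Q where "Q = (\<Sum>i<n. monom ((deriv ^^ i) B 0 / fact i * of_real r ^ i) i)"
  have "norm (B (of_real r * z) - poly Q z) \<le> e" if "z \<in> ball 0 1" for z
  proof -
    have "poly Q z = (\<Sum>i<n. (deriv ^^ i) B 0 / fact i * (of_real r * z) ^ i)"
      by (simp add: Q_def poly_sum poly_monom power_mult_distrib algebra_simps)
    then show ?thesis using n[of n "of_real r * z"] rb[OF that] by (simp add: norm_minus_commute)
  qed
  then have s2: "hsmall (ball 0 1) 0 p (\<lambda>z. B (of_real r * z) - poly Q z) \<epsilon>1"
    using e p by (intro hsmall_const[of _ _ e]) auto
  have "hsmall (ball 0 1) 0 p (\<lambda>z. (B z - B (of_real r * z)) + (B (of_real r * z) - poly Q z)) (2 powr p * (\<epsilon>1 + \<epsilon>1))"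
    using hsmall_add[OF s1 s2] p by simp
  moreover have "2 powr p * (\<epsilon>1 + \<epsilon>1) = \<epsilon>" by (simp add: \<epsilon>1_def)
  ultimately show thesis by (intro that[of Q]) simp
qed

lemma hardy_disc_poly_approx:
  assumes F: "F \<in> hardy p (ball 0 1)" and p: "p \<ge> 1" and \<epsilon>: "\<epsilon> > 0"
  obtains Q where "hsmall (ball 0 1) 0 p (\<lambda>z. F z - poly Q z) \<epsilon>"
proof -
  obtain u where u: "F holomorphic_on ball 0 1" "harmonic_on u (ball 0 1)" "\<And>z. z \<in> ball 0 1 \<Longrightarrow> norm (F z) powr p \<le> u z"
    using F unfolding hardy_def harmonic_majorant_def by blast
  define d where "d = \<epsilon> / (2 * 2 powr p)"
  have d: "d > 0" using \<epsilon> by (simp add: d_def)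
  obtain B m where B: "B holomorphic_on ball 0 1" "\<And>z. z \<in> ball 0 1 \<Longrightarrow> norm (B z) \<le> m"
    "hsmall (ball 0 1) 0 p (\<lambda>z. F z - B z) d"
    using hardy_disc_bounded_approx[OF u(1,2) p u(3) d] by blast
  obtain Q where Q: "hsmall (ball 0 1) 0 p (\<lambda>z. B z - poly Q z) d"
    using bounded_disc_poly_approx[OF B(1,2) p d] by blast
  have "hsmall (ball 0 1) 0 p (\<lambda>z. (F z - B z) + (B z - poly Q z)) (2 powr p * (d + d))"
    using hsmall_add[OF B(3) Q] p by simp
  moreover have "2 powr p * (d + d) = \<epsilon>" by (simp add: d_def)
  ultimately show thesis by (intro that[of Q]) simp
qed

section \<open>Runge's theorem and simply connected neighbourhoods\<close>

text \<open>The uniform algebra P(K), except that its members are functions on the whole plane with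
  arbitrary values off \<open>K\<close>.\<close>

definition poly_closure :: "complex set \<Rightarrow> (complex \<Rightarrow> complex) set" where
  "poly_closure K = {f. \<forall>e>0. \<exists>P. \<forall>z\<in>K. norm (f z - poly P z) < e}"

lemma poly_closure_uniform:
  assumes "\<And>e. e > 0 \<Longrightarrow> \<exists>g\<in>poly_closure K. \<forall>z\<in>K. norm (f z - g z) < e"
  shows "f \<in> poly_closure K"
  unfolding poly_closure_def
proof (intro CollectI allI impI)
  fix e :: real assume e: "e > 0"
  obtain g where g: "g \<in> poly_closure K" "\<forall>z\<in>K. norm (f z - g z) < e/2" using assms[of "e/2"] e by auto
  have "e/2 > 0" using e by simp
  then obtain P where P: "\<forall>z\<in>K. norm (g z - poly P z) < e/2" using g(1) unfolding poly_closure_def by blast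
  have "norm (f z - poly P z) < e" if z: "z \<in> K" for z
    using norm_triangle_lt[of "f z - g z" "g z - poly P z" e] g(2)[rule_format, OF z] P[rule_format, OF z] by simp
  then show "\<exists>P. \<forall>z\<in>K. norm (f z - poly P z) < e" by blast
qed

lemma poly_closure_poly: "poly P \<in> poly_closure K"
  unfolding poly_closure_def by (auto intro!: exI[of _ P])

lemma poly_closure_add:
  assumes "f \<in> poly_closure K" "g \<in> poly_closure K"
  shows "(\<lambda>z. f z + g z) \<in> poly_closure K"
  unfolding poly_closure_def
proof (intro CollectI allI impI)
  fix e :: real assume e: "e > 0"
  then have e2: "e/2 > 0" by simp
  obtain P where P: "\<forall>z\<in>K. norm (f z - poly P z) < e/2" using assms(1) e2 unfolding poly_closure_def by blast
  obtain Q where Q: "\<forall>z\<in>K. norm (g z - poly Q z) < e/2" using assms(2) e2 unfolding poly_closure_def by blast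
  have "norm (f z + g z - poly (P + Q) z) < e" if z: "z \<in> K" for z
    using norm_triangle_lt[of "f z - poly P z" "g z - poly Q z" e] P[rule_format, OF z] Q[rule_format, OF z]
    by (simp add: algebra_simps)
  then show "\<exists>P. \<forall>z\<in>K. norm (f z + g z - poly P z) < e" by blast
qed

lemma poly_closure_bounded:
  assumes "compact K" "f \<in> poly_closure K"
  obtains B where "B > 0" "\<And>z. z \<in> K \<Longrightarrow> norm (f z) \<le> B"
proof -
  obtain P where P: "\<forall>z\<in>K. norm (f z - poly P z) < 1"
    using assms(2) zero_less_one[where ?'a=real] unfolding poly_closure_def by blast
  have "compact (poly P ` K)" using assms(1) by (intro compact_continuous_image continuous_intros)
  then obtain B where "B > 0" and B: "\<And>z. z \<in> K \<Longrightarrow> norm (poly P z) \<le> B"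
    using compact_imp_bounded bounded_pos by (metis imageI)
  show thesis
  proof (rule that[of "B + 1"])
    show "norm (f z) \<le> B + 1" if z: "z \<in> K" for z
      using norm_triangle_sub[of "f z" "poly P z"] P[rule_format, OF z] B[OF z] by linarith
  qed (use \<open>B > 0\<close> in simp)
qed

lemma poly_closure_mult:
  assumes K: "compact K" and "f \<in> poly_closure K" "g \<in> poly_closure K"
  shows "(\<lambda>z. f z * g z) \<in> poly_closure K"
  unfolding poly_closure_def
proof (intro CollectI allI impI)
  fix e :: real assume e: "e > 0"
  obtain B where B: "B > 0" "\<And>z. z \<in> K \<Longrightarrow> norm (g z) \<le> B" using poly_closure_bounded[OF K assms(3)] by blast
  have eB: "e / (2 * B) > 0" using e B by simp
  obtain P where P: "\<forall>z\<in>K. norm (f z - poly P z) < e / (2 * B)"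
    using assms(2) eB unfolding poly_closure_def by blast
  obtain C where C: "C > 0" "\<And>z. z \<in> K \<Longrightarrow> norm (poly P z) \<le> C" using poly_closure_bounded[OF K poly_closure_poly] by blast
  have eC: "e / (2 * C) > 0" using e C by simp
  obtain Q where Q: "\<forall>z\<in>K. norm (g z - poly Q z) < e / (2 * C)"
    using assms(3) eC unfolding poly_closure_def by blast
  have "norm (f z * g z - poly (P * Q) z) < e" if z: "z \<in> K" for z
  proof -
    have 1: "norm (f z - poly P z) * norm (g z) \<le> norm (f z - poly P z) * B"
      using B(2)[OF z] by (intro mult_left_mono) auto
    have 2: "norm (f z - poly P z) * B < e / 2"
      using P[rule_format, OF z] B(1) by (simp add: field_simps)
    have 3: "norm (poly P z) * norm (g z - poly Q z) \<le> C * norm (g z - poly Q z)"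
      using C(2)[OF z] by (intro mult_right_mono) auto
    have 4: "C * norm (g z - poly Q z) < e / 2"
      using Q[rule_format, OF z] C(1) by (simp add: field_simps)
    have "f z * g z - poly (P * Q) z = (f z - poly P z) * g z + poly P z * (g z - poly Q z)"
      by (simp add: algebra_simps)
    then show ?thesis
      using norm_triangle_lt[of "(f z - poly P z) * g z" "poly P z * (g z - poly Q z)" e] 1 2 3 4
      by (simp add: norm_mult)
  qed
  then show "\<exists>P. \<forall>z\<in>K. norm (f z * g z - poly P z) < e" by blast
qed

lemma poly_closure_const: "(\<lambda>_. c) \<in> poly_closure K"
  using poly_closure_poly[of "[:c:]" K] by (simp add: poly_closure_def)

lemma poly_closure_cmult: "compact K \<Longrightarrow> f \<in> poly_closure K \<Longrightarrow> (\<lambda>z. c * f z) \<in> poly_closure K"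
  by (rule poly_closure_mult[OF _ poly_closure_const])

lemma poly_closure_sum:
  "(\<And>i. i \<in> I \<Longrightarrow> f i \<in> poly_closure K) \<Longrightarrow> (\<lambda>z. \<Sum>i\<in>I. f i z) \<in> poly_closure K"
  by (induction I rule: infinite_finite_induct) (auto intro: poly_closure_const poly_closure_add)

lemma poly_closure_power: "compact K \<Longrightarrow> f \<in> poly_closure K \<Longrightarrow> (\<lambda>z. f z ^ n) \<in> poly_closure K"
  by (induction n) (auto intro: poly_closure_const poly_closure_mult)

lemma poly_closure_cong: "f \<in> poly_closure K \<Longrightarrow> (\<And>z. z \<in> K \<Longrightarrow> f z = g z) \<Longrightarrow> g \<in> poly_closure K"
  by (rule poly_closure_uniform) (auto intro!: bexI[of _ f])

text \<open>A Neumann series; the bound \<open>1/2\<close> makes it converge uniformly on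
  \<open>K\<close>.\<close>

lemma poly_closure_geometric:
  assumes K: "compact K" and t: "t \<in> poly_closure K" "\<And>z. z \<in> K \<Longrightarrow> norm (t z) \<le> 1/2"
  shows "(\<lambda>z. 1 / (1 - t z)) \<in> poly_closure K"
proof (rule poly_closure_uniform)
  fix e :: real assume e: "e > 0"
  then obtain N where N: "(1/2) ^ N < e / 2" using real_arch_pow_inv[of "e/2" "1/2"] by auto
  have "norm (1 / (1 - t z) - (\<Sum>n<N. t z ^ n)) < e" if z: "z \<in> K" for z
  proof -
    have ne: "norm (1 - t z) \<ge> 1/2" using norm_triangle_ineq2[of 1 "t z"] t(2)[OF z] by simp
    then have "t z \<noteq> 1" by auto
    then have "1 / (1 - t z) - (\<Sum>n<N. t z ^ n) = t z ^ N / (1 - t z)"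
      by (simp add: sum_gp_strict field_simps)
    then have "norm (1 / (1 - t z) - (\<Sum>n<N. t z ^ n)) = norm (t z) ^ N / norm (1 - t z)"
      by (simp add: norm_divide norm_power)
    also have "\<dots> \<le> (1/2) ^ N / (1/2)"
      using ne t(2)[OF z] by (intro frac_le power_mono) auto
    also have "\<dots> < e" using N by simp
    finally show ?thesis .
  qed
  then show "\<exists>g\<in>poly_closure K. \<forall>z\<in>K. norm (1 / (1 - t z) - g z) < e"
    using poly_closure_sum[of "{..<N}" "\<lambda>n z. t z ^ n" K] poly_closure_power[OF K t(1)]
    by (intro bexI[of _ "\<lambda>z. \<Sum>n<N. t z ^ n"]) auto
qed

text \<open>Pole pushing. For a pole of modulus \<open>2 * R\<close> the geometric series converges
  uniformly on \<open>K\<close>. The property then spreads through the connected complement, because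
  expanding about a pole \<open>x\<close> reaches all nearby poles \<open>y\<close>.\<close>

lemma poly_closure_pole:
  assumes K: "compact K" and conn: "connected (- K)" and \<zeta>: "\<zeta> \<notin> K"
  shows "(\<lambda>z. 1 / (\<zeta> - z)) \<in> poly_closure K"
proof -
  obtain R where R: "R > 0" "\<And>z. z \<in> K \<Longrightarrow> norm z \<le> R"
    using compact_imp_bounded[OF K] bounded_pos by blast
  define \<zeta>0 where "\<zeta>0 = complex_of_real (2 * R)"
  have n\<zeta>0: "norm \<zeta>0 = 2 * R" using R(1) by (simp add: \<zeta>0_def)
  have \<zeta>0: "\<zeta>0 \<in> - K" "\<zeta>0 \<noteq> 0" using R n\<zeta>0 by force+
  show ?thesis
  proof (rule connected_induction_simple[OF conn, where a=\<zeta>0 and P="\<lambda>\<zeta>. (\<lambda>z. 1 / (\<zeta> - z)) \<in> poly_closure K"])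
    have t: "(\<lambda>z. 1 / \<zeta>0 * z) \<in> poly_closure K"
      using poly_closure_cmult[OF K poly_closure_poly[of "[:0,1:]"], of "1/\<zeta>0"] by simp
    have "(\<lambda>z. 1 / (1 - 1 / \<zeta>0 * z)) \<in> poly_closure K"
    proof (rule poly_closure_geometric[OF K t])
      show "norm (1 / \<zeta>0 * z) \<le> 1 / 2" if "z \<in> K" for z
        using R(2)[OF that] R(1) by (simp add: norm_mult norm_divide n\<zeta>0 field_simps)
    qed
    from poly_closure_cmult[OF K this, of "1 / \<zeta>0"]
    show "(\<lambda>z. 1 / (\<zeta>0 - z)) \<in> poly_closure K"
      by (rule poly_closure_cong) (use \<zeta>0 in \<open>auto simp: field_simps\<close>)
    fix a assume a: "a \<in> - K"
    have "open (- K)" using K compact_imp_closed by blast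
    then obtain d where d: "d > 0" "ball a d \<subseteq> - K" using a openE by blast
    \<comment> \<open>Radius \<open>d/5\<close> gives \<open>norm (x - y) \<le> 2 * d / 5\<close>,
      at most half the distance from \<open>x\<close> to any point of \<open>K\<close>. So
      \<open>1 / (y - z)\<close> is \<open>1 / (x - z)\<close> times a geometric series in
      \<open>(x - y) / (x - z)\<close>.\<close>
    have step: "(\<lambda>z. 1 / (y - z)) \<in> poly_closure K"
      if xy: "x \<in> ball a (d/5)" "y \<in> ball a (d/5)" and x: "(\<lambda>z. 1 / (x - z)) \<in> poly_closure K" for x y
    proof -
      have "dist x y < d/5 + d/5" using xy dist_triangle_less_add[of x a "d/5" y "d/5"] by (simp add: dist_commute)
      then have xy': "norm (x - y) \<le> 2 * d / 5" by (simp add: dist_norm)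
      have far: "norm (x - z) \<ge> 4 * d / 5" "x \<noteq> z" "y \<noteq> z" if "z \<in> K" for z
      proof -
        have "\<not> dist a z < d" using d(2) that by auto
        then have *: "norm (a - z) \<ge> d" by (simp add: dist_norm)
        then show "norm (x - z) \<ge> 4 * d / 5"
          using xy(1) norm_triangle_ineq[of "a - x" "x - z"] by (simp add: dist_norm)
        then show "x \<noteq> z" using d(1) by auto
        show "y \<noteq> z" using * xy(2) d(1) by (auto simp: dist_norm)
      qed
      have t: "(\<lambda>z. (x - y) * (1 / (x - z))) \<in> poly_closure K" by (rule poly_closure_cmult[OF K x])
      have "(\<lambda>z. 1 / (1 - (x - y) * (1 / (x - z)))) \<in> poly_closure K"
      proof (rule poly_closure_geometric[OF K t])
        show "norm ((x - y) * (1 / (x - z))) \<le> 1 / 2" if "z \<in> K" for z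
        proof -
          have "norm (x - y) \<le> norm (x - z) * (1/2)" using far(1)[OF that] xy' by simp
          moreover have "norm (x - z) > 0" using far(2)[OF that] by simp
          ultimately show ?thesis by (simp add: norm_divide norm_mult divide_le_eq)
        qed
      qed
      from poly_closure_mult[OF K x this] show ?thesis
      proof (rule poly_closure_cong)
        fix z assume z: "z \<in> K"
        have "1 - (x - y) * (1 / (x - z)) = (y - z) / (x - z)" using far[OF z] by (simp add: field_simps)
        then show "1 / (x - z) * (1 / (1 - (x - y) * (1 / (x - z)))) = 1 / (y - z)" using far[OF z] by simp
      qed
    qed
    show "\<exists>T. openin (top_of_set (- K)) T \<and> a \<in> T \<and>
        (\<forall>x\<in>T. \<forall>y\<in>T. (\<lambda>z. 1 / (x - z)) \<in> poly_closure K \<longrightarrow> (\<lambda>z. 1 / (y - z)) \<in> poly_closure K)"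
    proof (intro exI[of _ "ball a (d/5)"] conjI ballI impI)
      show "openin (top_of_set (- K)) (ball a (d/5))"
        using d subset_ball[of "d/5" d a] by (intro open_subset) auto
      show "a \<in> ball a (d/5)" using d by simp
    qed (rule step)
  qed (use \<zeta>0 \<zeta> in auto)
qed

section \<open>Cauchy integrals and Runge's theorem for Riemann maps\<close>

lemma uniform_riemann_sums:
  fixes \<Phi> :: "real \<Rightarrow> complex \<Rightarrow> complex"
  assumes K: "compact K" and cont: "continuous_on ({0..1} \<times> K) (\<lambda>(t, z). \<Phi> t z)" and e: "e > 0"
  obtains m :: nat where "m > 0"
    "\<And>z. z \<in> K \<Longrightarrow> norm (integral {0..1} (\<lambda>t. \<Phi> t z) - (\<Sum>j<m. \<Phi> (real j / real m) z / of_nat m)) < e"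
proof -
  have "uniformly_continuous_on ({0..1} \<times> K) (\<lambda>(t, z). \<Phi> t z)"
    by (rule compact_uniformly_continuous[OF cont]) (intro compact_Times K compact_Icc)
  then obtain d where d: "d > 0"
    "\<And>t s z. t \<in> {0..1} \<Longrightarrow> s \<in> {0..1} \<Longrightarrow> z \<in> K \<Longrightarrow> \<bar>t - s\<bar> < d \<Longrightarrow> norm (\<Phi> t z - \<Phi> s z) < e/2"
  proof -
    assume *: "uniformly_continuous_on ({0..1} \<times> K) (\<lambda>(t, z). \<Phi> t z)"
      and that: "\<And>d. d > 0 \<Longrightarrow> (\<And>t s z. t \<in> {0..1} \<Longrightarrow> s \<in> {0..1} \<Longrightarrow> z \<in> K \<Longrightarrow> \<bar>t - s\<bar> < d \<Longrightarrow> norm (\<Phi> t z - \<Phi> s z) < e/2) \<Longrightarrow> thesis"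
    obtain d where d: "d > 0" "\<And>x y. x \<in> {0..1} \<times> K \<Longrightarrow> y \<in> {0..1} \<times> K \<Longrightarrow> dist x y < d \<Longrightarrow>
        dist (case x of (t, z) \<Rightarrow> \<Phi> t z) (case y of (t, z) \<Rightarrow> \<Phi> t z) < e / 2"
      by (rule uniformly_continuous_onE[OF *, of "e/2"]) (use e in \<open>auto simp: dist_commute\<close>)
    show thesis
    proof (rule that[OF d(1)])
      fix t s :: real and z assume "t \<in> {0..1}" "s \<in> {0..1}" "z \<in> K" "\<bar>t - s\<bar> < d"
      then show "norm (\<Phi> t z - \<Phi> s z) < e/2"
        using d(2)[of "(t, z)" "(s, z)"] by (simp add: dist_norm dist_Pair_Pair)
    qed
  qed
  obtain m :: nat where m: "1 / d < real m" using reals_Archimedean2 by blast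
  have m0: "m > 0" using m d(1) by (metis divide_pos_pos gr0I less_asym of_nat_0 zero_less_one)
  have md: "1 / real m < d" using m d(1) m0 by (simp add: field_simps)
  show thesis
  proof (rule that[OF m0])
    fix z assume z: "z \<in> K"
    have contz: "continuous_on {0..1} (\<lambda>t. \<Phi> t z)"
    proof -
      have "continuous_on {0..1} (\<lambda>t. (\<lambda>(t, z). \<Phi> t z) (t, z))"
        by (rule continuous_on_compose2[OF cont]) (use z in \<open>auto intro!: continuous_intros\<close>)
      then show ?thesis by simp
    qed
    \<comment> \<open>Left endpoint sums: each subinterval adds an error of at most
      \<open>e / 2 / m\<close>, by uniform continuity.\<close>
    have "k \<le> m \<Longrightarrow> norm (integral {0..real k / m} (\<lambda>t. \<Phi> t z) - (\<Sum>j<k. \<Phi> (real j / real m) z / of_nat m)) \<le> real k * (e / 2 / m)" for k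
    proof (induction k)
      case (Suc k)
      define a b where "a = real k / real m" and "b = real (Suc k) / real m"
      have ab: "0 \<le> a" "a \<le> b" "b \<le> 1" "b - a = 1 / m" using Suc.prems m0 by (auto simp: a_def b_def field_simps)
      have int: "(\<lambda>t. \<Phi> t z) integrable_on {0..b}"
        using ab by (intro integrable_continuous_interval continuous_on_subset[OF contz]) auto
      have intab: "(\<lambda>t. \<Phi> t z) integrable_on {a..b}"
        using ab by (intro integrable_continuous_interval continuous_on_subset[OF contz]) auto
      have split: "integral {0..b} (\<lambda>t. \<Phi> t z) = integral {0..a} (\<lambda>t. \<Phi> t z) + integral {a..b} (\<lambda>t. \<Phi> t z)"
        using Henstock_Kurzweil_Integration.integral_combine[OF ab(1,2) int] by simp
      have "integral {a..b} (\<lambda>t. \<Phi> t z - \<Phi> a z) = integral {a..b} (\<lambda>t. \<Phi> t z) - integral {a..b} (\<lambda>t. \<Phi> a z)"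
        by (intro integral_diff intab) auto
      also have "integral {a..b} (\<lambda>t. \<Phi> a z) = \<Phi> a z / of_nat m" using ab by (simp add: scaleR_conv_of_real)
      finally have eq: "integral {a..b} (\<lambda>t. \<Phi> t z) - \<Phi> a z / of_nat m = integral {a..b} (\<lambda>t. \<Phi> t z - \<Phi> a z)" ..
      have "norm (integral {a..b} (\<lambda>t. \<Phi> t z - \<Phi> a z)) \<le> e / 2 * (b - a)"
      proof (rule integral_bound[OF ab(2)])
        show "continuous_on {a..b} (\<lambda>t. \<Phi> t z - \<Phi> a z)"
          using ab by (intro continuous_intros continuous_on_subset[OF contz]) auto
        fix t assume t: "t \<in> {a..b}"
        then have "\<bar>t - a\<bar> < d" using ab(4) md by auto
        then show "norm (\<Phi> t z - \<Phi> a z) \<le> e / 2" using d(2)[of t a z] t ab z by auto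
      qed
      then have 1: "norm (integral {a..b} (\<lambda>t. \<Phi> t z) - \<Phi> a z / of_nat m) \<le> e / 2 / m"
        unfolding eq ab(4) by simp
      have IH: "norm (integral {0..a} (\<lambda>t. \<Phi> t z) - (\<Sum>j<k. \<Phi> (real j / real m) z / of_nat m)) \<le> real k * (e / 2 / m)"
        using Suc by (simp add: a_def)
      have "norm ((integral {0..a} (\<lambda>t. \<Phi> t z) - (\<Sum>j<k. \<Phi> (real j / real m) z / of_nat m))
           + (integral {a..b} (\<lambda>t. \<Phi> t z) - \<Phi> a z / of_nat m)) \<le> real k * (e / 2 / m) + e / 2 / m"
        by (rule order_trans[OF norm_triangle_ineq add_mono[OF IH 1]])
      moreover have "integral {0..b} (\<lambda>t. \<Phi> t z) - (\<Sum>j<Suc k. \<Phi> (real j / real m) z / of_nat m)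
        = (integral {0..a} (\<lambda>t. \<Phi> t z) - (\<Sum>j<k. \<Phi> (real j / real m) z / of_nat m))
           + (integral {a..b} (\<lambda>t. \<Phi> t z) - \<Phi> a z / of_nat m)"
        unfolding split by (simp add: a_def)
      moreover have "real k * (e / 2 / m) + e / 2 / m = real (Suc k) * (e / 2 / m)"
        by (simp only: of_nat_Suc distrib_right mult_1_left add.commute)
      ultimately have "norm (integral {0..b} (\<lambda>t. \<Phi> t z) - (\<Sum>j<Suc k. \<Phi> (real j / real m) z / of_nat m))
          \<le> real (Suc k) * (e / 2 / m)" by (simp only:)
      then show ?case by (simp only: b_def)
    qed simp
    from this[of m] m0 have "norm (integral {0..1} (\<lambda>t. \<Phi> t z) - (\<Sum>j<m. \<Phi> (real j / real m) z / of_nat m)) \<le> e / 2"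
      by simp
    then show "norm (integral {0..1} (\<lambda>t. \<Phi> t z) - (\<Sum>j<m. \<Phi> (real j / real m) z / of_nat m)) < e"
      using e by simp
  qed
qed

text \<open>A circle in the disc replaces a cycle around \<open>K\<close>: Cauchy's formula on
  \<open>norm w = \<rho>\<close> writes \<open>\<phi> z\<close> as an integral with integrand a
  multiple, independent of \<open>z\<close>, of \<open>1 / (\<psi> (\<gamma> t) - z)\<close>. Its
  Riemann sums are combinations of simple fractions with poles off \<open>K\<close>.\<close>

lemma riemann_map_in_poly_closure:
  assumes K: "compact K" "connected (- K)" "K \<subseteq> U"
    and \<psi>: "\<psi> holomorphic_on ball 0 (1::real)" "\<And>w. w \<in> ball 0 1 \<Longrightarrow> \<phi> (\<psi> w) = w"
    and \<phi>: "continuous_on U \<phi>" "\<And>z. z \<in> U \<Longrightarrow> \<phi> z \<in> ball 0 1" "\<And>z. z \<in> U \<Longrightarrow> \<psi> (\<phi> z) = z"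
  shows "\<phi> \<in> poly_closure K"
proof (cases "K = {}")
  case True then show ?thesis by (simp add: poly_closure_def)
next
  case False
  have inj: "inj_on \<psi> (ball 0 1)" by (rule inj_on_inverseI[of _ \<phi>]) (use \<psi> in auto)
  have reg: "deriv \<psi> w \<noteq> 0" if "w \<in> ball 0 1" for w
    using holomorphic_injective_imp_regular[OF \<psi>(1) open_ball inj that] .
  have "continuous_on K (\<lambda>z. norm (\<phi> z))" by (intro continuous_on_norm continuous_on_subset[OF \<phi>(1) K(3)])
  then obtain k where k: "k \<in> K" "\<And>z. z \<in> K \<Longrightarrow> norm (\<phi> z) \<le> norm (\<phi> k)"
    using continuous_attains_sup[OF K(1) False] by blast
  \<comment> \<open>Halfway between the maximum of \<open>norm (\<phi> z)\<close> on
    \<open>K\<close> and 1, so that the image of the circle under \<open>\<psi>\<close> misses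
    \<open>K\<close>.\<close>
  define \<rho> where "\<rho> = (norm (\<phi> k) + 1) / 2"
  have k1: "norm (\<phi> k) < 1" using \<phi>(2)[of k] k(1) K(3) by auto
  have \<rho>: "0 < \<rho>" "\<rho> < 1" using k1 by (simp_all add: \<rho>_def add_nonneg_pos)
  have \<phi>\<rho>: "norm (\<phi> z) < \<rho>" if "z \<in> K" for z using k(2)[OF that] k1 by (simp add: \<rho>_def)
  define \<gamma> where "\<gamma> = circlepath 0 \<rho>"
  have \<gamma>n: "norm (\<gamma> t) = \<rho>" for t using \<rho> by (simp add: \<gamma>_def circlepath norm_mult)
  have \<gamma>b: "\<gamma> t \<in> ball 0 1" for t using \<gamma>n[of t] \<rho> by simp
  have notK: "\<psi> (\<gamma> t) \<notin> K" for t
  proof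
    assume "\<psi> (\<gamma> t) \<in> K"
    from \<phi>\<rho>[OF this] show False using \<psi>(2)[OF \<gamma>b] \<gamma>n[of t] by simp
  qed
  define c where "c t = \<gamma> t * deriv \<psi> (\<gamma> t) * (2 * of_real pi * \<i> * \<rho> * exp (2 * of_real pi * \<i> * of_real t))" for t
  define \<Phi> where "\<Phi> t z = c t * (1 / (\<psi> (\<gamma> t) - z))" for t z
  have int: "integral {0..1} (\<lambda>t. \<Phi> t z) = 2 * of_real pi * \<i> * \<phi> z" if z: "z \<in> K" for z
  proof -
    define w0 where "w0 = \<phi> z"
    have zU: "z \<in> U" using z K(3) by blast
    have w0: "w0 \<in> ball 0 1" "\<psi> w0 = z" "norm (w0 - 0) < \<rho>" using \<phi>(2,3)[OF zU] \<phi>\<rho>[OF z] by (auto simp: w0_def)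
    \<comment> \<open>The difference quotient of \<open>\<psi>\<close> at \<open>w0\<close>. It is
      zero-free since \<open>\<psi>\<close> is injective, and dividing by it turns the Cauchy kernel
      \<open>1 / (w - w0)\<close> of the disc into \<open>1 / (\<psi> w - z)\<close>. The factor
      \<open>w * deriv \<psi> w\<close> makes the value \<open>N w0\<close> equal to
      \<open>w0\<close>.\<close>
    define q where "q w = (if w = w0 then deriv \<psi> w0 else (\<psi> w - \<psi> w0) / (w - w0))" for w
    have q: "q holomorphic_on ball 0 1" unfolding q_def by (rule pole_lemma_open[OF \<psi>(1) open_ball])
    have qnz: "q w \<noteq> 0" if "w \<in> ball 0 1" for w
      using reg[OF w0(1)] inj_onD[OF inj _ that w0(1)] by (auto simp: q_def)
    define N where "N w = w * deriv \<psi> w / q w" for w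
    have "N holomorphic_on ball 0 1" unfolding N_def
      using qnz by (intro holomorphic_intros q holomorphic_deriv \<psi>) auto
    then have "N holomorphic_on cball 0 \<rho>" by (rule holomorphic_on_subset) (use \<rho> in auto)
    from Cauchy_integral_circlepath_simple[OF this w0(3)]
    have "((\<lambda>u. N u / (u - w0)) has_contour_integral 2 * of_real pi * \<i> * N w0) (circlepath 0 \<rho>)" .
    moreover have "N w0 = w0" using reg[OF w0(1)] by (simp add: N_def q_def)
    moreover have "N (\<gamma> t) / (\<gamma> t - w0) = \<gamma> t * deriv \<psi> (\<gamma> t) * (1 / (\<psi> (\<gamma> t) - z))" for t
    proof -
      have "\<gamma> t \<noteq> w0" using \<gamma>n[of t] w0(3) by auto
      then show ?thesis using w0(2) by (simp add: N_def q_def)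
    qed
    ultimately have "((\<lambda>t. \<gamma> t * deriv \<psi> (\<gamma> t) * (1 / (\<psi> (\<gamma> t) - z)) * vector_derivative \<gamma> (at t within {0..1}))
        has_integral 2 * of_real pi * \<i> * w0) {0..1}"
      unfolding has_contour_integral_def \<gamma>_def[symmetric] by simp
    then have "((\<lambda>t. \<Phi> t z) has_integral 2 * of_real pi * \<i> * w0) {0..1}"
      by (rule has_integral_eq[rotated])
         (simp add: \<gamma>_def[symmetric] \<Phi>_def c_def vector_derivative_circlepath01[of _ 0 \<rho>, folded \<gamma>_def])
    then show ?thesis by (simp add: integral_unique w0_def)
  qed
  have "continuous_on UNIV \<gamma>" unfolding \<gamma>_def circlepath by (intro continuous_intros)
  then have cont\<gamma>: "continuous_on A \<gamma>" for A using continuous_on_subset by blast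
  have cont\<psi>: "continuous_on A (\<lambda>t. \<psi> (\<gamma> t))" for A
    by (rule continuous_on_compose2[OF holomorphic_on_imp_continuous_on[OF \<psi>(1)] cont\<gamma>]) (use \<gamma>b in auto)
  have cont\<psi>': "continuous_on A (\<lambda>t. deriv \<psi> (\<gamma> t))" for A
    by (rule continuous_on_compose2[OF holomorphic_on_imp_continuous_on[OF holomorphic_deriv[OF \<psi>(1) open_ball]] cont\<gamma>])
       (use \<gamma>b in auto)
  have contc: "continuous_on {0..1} c" unfolding c_def by (intro continuous_intros cont\<psi>' cont\<gamma>)
  have cont: "continuous_on ({0..1} \<times> K) (\<lambda>(t, z). \<Phi> t z)"
    unfolding \<Phi>_def case_prod_beta
    by (intro continuous_intros continuous_on_compose2[OF contc] continuous_on_compose2[OF cont\<psi>[of "{0..1}"]])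
       (use notK in auto)
  have "(\<lambda>z. 2 * of_real pi * \<i> * \<phi> z) \<in> poly_closure K"
  proof (rule poly_closure_uniform)
    fix e :: real assume e: "e > 0"
    obtain m :: nat where m: "m > 0"
      "\<And>z. z \<in> K \<Longrightarrow> norm (integral {0..1} (\<lambda>t. \<Phi> t z) - (\<Sum>j<m. \<Phi> (real j / real m) z / of_nat m)) < e"
      using uniform_riemann_sums[OF K(1) cont e] by blast
    have *: "(\<lambda>z. c t / of_nat m * (1 / (\<psi> (\<gamma> t) - z))) \<in> poly_closure K" for t
      by (intro poly_closure_cmult[OF K(1)] poly_closure_pole[OF K(1,2) notK])
    have "(\<lambda>z. \<Phi> t z / of_nat m) \<in> poly_closure K" for t
      by (rule poly_closure_cong[OF *[of t]]) (simp add: \<Phi>_def)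
    then have "(\<lambda>z. \<Sum>j<m. \<Phi> (real j / real m) z / of_nat m) \<in> poly_closure K"
      by (intro poly_closure_sum)
    then show "\<exists>g\<in>poly_closure K. \<forall>z\<in>K. norm (2 * of_real pi * \<i> * \<phi> z - g z) < e"
      using m(2) int by (intro bexI[of _ "\<lambda>z. \<Sum>j<m. \<Phi> (real j / real m) z / of_nat m"]) auto
  qed
  from poly_closure_cmult[OF K(1) this, of "1 / (2 * of_real pi * \<i>)"]
  show ?thesis by (rule poly_closure_cong) simp
qed

section \<open>Simply connected neighbourhoods of compact sets\<close>

text \<open>Every point of the compact set \<open>L\<close> of points to be excluded is joined to
  one far point \<open>b\<close> by a closed connected set off \<open>K\<close>, a small disc with a
  path. Finitely many of these cover \<open>L\<close>, and with the exterior \<open>E\<close> of a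
  large disc they form a closed connected set \<open>S\<close>. The component \<open>U\<close> of
  its complement that contains \<open>K\<close> has connected complement, so it is simply
  connected.\<close>

lemma simply_connected_nbhd:
  fixes K :: "complex set"
  assumes K: "compact K" "connected K" "K \<noteq> {}" "connected (- K)" and d: "d > 0"
  obtains U where "open U" "simply_connected U" "bounded U" "K \<subseteq> U" "\<And>z. z \<in> U \<Longrightarrow> infdist z K < d"
proof -
  obtain R where R: "R > 0" "\<And>z. z \<in> K \<Longrightarrow> norm z < R"
    using compact_imp_bounded[OF K(1)] bounded_pos_less by blast
  define E where "E = {z::complex. R \<le> norm z}"
  define L where "L = {z. d \<le> infdist z K} \<inter> cball 0 R"
  have "closed {z. d \<le> infdist z K}" by (intro closed_Collect_le continuous_intros)
  then have cL: "compact L" unfolding L_def by (intro closed_Int_compact compact_cball)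
  have opK: "open (- K)" using K(1) compact_imp_closed by blast
  have pc: "path_connected (- K)" using connected_open_path_connected[OF opK K(4)] .
  define b where "b = complex_of_real R"
  have bE: "b \<in> E" using R(1) by (simp add: E_def b_def)
  have EK: "E \<subseteq> - K" using R(2) by (force simp: E_def)
  have "\<exists>T. closed T \<and> connected T \<and> x \<in> interior T \<and> T \<subseteq> - K \<and> b \<in> T" if x: "x \<in> L" for x
  proof -
    have xK: "x \<in> - K"
    proof
      assume "x \<in> K"
      then have "infdist x K = 0" by simp
      then show False using x d by (simp add: L_def)
    qed
    then obtain r where r: "r > 0" "cball x r \<subseteq> - K" using opK open_contains_cball by blast
    obtain g where g: "path g" "path_image g \<subseteq> - K" "pathstart g = x" "pathfinish g = b"
      using pc xK bE EK unfolding path_connected_def by (metis subsetD)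
    show ?thesis
    proof (intro exI conjI)
      show "connected (cball x r \<union> path_image g)"
      proof (intro connected_Un connected_path_image)
        have "x \<in> cball x r \<inter> path_image g" using g(3) r(1) pathstart_in_path_image[of g] by simp
        then show "cball x r \<inter> path_image g \<noteq> {}" by blast
      qed (use g in auto)
      show "closed (cball x r \<union> path_image g)" using closed_path_image[OF g(1)] by auto
      show "b \<in> cball x r \<union> path_image g" using g(4) pathfinish_in_path_image[of g] by auto
      have "ball x r \<subseteq> interior (cball x r \<union> path_image g)" by (intro interior_maximal) auto
      then show "x \<in> interior (cball x r \<union> path_image g)" using r(1) by auto
    qed (use r g in auto)
  qed
  then have "\<forall>x\<in>L. \<exists>T. closed T \<and> connected T \<and> x \<in> interior T \<and> T \<subseteq> - K \<and> b \<in> T" by blast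
  from bchoice[OF this] obtain T where rT: "\<forall>x\<in>L. closed (T x) \<and> connected (T x) \<and> x \<in> interior (T x) \<and> T x \<subseteq> - K \<and> b \<in> T x"
    ..
  have cov: "L \<subseteq> (\<Union>x\<in>L. interior (T x))" using rT by blast
  obtain X where X: "X \<subseteq> L" "finite X" "L \<subseteq> (\<Union>x\<in>X. interior (T x))"
    by (rule compactE_image[OF cL _ cov]) auto
  define S where "S = E \<union> (\<Union>x\<in>X. T x)"
  have conE: "connected E"
  proof -
    have "E = - ball 0 R" by (auto simp: E_def)
    then show ?thesis using connected_complement_bounded_convex[of "ball (0::complex) R"] by (simp del: Compl_iff)
  qed
  have clE: "closed E" unfolding E_def by (intro closed_Collect_le continuous_intros)
  have clS: "closed S" unfolding S_def using X clE rT by (intro closed_Un closed_UN) auto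
  have "connected (\<Union>(insert E (T ` X)))"
  proof (rule connected_Union)
    have "b \<in> \<Inter>(insert E (T ` X))" using bE rT X(1) by auto
    then show "\<Inter>(insert E (T ` X)) \<noteq> {}" by blast
  qed (use conE rT X in auto)
  then have conS: "connected S" by (simp add: S_def)
  have SK: "S \<subseteq> - K" unfolding S_def using EK rT X(1) by blast
  have LS: "L \<subseteq> S" unfolding S_def using X interior_subset by blast
  obtain k where k: "k \<in> K" using K(3) by blast
  define U where "U = connected_component_set (- S) k"
  have opU: "open U" unfolding U_def using clS by (intro open_connected_component) auto
  have KU: "K \<subseteq> U" unfolding U_def using SK by (intro connected_component_maximal k K) auto
  have US: "U \<subseteq> - S" unfolding U_def by (rule connected_component_subset)
  have "U \<in> components (- S)" unfolding U_def using k SK by (intro componentsI) auto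
  then have conU: "connected (- U)" "connected U"
    using component_complement_connected[OF conS] in_components_connected by blast+
  have UR: "norm z < R" if "z \<in> U" for z using US that by (force simp: S_def E_def)
  then have bU: "bounded U" unfolding bounded_iff by (meson less_imp_le)
  show thesis
  proof (rule that[OF opU _ bU KU])
    show "simply_connected U" using simply_connected_iff_simple[OF opU bU] conU by blast
    show "infdist z K < d" if "z \<in> U" for z
    proof (rule ccontr)
      assume "\<not> infdist z K < d"
      then have "z \<in> L" using UR[OF that] by (simp add: L_def)
      then show False using LS US that by blast
    qed
  qed
qed

section \<open>Approximation of Riemann maps of Caratheodory domains\<close>

lemma riemann_map_normalized:
  assumes "open U" "simply_connected U" "U \<noteq> UNIV" "w0 \<in> U"
  obtains f g where "f holomorphic_on U" "g holomorphic_on ball 0 (1::real)"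
    "\<And>z. z \<in> U \<Longrightarrow> f z \<in> ball 0 1 \<and> g (f z) = z" "\<And>w. w \<in> ball 0 1 \<Longrightarrow> g w \<in> U \<and> f (g w) = w"
    "f w0 = 0" "g 0 = w0"
proof -
  have "\<exists>f g. f holomorphic_on U \<and> g holomorphic_on ball 0 1 \<and>
                 (\<forall>z \<in> U. f z \<in> ball 0 1 \<and> g(f z) = z) \<and> (\<forall>z \<in> ball 0 1. g z \<in> U \<and> f(g z) = z)"
    using Riemann_mapping_theorem[of U] assms by blast
  then obtain f g where fg: "f holomorphic_on U" "g holomorphic_on ball 0 1"
    "\<And>z. z \<in> U \<Longrightarrow> f z \<in> ball 0 1 \<and> g (f z) = z" "\<And>w. w \<in> ball 0 1 \<Longrightarrow> g w \<in> U \<and> f (g w) = w" by blast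
  obtain a b where ab: "a (f w0) = 0" "a holomorphic_on ball 0 1" "a ` ball 0 1 \<subseteq> ball 0 1"
     "b holomorphic_on ball 0 1" "b ` ball 0 1 \<subseteq> ball 0 1"
     "\<And>z. z \<in> ball 0 1 \<Longrightarrow> a (b z) = z" "\<And>z. z \<in> ball 0 1 \<Longrightarrow> b (a z) = z"
    using ball_biholomorphism_exists[of "f w0"] fg(3)[OF assms(4)] by metis
  show thesis
  proof (rule that[of "a \<circ> f" "g \<circ> b"])
    show "a \<circ> f holomorphic_on U" using fg(3) by (intro holomorphic_on_compose_gen[OF fg(1) ab(2)]) blast
    show "g \<circ> b holomorphic_on ball 0 1" by (rule holomorphic_on_compose_gen[OF ab(4) fg(2) ab(5)])
    show "(a \<circ> f) z \<in> ball 0 1 \<and> (g \<circ> b) ((a \<circ> f) z) = z" if "z \<in> U" for z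
    proof -
      have "a (f z) \<in> ball 0 1" using fg(3)[OF that] ab(3) by blast
      then show ?thesis using fg(3)[OF that] ab(7)[of "f z"] by simp
    qed
    show "(g \<circ> b) w \<in> U \<and> (a \<circ> f) ((g \<circ> b) w) = w" if "w \<in> ball 0 1" for w
    proof -
      have "b w \<in> ball 0 1" using that ab(5) by blast
      then show ?thesis using fg(4)[of "b w"] ab(6)[OF that] by simp
    qed
    show "(a \<circ> f) w0 = 0" using ab(1) by simp
    have "b 0 = f w0" using ab(7)[of "f w0"] ab(1) fg(3)[OF assms(4)] by simp
    then show "(g \<circ> b) 0 = w0" using fg(3)[OF assms(4)] by simp
  qed
qed

text \<open>Let \<open>f n\<close> be Riemann maps of shrinking neighbourhoods of \<open>K\<close>;
  then \<open>m n = f n \<circ> \<kappa>\<close> is a self-map of the disc fixing 0. Were its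
  derivative at 0 of modulus at most \<open>1 - \<eta>\<close> for all \<open>n\<close>, a limit
  \<open>\<psi>\<close> of the inverse maps would send the disc into \<open>G\<close> and satisfy
  \<open>norm (deriv \<kappa> 0) \<le> (1 - \<eta>) * norm (deriv \<psi> 0)\<close>, whereas the
  Schwarz lemma for \<open>\<phi> \<circ> \<psi>\<close> gives
  \<open>norm (deriv \<psi> 0) \<le> norm (deriv \<kappa> 0)\<close>. For a good \<open>n\<close>,
  \<open>q\<close> is the quotient \<open>m n w / w\<close> up to rotation.\<close>

lemma caratheodory_riemann_map_approx:
  assumes K: "compact K" "connected K" "connected (- K)" and intK: "interior K = G"
    and \<kappa>: "\<kappa> holomorphic_on ball 0 (1::real)" "\<And>w. w \<in> ball 0 1 \<Longrightarrow> \<kappa> w \<in> G \<and> \<phi> (\<kappa> w) = w"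
    and \<phi>: "\<phi> holomorphic_on G" "\<And>z. z \<in> G \<Longrightarrow> \<phi> z \<in> ball 0 1 \<and> \<kappa> (\<phi> z) = z"
    and w0: "\<kappa> 0 = w0" and \<eta>: "0 < \<eta>" "\<eta> < 1"
  obtains f q where "f \<in> poly_closure K" "q holomorphic_on ball 0 (1::real)"
    "\<And>w. w \<in> ball 0 1 \<Longrightarrow> f (\<kappa> w) = w * q w" "\<And>w. w \<in> ball 0 1 \<Longrightarrow> norm (q w) \<le> 1" "Re (q 0) > 1 - \<eta>"
proof -
  have w0G: "w0 \<in> G" using \<kappa>(2)[of 0] w0 by simp
  have opG: "open G" using intK by auto
  have GK: "G \<subseteq> K" using intK interior_subset by blast
  have K0: "K \<noteq> {}" using w0G GK by blast
  have "\<exists>U. open U \<and> simply_connected U \<and> bounded U \<and> K \<subseteq> U \<and> (\<forall>z\<in>U. infdist z K < inverse (real (Suc n)))" for n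
    using simply_connected_nbhd[OF K(1,2) K0 K(3), of "inverse (real (Suc n))"] by (metis inverse_positive_iff_positive of_nat_0_less_iff zero_less_Suc)
  then obtain U where U: "\<And>n. open (U n)" "\<And>n. simply_connected (U n)" "\<And>n. bounded (U n)" "\<And>n. K \<subseteq> U n"
    "\<And>n z. z \<in> U n \<Longrightarrow> infdist z K < inverse (real (Suc n))" by metis
  have Un: "U n \<noteq> UNIV" for n using U(3)[of n] not_bounded_UNIV by metis
  have w0U: "w0 \<in> U n" for n using w0G GK U(4) by blast
  have "\<exists>f g. f holomorphic_on U n \<and> g holomorphic_on ball 0 1 \<and> (\<forall>z\<in>U n. f z \<in> ball 0 1 \<and> g (f z) = z) \<and>
      (\<forall>w\<in>ball 0 1. g w \<in> U n \<and> f (g w) = w) \<and> f w0 = 0 \<and> g 0 = w0" for n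
    using riemann_map_normalized[OF U(1) U(2) Un w0U, of n] by metis
  then obtain f g where fg: "\<And>n. f n holomorphic_on U n" "\<And>n. g n holomorphic_on ball 0 1"
    "\<And>n z. z \<in> U n \<Longrightarrow> f n z \<in> ball 0 1 \<and> g n (f n z) = z"
    "\<And>n w. w \<in> ball 0 1 \<Longrightarrow> g n w \<in> U n \<and> f n (g n w) = w" "\<And>n. f n w0 = 0" "\<And>n. g n 0 = w0"
    by metis
  define m where "m n = f n \<circ> \<kappa>" for n
  have \<kappa>U: "\<kappa> ` ball 0 1 \<subseteq> U n" for n using \<kappa>(2) GK U(4) by blast
  have m: "m n holomorphic_on ball 0 1" for n
    unfolding m_def by (rule holomorphic_on_compose_gen[OF \<kappa>(1) fg(1) \<kappa>U])
  have m0: "m n 0 = 0" for n using fg(5) w0 by (simp add: m_def)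
  have m1: "norm (m n w) < 1" if "norm w < 1" for n w
  proof -
    have "\<kappa> w \<in> U n" using \<kappa>U[of n] that by auto
    then show ?thesis using fg(3)[of "\<kappa> w" n] by (simp add: m_def)
  qed
  have z: "(0::complex) \<in> ball 0 1" by simp
  have dm: "deriv (m n) 0 = deriv (f n) w0 * deriv \<kappa> 0" for n
    unfolding m_def using deriv_chain[of \<kappa> 0 "f n"] w0
      holomorphic_on_imp_differentiable_at[OF \<kappa>(1) open_ball z]
      holomorphic_on_imp_differentiable_at[OF fg(1) U(1) w0U] by simp
  have \<kappa>G: "\<kappa> ` ball 0 1 \<subseteq> G" using \<kappa>(2) by blast
  have d\<kappa>: "deriv \<kappa> 0 * deriv \<phi> w0 = 1"
    using deriv_left_inverse[OF \<kappa>(1) \<phi>(1) open_ball opG \<kappa>G _ z] \<kappa>(2) w0 by auto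
  have dg: "deriv (g n) 0 * deriv (f n) w0 = 1" for n
  proof -
    have "g n ` ball 0 1 \<subseteq> U n" using fg(4) by blast
    from deriv_left_inverse[OF fg(2) fg(1) open_ball U(1) this _ z] show ?thesis using fg(4) fg(6) by auto
  qed
  have "\<exists>n. norm (deriv (m n) 0) > 1 - \<eta>"
  proof (rule ccontr)
    assume "\<not> ?thesis"
    then have le: "norm (deriv (m n) 0) \<le> 1 - \<eta>" for n by (meson not_le)
    have lb: "norm (deriv \<kappa> 0) \<le> (1 - \<eta>) * norm (deriv (g n) 0)" for n
    proof -
      have "deriv \<kappa> 0 = deriv (m n) 0 * deriv (g n) 0" 
      proof -
        have "deriv (m n) 0 * deriv (g n) 0 = deriv \<kappa> 0 * (deriv (g n) 0 * deriv (f n) w0)" by (simp add: dm)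
        then show ?thesis by (simp add: dg)
      qed
      then have "norm (deriv \<kappa> 0) = norm (deriv (m n) 0) * norm (deriv (g n) 0)" by (simp add: norm_mult)
      also have "\<dots> \<le> (1 - \<eta>) * norm (deriv (g n) 0)" using le by (intro mult_right_mono) auto
      finally show ?thesis .
    qed
    obtain B where B: "\<And>z. z \<in> K \<Longrightarrow> norm z \<le> B" using compact_imp_bounded[OF K(1)] bounded_iff by metis
    have gB: "norm (g n w) \<le> B + 1" if w: "w \<in> ball 0 1" for n w
    proof -
      have "infdist (g n w) K < inverse (real (Suc n))" using U(5) fg(4)[OF w] by blast
      also have "\<dots> \<le> 1" by (simp add: inverse_le_1_iff)
      finally have "infdist (g n w) K < 1" .
      moreover obtain k where "k \<in> K" "infdist (g n w) K = dist (g n w) k"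
        using infdist_attains_inf[OF compact_imp_closed[OF K(1)] K0] by metis
      ultimately show ?thesis
        using B[of k] norm_triangle_sub[of "g n w" k] by (simp add: dist_norm)
    qed
    obtain \<psi> r where \<psi>: "\<psi> holomorphic_on ball 0 1" "strict_mono (r :: nat \<Rightarrow> nat)"
      "\<And>x. x \<in> ball 0 1 \<Longrightarrow> (\<lambda>n. g (r n) x) \<longlonglongrightarrow> \<psi> x"
      "\<And>K. compact K \<Longrightarrow> K \<subseteq> ball 0 1 \<Longrightarrow> uniform_limit K (g \<circ> r) \<psi> sequentially"
    proof (rule Montel[of "ball 0 1" "range g" g])
      show "\<exists>C. \<forall>h\<in>range g. \<forall>z\<in>L. norm (h z) \<le> C" if "L \<subseteq> ball 0 1" for L
        using that gB by (intro exI[of _ "B + 1"]) blast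
    qed (use fg(2) in auto)
    have \<psi>0: "\<psi> 0 = w0" using \<psi>(3)[OF z] by (simp add: fg(6) LIMSEQ_const_iff)
    have \<psi>K: "\<psi> w \<in> K" if w: "w \<in> ball 0 1" for w
    proof -
      have "(\<lambda>n. infdist (g (r n) w) K) \<longlonglongrightarrow> infdist (\<psi> w) K" by (intro tendsto_infdist \<psi> w)
      moreover have "(\<lambda>n. infdist (g (r n) w) K) \<longlonglongrightarrow> 0"
      proof (rule tendsto_sandwich[OF _ _ tendsto_const])
        show "(\<lambda>n. inverse (real (Suc (r n)))) \<longlonglongrightarrow> 0"
          using LIMSEQ_subseq_LIMSEQ[OF LIMSEQ_inverse_real_of_nat \<psi>(2)] by (simp add: o_def)
        show "\<forall>\<^sub>F n in sequentially. infdist (g (r n) w) K \<le> inverse (real (Suc (r n)))"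
          using U(5) fg(4)[OF w] less_imp_le by (intro always_eventually) blast
      qed (simp add: infdist_nonneg)
      ultimately have "infdist (\<psi> w) K = 0" by (rule LIMSEQ_unique)
      then show ?thesis using in_closed_iff_infdist_zero[OF compact_imp_closed[OF K(1)] K0] by blast
    qed
    have "uniform_limit (cball 0 (1/2)) (g \<circ> r) \<psi> sequentially" by (rule \<psi>(4)) auto
    then have "(\<lambda>n. deriv ((g \<circ> r) n) 0) \<longlonglongrightarrow> deriv \<psi> 0"
    proof -
      have "uniform_limit (ball 0 (1/2)) (g \<circ> r) \<psi> sequentially"
        by (rule uniform_limit_on_subset[OF \<psi>(4)[of "cball 0 (1/2)"]]) auto
      then show ?thesis
      proof (rule deriv_complex_uniform_limit)
        show "\<forall>\<^sub>F n in sequentially. (g \<circ> r) n holomorphic_on ball 0 (1/2)"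
          using holomorphic_on_subset[OF fg(2) subset_ball[of "1/2" 1]] by (auto intro!: always_eventually)
      qed auto
    qed
    then have "(\<lambda>n. (1 - \<eta>) * norm (deriv (g (r n)) 0)) \<longlonglongrightarrow> (1 - \<eta>) * norm (deriv \<psi> 0)"
      by (intro tendsto_intros) (simp add: o_def)
    then have lim: "norm (deriv \<kappa> 0) \<le> (1 - \<eta>) * norm (deriv \<psi> 0)"
      by (rule tendsto_lowerbound) (use lb in auto)
    have \<kappa>nz: "deriv \<kappa> 0 \<noteq> 0" using d\<kappa> by auto
    then have \<psi>nz: "deriv \<psi> 0 \<noteq> 0" using lim by auto
    have nc: "\<not> \<psi> constant_on ball 0 1"
    proof
      assume "\<psi> constant_on ball 0 1"
      then obtain c where c: "\<And>w. w \<in> ball 0 1 \<Longrightarrow> \<psi> w = c" unfolding constant_on_def by blast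
      have "deriv \<psi> 0 = deriv (\<lambda>_. c) 0"
        by (rule deriv_cong_ev) (use c in \<open>auto simp: eventually_nhds intro!: exI[of _ "ball 0 1"]\<close>)
      then show False using \<psi>nz by simp
    qed
    \<comment> \<open>The limit is only known to take values in \<open>K\<close>; being nonconstant
      it is open, so its values lie in the interior \<open>G\<close>.\<close>
    have "open (\<psi> ` ball 0 1)" by (rule open_mapping_thm[OF \<psi>(1) _ _ _ _ nc]) auto
    then have \<psi>G: "\<psi> ` ball 0 1 \<subseteq> G" using \<psi>K unfolding intK[symmetric] by (intro interior_maximal) auto
    have "norm (deriv (\<phi> \<circ> \<psi>) 0) \<le> 1"
    proof (rule Schwarz_Lemma(2))
      show "\<phi> \<circ> \<psi> holomorphic_on ball 0 1" by (rule holomorphic_on_compose_gen[OF \<psi>(1) \<phi>(1) \<psi>G])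
      show "(\<phi> \<circ> \<psi>) 0 = 0" using \<psi>0 \<kappa>(2)[of 0] w0 by simp
      show "norm ((\<phi> \<circ> \<psi>) w) < 1" if "norm w < 1" for w
      proof -
        have "\<psi> w \<in> G" using \<psi>G that by auto
        then show ?thesis using \<phi>(2)[of "\<psi> w"] by simp
      qed
      show "norm (0::complex) < 1" by simp
    qed
    moreover have "deriv (\<phi> \<circ> \<psi>) 0 = deriv \<phi> w0 * deriv \<psi> 0"
      using deriv_chain[of \<psi> 0 \<phi>] \<psi>0 holomorphic_on_imp_differentiable_at[OF \<psi>(1) open_ball z]
        holomorphic_on_imp_differentiable_at[OF \<phi>(1) opG w0G] by simp
    ultimately have "norm (deriv \<phi> w0) * norm (deriv \<psi> 0) \<le> 1" by (simp add: norm_mult)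
    then have "norm (deriv \<kappa> 0) * (norm (deriv \<phi> w0) * norm (deriv \<psi> 0)) \<le> norm (deriv \<kappa> 0) * 1"
      by (intro mult_left_mono) auto
    moreover have "norm (deriv \<kappa> 0) * norm (deriv \<phi> w0) = 1" by (metis d\<kappa> norm_mult norm_one)
    ultimately have "norm (deriv \<psi> 0) \<le> norm (deriv \<kappa> 0)" by (simp add: mult.assoc[symmetric])
    also have "\<dots> \<le> (1 - \<eta>) * norm (deriv \<psi> 0)" by (rule lim)
    finally have "\<eta> * norm (deriv \<psi> 0) \<le> 0" by (simp add: algebra_simps)
    then show False using \<eta> \<psi>nz by (simp add: mult_le_0_iff)
  qed
  then obtain n where n: "norm (deriv (m n) 0) > 1 - \<eta>" by blast
  define d where "d = deriv (m n) 0"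
  have d0: "norm d > 0" using n \<eta> unfolding d_def by linarith
  \<comment> \<open>Rotates the derivative onto the positive axis, so that \<open>Re (q 0)\<close>
    is its modulus.\<close>
  define c where "c = cnj d / norm d"
  have nc: "norm c = 1" using d0 by (simp add: c_def norm_divide)
  have cd: "c * d = norm d" using d0 by (simp add: c_def complex_norm_square[symmetric] power2_eq_square mult.commute)
  define q where "q w = c * (if w = 0 then deriv (m n) 0 else (m n w - m n 0) / (w - 0))" for w
  show thesis
  proof (rule that[of "\<lambda>z. c * f n z" q])
    show "(\<lambda>z. c * f n z) \<in> poly_closure K"
    proof (rule poly_closure_cmult[OF K(1) riemann_map_in_poly_closure[OF K(1,3) U(4) fg(2)]])
      show "continuous_on (U n) (f n)" using fg(1) by (rule holomorphic_on_imp_continuous_on)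
    qed (use fg in auto)
    show "q holomorphic_on ball 0 1" unfolding q_def
      by (intro holomorphic_intros pole_lemma_open m open_ball)
    show "c * f n (\<kappa> w) = w * q w" if "w \<in> ball 0 1" for w
      using m0[of n] by (auto simp: q_def m_def)
    show "norm (q w) \<le> 1" if w: "w \<in> ball 0 1" for w
    proof (cases "w = 0")
      case True
      have "norm (deriv (m n) 0) \<le> 1"
        by (rule Schwarz_Lemma(2)[OF m m0 m1, of 0]) auto
      then show ?thesis using True nc by (simp add: q_def norm_mult)
    next
      case False
      have "norm (m n w) \<le> norm w"
        by (rule Schwarz_Lemma(1)[OF m m0 m1]) (use w in auto)
      then show ?thesis using False nc m0 by (simp add: q_def norm_mult norm_divide)
    qed
    show "Re (q 0) > 1 - \<eta>" using n cd by (simp add: q_def d_def)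
  qed
qed

section \<open>Reciprocals as limits of exponentials\<close>

text \<open>The constants 3 and 1/4 are matched: \<open>norm ((1 - exp (- u z)) / u z)\<close> is at
  most \<open>2 / norm (u z) + 1/4\<close>, hence at most \<open>2/3 + 1/4 = 11/12\<close>, which is
  less than 1.\<close>

locale exp_generator = hardy_algebra +
  fixes u :: "complex \<Rightarrow> complex"
  assumes holu: "u holomorphic_on G"
    and u3: "z \<in> G \<Longrightarrow> 3 \<le> norm (u z)"
    and expu: "z \<in> G \<Longrightarrow> norm (exp (- u z)) \<le> 1 + norm (u z) / 4"
    and expE: "s \<ge> 0 \<Longrightarrow> (\<lambda>z. exp (- (complex_of_real s * u z))) \<in> E"
begin

definition W :: "complex \<Rightarrow> real" where "W z = norm (exp (- u z))"

lemma W0: "W z \<ge> 0" by (simp add: W_def)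

lemma u_nz: "z \<in> G \<Longrightarrow> u z \<noteq> 0" using u3 by force

text \<open>As \<open>s\<close> runs from 0 to 1 the modulus moves monotonically from 1 to
  \<open>W z\<close>. The bound serves as a common majorant for all exponentials in the integrals
  below.\<close>

lemma norm_exp_le_W:
  assumes "0 \<le> s" "s \<le> 1"
  shows "norm (exp (- (complex_of_real s * u z))) \<le> 1 + W z"
proof (cases "Re (u z) \<ge> 0")
  case True
  then have "norm (exp (- (complex_of_real s * u z))) \<le> 1" using assms by simp
  then show ?thesis using W0[of z] by linarith
next
  case False
  then have "- (s * Re (u z)) \<le> - Re (u z)" using assms mult_right_mono[of s 1 "- Re (u z)"] by simp
  then have "norm (exp (- (complex_of_real s * u z))) \<le> W z" by (simp add: W_def)
  then show ?thesis by linarith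
qed

text \<open>The harmonic function \<open>ln |u|\<close> tends to infinity where \<open>u\<close> does, so its small multiples
  absorb the contribution of the region \<open>|u| > Y\<close>.\<close>
lemma hsmall_dominated:
  assumes p: "p \<ge> 1" and e: "e > 0"
  obtains Y d where "Y > 0" "d > 0"
    "\<And>f. (\<And>z. z \<in> G \<Longrightarrow> norm (f z) \<le> 2 * (1 + W z)) \<Longrightarrow>
      (\<And>z. z \<in> G \<Longrightarrow> norm (u z) \<le> Y \<Longrightarrow> norm (f z) \<le> d) \<Longrightarrow> hsmall G z0 p f e"
proof -
  have "hfin G z0 (\<lambda>z. exp (- (complex_of_real 1 * u z)))" by (rule fin[OF expE]) simp
  then have "hfin G z0 (\<lambda>z. exp (- u z))" by simp
  moreover have "2 * p \<ge> 1" using p by simp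
  ultimately obtain M1 where "hsmall G z0 (2 * p) (\<lambda>z. exp (- u z)) M1"
    unfolding hfin_def by blast
  then have M1: "hsmall G z0 (2 * p) (\<lambda>z. of_real (W z)) M1"
    by (rule hsmall_mono) (use p in \<open>auto simp: W_def\<close>)
  have M2: "hsmall G z0 (2 * p) (\<lambda>z. 1) 2" by (rule hsmall_const[OF opG, of _ 1]) (use p in auto)
  obtain M where M: "hsmall G z0 (2 * p) (\<lambda>z. of_real (1 + W z)) M"
    using hsmall_add[OF M2 M1] p by auto
  then obtain v where v: "harmonic_on v G" "\<And>z. z \<in> G \<Longrightarrow> norm (complex_of_real (1 + W z)) powr (2 * p) \<le> v z" "v z0 < M"
    using hsmallE by blast
  have vW: "(1 + W z) powr (2 * p) \<le> v z" if "z \<in> G" for z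
    using v(2)[OF that] W0[of z] by (simp add: abs_of_nonneg del: of_real_add)
  define C where "C = 2 powr (2 * p) * M"
  have C: "C > 0" using hsmall_pos[OF M] by (simp add: C_def)
  \<comment> \<open>Makes \<open>t * C\<close>, which bounds the term with \<open>v\<close> at
    \<open>z0\<close>, equal to \<open>e / 4\<close>.\<close>
  define t where "t = e / (4 * C)"
  have t: "t > 0" using e C by (simp add: t_def)
  define l where "l = ln (norm (u z0))"
  have l: "l \<ge> 0" using u3[OF z0] by (simp add: l_def)
  \<comment> \<open>Makes \<open>l / (t * y)\<close>, the logarithmic term at \<open>z0\<close>, at
    most \<open>e / 4\<close>.\<close>
  define y where "y = 4 * l / (t * e) + 1"
  have y: "y > 0" using l t e by (simp add: y_def add_nonneg_pos)
  define Y where "Y = exp y"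
  define d where "d = (e/4) powr (1/p)"
  have d: "d > 0" "d powr p = e / 4" using e p by (simp_all add: d_def powr_powr)
  show thesis
  proof (rule that[of Y d])
    show "Y > 0" "d > 0" using d by (simp_all add: Y_def)
    fix f :: "complex \<Rightarrow> complex" assume f1: "\<And>z. z \<in> G \<Longrightarrow> norm (f z) \<le> 2 * (1 + W z)"
      and f2: "\<And>z. z \<in> G \<Longrightarrow> norm (u z) \<le> Y \<Longrightarrow> norm (f z) \<le> d"
    \<comment> \<open>Where \<open>norm (u z) \<le> Y\<close> the constant
      \<open>e / 4 = d powr p\<close> suffices. Elsewhere the \<open>p\<close>-th power
      \<open>a\<close> of the dominating function is at most \<open>t * a^2 + 1 / t\<close>, and the
      logarithm, which is at least \<open>y\<close> there, absorbs \<open>1 / t\<close>.\<close>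
    define H where "H z = e / 4 + ((t * 2 powr (2 * p)) * v z + (1 / (t * y)) * ln (norm (u z)))" for z
    show "hsmall G z0 p f e"
    proof (rule hsmallI)
      show "harmonic_on H G" unfolding H_def
        by (intro harmonic_on_add harmonic_on_cmult harmonic_on_const harmonic_on_ln_norm v opG holu u_nz)
      fix z assume z: "z \<in> G"
      have v0: "v z \<ge> 0" using vW[OF z] powr_ge_zero order_trans by blast
      have ln0: "ln (norm (u z)) \<ge> 0" using u3[OF z] by simp
      show "norm (f z) powr p \<le> H z"
      proof (cases "norm (u z) \<le> Y")
        case True
        then have "norm (f z) powr p \<le> d powr p" using f2[OF z] p by (intro powr_mono2) auto
        moreover have "0 \<le> (t * 2 powr (2 * p)) * v z + (1 / (t * y)) * ln (norm (u z))"
          using v0 ln0 t y by (intro add_nonneg_nonneg mult_nonneg_nonneg) auto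
        ultimately show ?thesis using d by (simp add: H_def)
      next
        case False
        define a where "a = (2 * (1 + W z)) powr p"
        have "norm (f z) powr p \<le> a" unfolding a_def using f1[OF z] p by (intro powr_mono2) auto
        also have "a \<le> t * a\<^sup>2 + 1 / t"
        proof -
          have "0 \<le> (t * a - 1)\<^sup>2" by simp
          then have "2 * (t * a) \<le> t\<^sup>2 * a\<^sup>2 + 1" by (simp add: power2_eq_square algebra_simps)
          moreover have "t * a \<ge> 0" using t by (simp add: a_def)
          ultimately have "t * a \<le> t\<^sup>2 * a\<^sup>2 + 1" by linarith
          then show ?thesis using t by (simp add: field_simps power2_eq_square)
        qed
        also have "a\<^sup>2 = 2 powr (2 * p) * (1 + W z) powr (2 * p)"
        proof -
          have "a\<^sup>2 = (2 * (1 + W z)) powr (2 * p)" by (simp add: a_def power2_eq_square powr_add[symmetric])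
          also have "\<dots> = 2 powr (2 * p) * (1 + W z) powr (2 * p)" using W0[of z] by (subst powr_mult) auto
          finally show ?thesis .
        qed
        also have "t * (2 powr (2 * p) * (1 + W z) powr (2 * p)) \<le> t * 2 powr (2 * p) * v z"
          using vW[OF z] t by (simp add: mult.assoc)
        also have "1 / t \<le> (1 / (t * y)) * ln (norm (u z))"
        proof -
          have "y \<le> ln (norm (u z))"
            using False u3[OF z] unfolding Y_def by (subst ln_ge_iff) auto
          then have "1 \<le> ln (norm (u z)) / y" using y by simp
          then have "1 / t * 1 \<le> 1 / t * (ln (norm (u z)) / y)" using t by (intro mult_left_mono) auto
          then show ?thesis by simp
        qed
        finally show ?thesis using e by (simp add: H_def)
      qed
    next
      have "t * 2 powr (2 * p) * v z0 < t * C"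
        unfolding C_def using v(3) t by (simp add: mult.assoc)
      also have "t * C = e / 4" using C by (simp add: t_def)
      finally have 1: "t * 2 powr (2 * p) * v z0 < e / 4" .
      have "l / t \<le> (e / 4) * y" using t e by (simp add: y_def field_simps)
      then have "(1 / (t * y)) * l \<le> e / 4" using t y by (simp add: field_simps)
      then show "H z0 < e" using 1 e unfolding H_def l_def[symmetric] by linarith
    qed
  qed
qed

text \<open>\<open>T s\<close> is the integral of \<open>exp (- t u)\<close> over \<open>0 \<le> t \<le> s\<close>, and \<open>Rs s m\<close> a Riemann sum of it.\<close>
definition T :: "real \<Rightarrow> complex \<Rightarrow> complex" where
  "T s z = (1 - exp (- (of_real s * u z))) / u z"

definition Rs :: "real \<Rightarrow> nat \<Rightarrow> complex \<Rightarrow> complex" where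
  "Rs s m z = of_real (s / real m) * (\<Sum>j<m. exp (- (of_real (s * real j / real m) * u z)))"

lemma Rs_in: "s \<ge> 0 \<Longrightarrow> Rs s m \<in> hclos G z0 E"
  unfolding Rs_def[abs_def] by (intro hclos_cmult hclos_sum hclos_base expE) auto

lemma T_minus_Rs_dominated:
  assumes s: "0 \<le> s" "s \<le> 1" and m: "m > 0" and z: "z \<in> G"
  shows "norm (T s z - Rs s m z) \<le> 2 * (1 + W z)"
proof -
  have "norm (1 - exp (- (of_real s * u z))) \<le> 1 + (1 + W z)"
    using norm_triangle_ineq4[of 1 "exp (- (of_real s * u z))"] norm_exp_le_W[OF s] by (smt (verit) norm_one)
  moreover have "1 + (1 + W z) \<le> (1 + W z) * norm (u z)"
  proof -
    have "(1 + W z) * 3 \<le> (1 + W z) * norm (u z)" using u3[OF z] W0[of z] by (intro mult_left_mono) auto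
    then show ?thesis using W0[of z] by simp
  qed
  ultimately have 1: "norm (T s z) \<le> 1 + W z"
    using u_nz[OF z] by (simp add: T_def norm_divide divide_le_eq)
  have "norm (\<Sum>j<m. exp (- (of_real (s * real j / real m) * u z))) \<le> (\<Sum>j<m. 1 + W z)"
  proof (intro sum_norm_le norm_exp_le_W)
    fix j assume "j \<in> {..<m}"
    then have "s * (real j / real m) \<le> 1 * 1" using s m by (intro mult_mono) auto
    then show "s * real j / real m \<le> 1" by simp
  qed (use s in auto)
  then have "norm (Rs s m z) \<le> s / real m * (real m * (1 + W z))"
    unfolding Rs_def norm_mult norm_of_real using s m by (intro mult_mono) auto
  also have "\<dots> = s * (1 + W z)" using m by simp
  also have "\<dots> \<le> 1 * (1 + W z)" using s W0[of z] by (intro mult_right_mono) auto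
  finally show ?thesis using norm_triangle_ineq4[of "T s z" "Rs s m z"] 1 by simp
qed

text \<open>With \<open>h = s / m\<close> and \<open>x = exp (- (h * u z))\<close>, both functions
  are multiples of one geometric sum, so their difference is that sum times
  \<open>(1 - x) / u z - h\<close>. Taylor's formula bounds this factor by
  \<open>3 * h^2 * norm (u z)\<close>; the condition \<open>Y \<le> real m\<close> keeps the modulus
  of \<open>h * u z\<close> at most 1.\<close>

lemma T_minus_Rs_small:
  assumes s: "0 \<le> s" "s \<le> 1" and m: "m > 0" and z: "z \<in> G" and Y: "norm (u z) \<le> Y" "Y \<le> real m"
  shows "norm (T s z - Rs s m z) \<le> 3 * (2 + Y / 4) * Y / m"
proof -
  define h where "h = s / real m"
  have h: "0 \<le> h" "h \<le> 1 / m" using s m by (auto simp: h_def divide_right_mono)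
  define x where "x = exp (- (of_real h * u z))"
  have xj: "x ^ j = exp (- (of_real (s * real j / real m) * u z))" for j
    unfolding x_def h_def exp_of_nat_mult[symmetric] by (simp add: mult_ac)
  have "x ^ m = exp (- (of_real s * u z))" using xj[of m] m by simp
  then have "T s z = (1 - x) / u z * (\<Sum>j<m. x ^ j)"
    unfolding T_def using one_diff_power_eq[of x m] by simp
  moreover have "Rs s m z = of_real h * (\<Sum>j<m. x ^ j)" unfolding Rs_def xj h_def ..
  ultimately have eq: "T s z - Rs s m z = ((1 - x) / u z - of_real h) * (\<Sum>j<m. x ^ j)"
    by (simp add: algebra_simps)
  have W: "1 + W z \<le> 2 + Y / 4" using expu[OF z] Y(1) by (simp add: W_def)
  have "norm (\<Sum>j<m. x ^ j) \<le> (\<Sum>j<m. 1 + W z)"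
    unfolding xj
  proof (intro sum_norm_le norm_exp_le_W)
    fix j assume "j \<in> {..<m}"
    then have "s * (real j / real m) \<le> 1 * 1" using s m by (intro mult_mono) auto
    then show "s * real j / real m \<le> 1" by simp
  qed (use s in auto)
  then have S: "norm (\<Sum>j<m. x ^ j) \<le> real m * (2 + Y / 4)"
    using W mult_left_mono[OF W, of "real m"] by simp
  define w where "w = - (of_real h * u z)"
  have "norm w = h * norm (u z)" using h by (simp add: w_def norm_mult)
  also have "\<dots> \<le> 1 / m * Y" using h Y by (intro mult_mono) auto
  also have "\<dots> \<le> 1" using Y m by simp
  finally have w1: "norm w \<le> 1" .
  have "norm (exp w - (\<Sum>i\<le>1. w ^ i / fact i)) \<le> exp \<bar>Re w\<bar> * (norm w ^ Suc 1) / fact 1"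
    by (rule Taylor_exp)
  also have "(\<Sum>i\<le>1. w ^ i / fact i) = 1 + w" by simp
  also have "exp \<bar>Re w\<bar> * (norm w ^ Suc 1) / fact 1 \<le> 3 * (norm w)\<^sup>2"
  proof -
    have "exp \<bar>Re w\<bar> \<le> exp 1" using w1 abs_Re_le_cmod[of w] by simp
    also have "\<dots> \<le> 3" by (rule exp_le)
    finally show ?thesis by (simp add: mult_right_mono power2_eq_square)
  qed
  finally have ew: "norm (exp w - (1 + w)) \<le> 3 * (norm w)\<^sup>2" .
  have "(1 - x) / u z - of_real h = - (exp w - (1 + w)) / u z"
    using u_nz[OF z] by (simp add: x_def w_def field_simps)
  then have "norm ((1 - x) / u z - of_real h) = norm (exp w - (1 + w)) / norm (u z)"
    by (simp only: norm_divide norm_minus_cancel)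
  also have "\<dots> \<le> 3 * (norm w)\<^sup>2 / norm (u z)" using ew by (rule divide_right_mono) simp
  also have "\<dots> = 3 * h\<^sup>2 * norm (u z)"
    using u_nz[OF z] h by (simp add: w_def norm_mult power2_eq_square)
  also have "\<dots> \<le> 3 * (1 / m)\<^sup>2 * Y" using h Y by (intro mult_mono power_mono) auto
  finally have D: "norm ((1 - x) / u z - of_real h) \<le> 3 * (1 / m)\<^sup>2 * Y" .
  have "norm (T s z - Rs s m z) \<le> 3 * (1 / m)\<^sup>2 * Y * (real m * (2 + Y / 4))"
    unfolding eq norm_mult
    using D S Y order_trans[OF norm_ge_zero Y(1)] by (intro mult_mono) auto
  also have "\<dots> = 3 * (2 + Y / 4) * Y / m" using m by (simp add: power2_eq_square field_simps)
  finally show ?thesis .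
qed

lemma T_Rs_hsmall:
  assumes p: "p \<ge> 1" and e: "e > 0"
  obtains m :: nat where "m > 0" "\<And>s. 0 \<le> s \<Longrightarrow> s \<le> 1 \<Longrightarrow> hsmall G z0 p (\<lambda>z. T s z - Rs s m z) e"
proof -
  obtain Y d where Y: "Y > 0" "d > 0"
    "\<And>f. (\<And>z. z \<in> G \<Longrightarrow> norm (f z) \<le> 2 * (1 + W z)) \<Longrightarrow>
      (\<And>z. z \<in> G \<Longrightarrow> norm (u z) \<le> Y \<Longrightarrow> norm (f z) \<le> d) \<Longrightarrow> hsmall G z0 p f e"
    using hsmall_dominated[OF p e] by blast
  obtain m :: nat where m: "real m > max Y (3 * (2 + Y / 4) * Y / d)" using reals_Archimedean2 by blast
  have m0: "m > 0" using m Y(1) by (cases m) auto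
  have "3 * (2 + Y / 4) * Y / d < real m" using m by simp
  then have "3 * (2 + Y / 4) * Y < real m * d" using Y(2) by (simp only: pos_divide_less_eq)
  then have md: "3 * (2 + Y / 4) * Y / m \<le> d" using m0 by (simp add: divide_le_eq mult.commute)
  show thesis
  proof (rule that[OF m0])
    fix s :: real assume s: "0 \<le> s" "s \<le> 1"
    show "hsmall G z0 p (\<lambda>z. T s z - Rs s m z) e"
    proof (rule Y(3))
      show "norm (T s z - Rs s m z) \<le> d" if "z \<in> G" "norm (u z) \<le> Y" for z
        using T_minus_Rs_small[OF s m0 that] m md by simp
    qed (rule T_minus_Rs_dominated[OF s m0])
  qed
qed

lemma T_in:
  assumes s: "0 \<le> s" "s \<le> 1"
  shows "T s \<in> hclos G z0 E"
proof (rule hclos_closed)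
  fix p e :: real assume p: "p \<ge> 1" and e: "e > 0"
  obtain m :: nat where "m > 0" "\<And>s. 0 \<le> s \<Longrightarrow> s \<le> 1 \<Longrightarrow> hsmall G z0 p (\<lambda>z. T s z - Rs s m z) e"
    using T_Rs_hsmall[OF p e] by blast
  then have "hsmall G z0 p (\<lambda>z. T s z - Rs s m z) e" using s by simp
  then show "\<exists>g\<in>hclos G z0 E. hsmall G z0 p (\<lambda>z. T s z - g z) e"
    by (rule bexI[of _ "Rs s m"]) (rule Rs_in[OF s(1)])
qed

text \<open>The function is the integral of \<open>T s\<close> over
  \<open>0 \<le> s \<le> 1\<close>. Its Riemann sum with \<open>m\<close> terms is exactly
  \<open>(1 - Rs 1 m z) / u z\<close>, so the error is \<open>T 1 z - Rs 1 m z\<close> divided by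
  \<open>u z\<close> up to sign, and the earlier estimate applies.\<close>

lemma inverse_times_one_minus_T_in: "(\<lambda>z. 1 / u z * (1 - T 1 z)) \<in> hclos G z0 E"
proof (rule hclos_closed)
  fix p e :: real assume p: "p \<ge> 1" and e: "e > 0"
  obtain m :: nat where m: "m > 0" "\<And>s. 0 \<le> s \<Longrightarrow> s \<le> 1 \<Longrightarrow> hsmall G z0 p (\<lambda>z. T s z - Rs s m z) e"
    using T_Rs_hsmall[OF p e] by blast
  have "(\<lambda>z. of_real (1 / real m) * (\<Sum>j<m. T (real j / real m) z)) \<in> hclos G z0 E"
    by (intro hclos_cmult hclos_sum T_in) auto
  then have "(\<lambda>z. 1 / u z * (1 - Rs 1 m z)) \<in> hclos G z0 E"
  proof (rule hclos_cong)
    fix z assume z: "z \<in> G"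
    have "1 - Rs 1 m z = of_real (1 / real m) * (\<Sum>j<m. 1 - exp (- (of_real (real j / real m) * u z)))"
      using m(1) by (simp add: Rs_def sum_subtractf algebra_simps)
    then show "of_real (1 / real m) * (\<Sum>j<m. T (real j / real m) z) = 1 / u z * (1 - Rs 1 m z)"
      unfolding T_def sum_divide_distrib[symmetric] by simp
  qed
  moreover have "hsmall G z0 p (\<lambda>z. 1 / u z * (1 - T 1 z) - 1 / u z * (1 - Rs 1 m z)) e"
  proof (rule hsmall_mono[OF m(2)[of 1]])
    fix z assume z: "z \<in> G"
    have "1 / u z * (1 - T 1 z) - 1 / u z * (1 - Rs 1 m z) = - (T 1 z - Rs 1 m z) / u z"
      using u_nz[OF z] by (simp add: field_simps)
    then have "norm (1 / u z * (1 - T 1 z) - 1 / u z * (1 - Rs 1 m z)) = norm (T 1 z - Rs 1 m z) / norm (u z)"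
      by (simp only: norm_divide norm_minus_cancel)
    also have "\<dots> \<le> norm (T 1 z - Rs 1 m z) / 1"
      using u3[OF z] by (intro divide_left_mono) auto
    finally show "norm (1 / u z * (1 - T 1 z) - 1 / u z * (1 - Rs 1 m z)) \<le> norm (T 1 z - Rs 1 m z)" by simp
  qed (use p in auto)
  ultimately show "\<exists>g\<in>hclos G z0 E. hsmall G z0 p (\<lambda>z. 1 / u z * (1 - T 1 z) - g z) e"
    by (intro bexI[of _ "\<lambda>z. 1 / u z * (1 - Rs 1 m z)"])
qed

text \<open>Multiplying by the geometric sum turns \<open>1 - T 1 z\<close> into
  \<open>1 - T 1 z ^ N\<close>. As \<open>T 1\<close> has modulus at most 11/12, the limit is
  uniform on \<open>G\<close>.\<close>

lemma inverse_in: "(\<lambda>z. 1 / u z) \<in> hclos G z0 E"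
proof (rule hclos_uniform)
  fix e :: real assume e: "e > 0"
  obtain N where N: "(11/12) ^ N < e" using real_arch_pow_inv[OF e, of "11/12"] by auto
  have T1: "norm (T 1 z) \<le> 11/12" if z: "z \<in> G" for z
  proof -
    have "norm (1 - exp (- u z)) \<le> 1 + (1 + norm (u z) / 4)"
      using norm_triangle_ineq4[of 1 "exp (- u z)"] expu[OF z] by simp
    also have "\<dots> \<le> 11/12 * norm (u z)" using u3[OF z] by simp
    finally show ?thesis using u_nz[OF z] by (simp add: T_def norm_divide divide_le_eq)
  qed
  have "(\<lambda>z. (1 / u z * (1 - T 1 z)) * (\<Sum>j<N. T 1 z ^ j)) \<in> hclos G z0 E"
    by (intro hclos_mult inverse_times_one_minus_T_in hclos_sum hclos_power T_in) auto
  then have "(\<lambda>z. 1 / u z * (1 - T 1 z ^ N)) \<in> hclos G z0 E"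
    by (rule hclos_cong) (simp add: one_diff_power_eq)
  moreover have "norm (1 / u z - 1 / u z * (1 - T 1 z ^ N)) \<le> e" if z: "z \<in> G" for z
  proof -
    have "1 / u z - 1 / u z * (1 - T 1 z ^ N) = T 1 z ^ N / u z" by (simp add: algebra_simps diff_divide_distrib)
    then have "norm (1 / u z - 1 / u z * (1 - T 1 z ^ N)) = norm (T 1 z) ^ N / norm (u z)"
      by (simp add: norm_divide norm_power)
    also have "\<dots> \<le> (11/12) ^ N / 1" using T1[OF z] u3[OF z] by (intro frac_le power_mono) auto
    finally show ?thesis using N by simp
  qed
  ultimately show "\<exists>g\<in>hclos G z0 E. \<forall>z\<in>G. norm (1 / u z - g z) \<le> e"
    by (intro bexI[of _ "\<lambda>z. 1 / u z * (1 - T 1 z ^ N)"]) auto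
qed

end

section \<open>Density of exponentials\<close>

lemma exp_span_add_exp:
  assumes "f \<in> exp_span S" "l \<in> S"
  shows "(\<lambda>z. f z + c * exp (l * z)) \<in> exp_span S"
proof -
  obtain n :: nat and c' l' where f: "\<forall>k<n. l' k \<in> S" "f = (\<lambda>z. \<Sum>k<n. c' k * exp (l' k * z))"
    using assms(1) unfolding exp_span_def by blast
  have "(\<lambda>z. f z + c * exp (l * z)) = (\<lambda>z. \<Sum>k<Suc n. (c'(n := c)) k * exp ((l'(n := l)) k * z))"
    unfolding f(2) by (auto intro!: ext sum.cong)
  moreover have "\<forall>k<Suc n. (l'(n := l)) k \<in> S" using f(1) assms(2) by (auto simp: less_Suc_eq)
  ultimately show ?thesis unfolding exp_span_def by blast
qed

lemma exp_span_0: "(\<lambda>_. 0) \<in> exp_span S"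
  unfolding exp_span_def by (auto intro!: exI[of _ 0])

lemma exp_span_single: "l \<in> S \<Longrightarrow> (\<lambda>z. c * exp (l * z)) \<in> exp_span S"
  using exp_span_add_exp[OF exp_span_0] by simp

text \<open>Lets closure properties of the span be proved by adding one exponential at a time,
  without concatenating index ranges.\<close>

lemma exp_span_induct [consumes 1, case_names zero step]:
  assumes "f \<in> exp_span S" and 0: "P (\<lambda>_. 0)"
    and step: "\<And>f c l. f \<in> exp_span S \<Longrightarrow> P f \<Longrightarrow> l \<in> S \<Longrightarrow> P (\<lambda>z. f z + c * exp (l * z))"
  shows "P f"
proof -
  obtain n :: nat and c l where f: "\<forall>k<n. l k \<in> S" "f = (\<lambda>z. \<Sum>k<n. c k * exp (l k * z))"
    using assms(1) unfolding exp_span_def by blast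
  have "k \<le> n \<Longrightarrow> (\<lambda>z. \<Sum>i<k. c i * exp (l i * z)) \<in> exp_span S \<and> P (\<lambda>z. \<Sum>i<k. c i * exp (l i * z))" for k
  proof (induction k)
    case 0
    then show ?case using assms(2) exp_span_0 by simp
  next
    case (Suc k)
    then have "l k \<in> S" using f(1) by simp
    with Suc show ?case
      using step[of "\<lambda>z. \<Sum>i<k. c i * exp (l i * z)" "l k" "c k"]
        exp_span_add_exp[of "\<lambda>z. \<Sum>i<k. c i * exp (l i * z)" S "l k" "c k"] by simp
  qed
  from this[of n] show ?thesis using f(2) by simp
qed

lemma exp_span_add:
  assumes "g \<in> exp_span S" "f \<in> exp_span S"
  shows "(\<lambda>z. f z + g z) \<in> exp_span S"
  using assms(1)
proof (induction rule: exp_span_induct)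
  case zero then show ?case using assms(2) by simp
next
  case (step g c l)
  then show ?case using exp_span_add_exp[of "\<lambda>z. f z + g z" S l c] by (simp add: add.assoc)
qed

lemma exp_span_mult:
  assumes "g \<in> exp_span S" "f \<in> exp_span S" and S: "\<And>a b. a \<in> S \<Longrightarrow> b \<in> S \<Longrightarrow> a + b \<in> S"
  shows "(\<lambda>z. f z * g z) \<in> exp_span S"
  using assms(1)
proof (induction rule: exp_span_induct)
  case zero then show ?case using exp_span_0 by simp
next
  case (step g c l)
  have "(\<lambda>z. f z * (c * exp (l * z))) \<in> exp_span S"
    using assms(2)
  proof (induction rule: exp_span_induct)
    case zero then show ?case using exp_span_0 by simp
  next
    case (step f c' l')
    have "(\<lambda>z. (f z + c' * exp (l' * z)) * (c * exp (l * z)))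
       = (\<lambda>z. f z * (c * exp (l * z)) + (c' * c) * exp ((l' + l) * z))"
      by (intro ext) (simp add: algebra_simps exp_add)
    then show ?case
      using exp_span_add_exp[OF step.IH S[OF step.hyps(2) \<open>l \<in> S\<close>], of "c' * c"] by simp
  qed
  from exp_span_add[OF this step.IH] show ?case by (simp add: algebra_simps)
qed

lemma exp_span_mono: "S \<subseteq> S' \<Longrightarrow> exp_span S \<subseteq> exp_span S'"
  unfolding exp_span_def by blast

lemma hardy_subset:
  assumes "f \<in> hardy p D" "open G" "G \<subseteq> D"
  shows "f \<in> hardy p G"
  using assms harmonic_on_subset unfolding hardy_def harmonic_majorant_def
  by (auto elim: holomorphic_on_subset) blast

lemma hfin_exp_span:
  assumes "open G" and S: "\<And>p l. p \<ge> 1 \<Longrightarrow> l \<in> S \<Longrightarrow> l \<in> Lambda_p p G" and "f \<in> exp_span S"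
  shows "hfin G z0 f"
  using assms(3)
proof (induction rule: exp_span_induct)
  case zero
  show ?case unfolding hfin_def
    by (auto intro!: exI[of _ 1] hsmallI[OF harmonic_on_const[OF assms(1), of 0]])
next
  case (step f c l)
  have "hfin G z0 (\<lambda>z. exp (l * z))" unfolding hfin_def
  proof (intro allI impI)
    fix p :: real assume "p \<ge> 1"
    then have "(\<lambda>z. exp (l * z)) \<in> hardy p G" using S step.hyps by (auto simp: Lambda_p_def)
    then obtain u where "harmonic_majorant u (\<lambda>z. norm (exp (l * z)) powr p) G" by (auto simp: hardy_def)
    then show "\<exists>M. hsmall G z0 p (\<lambda>z. exp (l * z)) M"
      unfolding hsmall_def by (auto intro!: exI[of _ "u z0 + 1"] exI[of _ u])
  qed
  then show ?case by (intro hfin_add hfin_cmult step.IH)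
qed

section \<open>Logarithmic starlike domains and their frequencies\<close>

text \<open>A point of \<open>D0\<close> with imaginary part of modulus at most \<open>R'\<close>
  has real part at least \<open>x + 3\<close>. For the others the logarithmic bound with
  \<open>a < 1\<close> gives \<open>exp (- Re z) \<le> \<bar>Im z\<bar>\<close>, and the
  translation, by at least 3, gains the factor \<open>exp (-3) \<le> 1/4\<close>. The first claim
  covers all \<open>x \<le> c\<close>, since after inversion a whole segment ending at 0 has to be
  avoided.\<close>

lemma log_starlike_separation:
  assumes "log_starlike_at_infinity D0"
  obtains c :: real where "\<And>x z. x \<le> c \<Longrightarrow> z \<in> D0 \<Longrightarrow> 3 \<le> norm (z - of_real x)"
    "\<And>x z. x \<le> c \<Longrightarrow> z \<in> D0 \<Longrightarrow> norm (exp (- (z - of_real x))) \<le> 1 + norm (z - of_real x) / 4"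
proof -
  obtain \<psi> R a where \<psi>: "\<psi> differentiable_on UNIV" "0 < a" "a < 1"
    "\<And>y. \<bar>y\<bar> \<ge> R \<Longrightarrow> \<psi> y \<ge> - a * ln \<bar>y\<bar>" and D0: "D0 = {z. Re z > \<psi> (Im z)}"
    using assms unfolding log_starlike_at_infinity_def by blast
  define R' where "R' = max R 3"
  have cont: "continuous_on {-R'..R'} \<psi>"
    using \<psi>(1) differentiable_imp_continuous_on continuous_on_subset by blast
  have "R' \<ge> 0" by (simp add: R'_def)
  then have "{-R'..R'} \<noteq> {}" by simp
  from continuous_attains_inf[OF compact_Icc this cont]
  obtain y0 where "\<forall>y\<in>{-R'..R'}. \<psi> y0 \<le> \<psi> y" by blast
  then have y0: "\<psi> y0 \<le> \<psi> y" if "\<bar>y\<bar> \<le> R'" for y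
    using that by (simp add: abs_le_iff)
  define c where "c = - \<bar>\<psi> y0\<bar> - 3"
  have *: "(3 \<le> Re (z - of_real x)) \<or>
     (3 \<le> \<bar>Im (z - of_real x)\<bar> \<and> norm (exp (- (z - of_real x))) \<le> \<bar>Im (z - of_real x)\<bar> / 4)"
    if x: "x \<le> c" and z: "z \<in> D0" for x z
  proof (cases "\<bar>Im z\<bar> \<le> R'")
    case True
    then have "Re z > \<psi> y0" using y0[of "Im z"] z by (auto simp: D0)
    then have "3 \<le> Re z - x" using x unfolding c_def by linarith
    then show ?thesis by simp
  next
    case False
    define y where "y = \<bar>Im z\<bar>"
    have y: "y \<ge> 3" "y \<ge> R" using False by (auto simp: R'_def y_def)
    have ln0: "ln y \<ge> 0" using y by simp
    have "Re z > - a * ln y" using \<psi>(4)[of "Im z"] z y(2) by (auto simp: D0 y_def)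
    moreover have "a * ln y \<le> 1 * ln y" using \<psi>(3) ln0 by (intro mult_right_mono) auto
    ultimately have "- Re z \<le> ln y" by simp
    moreover have "x \<le> -3" using x by (simp add: c_def)
    ultimately have "exp (- Re z + x) \<le> exp (ln y + (-3))" by simp
    also have "\<dots> = y / exp 3" using y by (simp add: exp_diff)
    also have "\<dots> \<le> y / 4" using exp_ge_add_one_self[of "3::real"] y by (intro divide_left_mono) auto
    finally show ?thesis using y by (simp add: y_def)
  qed
  show thesis
  proof (rule that[of c])
    fix x z assume x: "x \<le> c" and z: "z \<in> D0"
    show "3 \<le> norm (z - of_real x)"
      using *[OF x z] complex_Re_le_cmod[of "z - of_real x"] abs_Im_le_cmod[of "z - of_real x"] by linarith
    show "norm (exp (- (z - of_real x))) \<le> 1 + norm (z - of_real x) / 4"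
      using *[OF x z]
    proof
      assume "3 \<le> Re (z - of_real x)"
      then have "norm (exp (- (z - of_real x))) \<le> 1" by simp
      then show ?thesis using norm_ge_zero[of "z - of_real x"] by linarith
    next
      assume "3 \<le> \<bar>Im (z - of_real x)\<bar> \<and> norm (exp (- (z - of_real x))) \<le> \<bar>Im (z - of_real x)\<bar> / 4"
      then show ?thesis using abs_Im_le_cmod[of "z - of_real x"] by linarith
    qed
  qed
qed

text \<open>One exponent \<open>p0\<close> yields every \<open>p\<close> because the given
  frequencies form a ray: the \<open>p\<close>-th power of the modulus of an exponential is the
  \<open>p0\<close>-th power for the frequency scaled by \<open>p / p0\<close>.\<close>

lemma p_frequencies_rotated:
  assumes freq: "has_p_frequencies D0" and p: "p \<ge> 1" and s: "s \<ge> 0" and e: "norm e = 1"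
  shows "- (of_real s * cnj e) \<in> Lambda_p p ((\<lambda>z. e * z) ` D0)"
proof -
  obtain p0 where p0: "p0 \<ge> 1" "\<And>l::real. l \<le> 0 \<Longrightarrow> (\<lambda>z. exp (of_real l * z)) \<in> hardy p0 D0"
    using freq unfolding has_p_frequencies_def by blast
  have ee: "cnj e * e = 1" using e by (simp add: complex_norm_square[symmetric] mult.commute)
  have "- (s * p / p0) \<le> 0" using s p p0 by simp
  then obtain u where u: "harmonic_on u D0"
    "\<And>z. z \<in> D0 \<Longrightarrow> norm (exp (of_real (- (s * p / p0)) * z)) powr p0 \<le> u z"
    using p0(2) unfolding hardy_def harmonic_majorant_def by blast
  have op: "open ((\<lambda>z. e * z) ` D0)"
  proof -
    have "(\<lambda>z. e * z) ` D0 = (\<lambda>z. cnj e * z) -` D0"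
    proof (intro set_eqI iffI)
      fix z assume "z \<in> (\<lambda>z. cnj e * z) -` D0"
      moreover have "e * (cnj e * z) = z" using ee by (simp add: mult.assoc[symmetric] mult.commute)
      ultimately show "z \<in> (\<lambda>z. e * z) ` D0" by (metis imageI vimageD)
    qed (use ee in \<open>auto simp: mult.assoc[symmetric]\<close>)
    then show ?thesis using harmonic_on_open[OF u(1)] by (auto intro!: open_vimage continuous_intros)
  qed
  have im: "(\<lambda>z. cnj e * z) ` ((\<lambda>z. e * z) ` D0) \<subseteq> D0" using ee by (auto simp: mult.assoc[symmetric])
  have h: "harmonic_on (\<lambda>z. u (cnj e * z)) ((\<lambda>z. e * z) ` D0)"
    by (rule harmonic_on_compose[OF u(1) op _ im]) (intro holomorphic_intros)
  have maj: "norm (exp (- (of_real s * cnj e) * z)) powr p \<le> u (cnj e * z)" if z: "z \<in> (\<lambda>z. e * z) ` D0" for z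
  proof -
    define w where "w = cnj e * z"
    have w: "w \<in> D0" using z im by (auto simp: w_def)
    have "norm (exp (- (of_real s * cnj e) * z)) = exp (- (s * Re w))" by (simp add: w_def mult.assoc)
    then have "norm (exp (- (of_real s * cnj e) * z)) powr p = exp (- (s * p * Re w))"
      by (simp add: powr_def)
    also have "\<dots> = norm (exp (of_real (- (s * p / p0)) * w)) powr p0"
      using p0(1) by (simp add: powr_def)
    also have "\<dots> \<le> u w" by (rule u(2)[OF w])
    finally show ?thesis by (simp add: w_def)
  qed
  have "(\<lambda>z. exp (- (of_real s * cnj e) * z)) holomorphic_on ((\<lambda>z. e * z) ` D0)"
    by (intro holomorphic_intros)
  then show ?thesis
    using h maj unfolding Lambda_p_def hardy_def harmonic_majorant_def by blast
qed

lemma hardy_normp_less: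
  assumes "z0 \<in> G" "hsmall G z0 p f e"
  shows "hardy_normp p G z0 f < e"
proof -
  obtain u where u: "harmonic_majorant u (\<lambda>z. norm (f z) powr p) G" "u z0 < e"
    using assms(2) unfolding hsmall_def by blast
  have "bdd_below {u z0 | u. harmonic_majorant u (\<lambda>z. norm (f z) powr p) G}"
    using assms(1) unfolding bdd_below_def harmonic_majorant_def
    by (intro exI[of _ 0]) (auto intro: order_trans[OF powr_ge_zero])
  then have "hardy_normp p G z0 f \<le> u z0"
    unfolding hardy_normp_def using u(1) by (intro cInf_lower) auto
  then show ?thesis using u(2) by simp
qed

lemma dense_in_hardy_mono: "dense_in_hardy F p G \<Longrightarrow> F \<subseteq> F' \<Longrightarrow> dense_in_hardy F' p G"
  unfolding dense_in_hardy_def by (meson subsetD)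

section \<open>Density of polynomials in the Riemann map\<close>

context hardy_algebra begin

text \<open>The functions \<open>f (v z)\<close> are uniform limits of polynomials in
  \<open>v\<close>. Their distance to \<open>\<phi> z\<close> is at most
  \<open>norm (1 - q (\<phi> z))\<close>, whose square is at most the harmonic function
  \<open>Re (2 - 2 * q (\<phi> z))\<close>, small at \<open>z0\<close>. Boundedness by 2 then gives
  every exponent.\<close>

lemma riemann_map_in_hclos:
  assumes v: "v \<in> hclos G z0 E" "v ` G \<subseteq> K"
    and \<phi>: "\<phi> holomorphic_on G" "\<And>z. z \<in> G \<Longrightarrow> \<phi> z \<in> ball 0 1" "\<phi> z0 = 0"
    and approx: "\<And>\<eta>. 0 < \<eta> \<Longrightarrow> \<eta> < 1 \<Longrightarrow> \<exists>f q. f \<in> poly_closure K \<and> q holomorphic_on ball 0 (1::real) \<and>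
       (\<forall>z\<in>G. f (v z) = \<phi> z * q (\<phi> z)) \<and> (\<forall>w\<in>ball 0 1. norm (q w) \<le> 1) \<and> Re (q 0) > 1 - \<eta>"
  shows "\<phi> \<in> hclos G z0 E"
proof (rule hclos_closed)
  fix p e :: real assume p: "p \<ge> 1" and e: "e > 0"
  \<comment> \<open>Fits \<open>hsmall_bounded_exponent\<close> with \<open>m = 2\<close>; the
    minimum with 1 ensures \<open>d / 2 < 1\<close>, as \<open>approx\<close> requires.\<close>
  define d where "d = min 1 ((e/2) * (e/2) powr (2/p) / 2 powr p)"
  have d: "d > 0" "d \<le> 1" using e by (auto simp: d_def)
  have dle: "2 powr p * d \<le> (e/2) * (e/2) powr (2/p)"
  proof -
    have "2 powr p * d \<le> 2 powr p * ((e/2) * (e/2) powr (2/p) / 2 powr p)"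
      by (intro mult_left_mono) (auto simp: d_def)
    then show ?thesis by simp
  qed
  have "0 < d / 2" "d / 2 < 1" using d by auto
  then obtain f q where fq: "f \<in> poly_closure K" "q holomorphic_on ball 0 (1::real)"
    "\<And>z. z \<in> G \<Longrightarrow> f (v z) = \<phi> z * q (\<phi> z)" "\<And>w. w \<in> ball 0 1 \<Longrightarrow> norm (q w) \<le> 1" "Re (q 0) > 1 - d / 2"
    using approx[of "d / 2"] by blast
  have "(\<lambda>z. f (v z)) \<in> hclos G z0 E"
  proof (rule hclos_uniform)
    fix e' :: real assume "e' > 0"
    then obtain P where P: "\<forall>z\<in>K. norm (f z - poly P z) < e'" using fq(1) unfolding poly_closure_def by blast
    show "\<exists>g\<in>hclos G z0 E. \<forall>z\<in>G. norm (f (v z) - g z) \<le> e'"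
    proof (rule bexI[of _ "\<lambda>z. poly P (v z)"])
      show "\<forall>z\<in>G. norm (f (v z) - poly P (v z)) \<le> e'" using P v(2) by (auto intro: less_imp_le)
    qed (rule hclos_poly[OF v(1)])
  qed
  moreover have "hsmall G z0 p (\<lambda>z. \<phi> z - f (v z)) e"
  proof (rule hsmall_bounded_exponent[OF opG, where m=2 and d=d])
    show "norm (\<phi> z - f (v z)) \<le> 2" if z: "z \<in> G" for z
    proof -
      have "norm (\<phi> z) \<le> 1" "norm (q (\<phi> z)) \<le> 1" using \<phi>(2)[OF z] fq(4) by auto
      then have "norm (\<phi> z * q (\<phi> z)) \<le> 1 * 1" unfolding norm_mult by (intro mult_mono) auto
      then show ?thesis using norm_triangle_ineq4[of "\<phi> z" "f (v z)"] \<open>norm (\<phi> z) \<le> 1\<close> fq(3)[OF z] by simp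
    qed
    have \<phi>G: "\<phi> ` G \<subseteq> ball 0 1" using \<phi>(2) by blast
    show "hsmall G z0 2 (\<lambda>z. \<phi> z - f (v z)) d"
    proof (rule hsmallI)
      show "harmonic_on (\<lambda>z. Re (2 - 2 * q (\<phi> z))) G"
        using holomorphic_on_compose_gen[OF \<phi>(1) fq(2) \<phi>G]
        by (intro harmonic_on_Re opG holomorphic_intros) (simp add: o_def)
      fix z assume z: "z \<in> G"
      define k where "k = q (\<phi> z)"
      have k: "norm k \<le> 1" using fq(4)[OF \<phi>(2)[OF z]] by (simp add: k_def)
      have "norm (\<phi> z - f (v z)) = norm (\<phi> z) * norm (1 - k)"
        unfolding fq(3)[OF z] k_def[symmetric] norm_mult[symmetric] by (simp add: algebra_simps)
      also have "\<dots> \<le> 1 * norm (1 - k)" using \<phi>(2)[OF z] by (intro mult_right_mono) auto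
      finally have "(norm (\<phi> z - f (v z)))\<^sup>2 \<le> (norm (1 - k))\<^sup>2" by (intro power_mono) auto
      also have "\<dots> = 1 - 2 * Re k + (norm k)\<^sup>2" unfolding cmod_power2 by (simp add: power2_eq_square algebra_simps)
      also have "\<dots> \<le> Re (2 - 2 * k)" using power_mono[OF k, of 2] by simp
      finally show "norm (\<phi> z - f (v z)) powr 2 \<le> Re (2 - 2 * q (\<phi> z))" by (simp add: k_def)
    qed (use \<phi>(3) fq(5) in auto)
  qed (use p e d dle in auto)
  ultimately show "\<exists>g\<in>hclos G z0 E. hsmall G z0 p (\<lambda>z. \<phi> z - g z) e" by (intro bexI)
qed

text \<open>Transport to the disc by \<open>\<kappa>\<close>, approximate there by a polynomial, and
  return by \<open>\<phi>\<close>; polynomials in \<open>\<phi>\<close> belong to the closure of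
  \<open>E\<close>.\<close>

lemma hardy_approx:
  assumes \<phi>: "\<phi> \<in> hclos G z0 E" "\<phi> holomorphic_on G" "\<And>z. z \<in> G \<Longrightarrow> \<phi> z \<in> ball 0 1 \<and> \<kappa> (\<phi> z) = z" "\<phi> z0 = 0"
    and \<kappa>: "\<kappa> holomorphic_on ball 0 (1::real)" "\<kappa> ` ball 0 1 \<subseteq> G"
    and f: "f \<in> hardy p G" and p: "p \<ge> 1" and e: "e > 0"
  obtains g where "g \<in> E" "hsmall G z0 p (\<lambda>z. f z - g z) e"
proof -
  define d where "d = e / (2 * 2 powr p)"
  have d: "d > 0" using e by (simp add: d_def)
  obtain u where u: "f holomorphic_on G" "harmonic_on u G" "\<And>z. z \<in> G \<Longrightarrow> norm (f z) powr p \<le> u z"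
    using f unfolding hardy_def harmonic_majorant_def by blast
  have "(\<lambda>w. f (\<kappa> w)) holomorphic_on ball 0 1"
    using holomorphic_on_compose_gen[OF \<kappa>(1) u(1) \<kappa>(2)] by (simp add: o_def)
  moreover have "harmonic_majorant (\<lambda>w. u (\<kappa> w)) (\<lambda>w. norm (f (\<kappa> w)) powr p) (ball 0 1)"
    unfolding harmonic_majorant_def using harmonic_on_compose[OF u(2) open_ball \<kappa>] u(3) \<kappa>(2) by blast
  ultimately have "(\<lambda>w. f (\<kappa> w)) \<in> hardy p (ball 0 1)" unfolding hardy_def by blast
  then obtain Q where Q: "hsmall (ball 0 1) 0 p (\<lambda>w. f (\<kappa> w) - poly Q w) d"
    using hardy_disc_poly_approx[OF _ p d] by blast
  have "hsmall G z0 p (\<lambda>z. f (\<kappa> (\<phi> z)) - poly Q (\<phi> z)) d"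
    by (rule hsmall_compose[OF Q opG \<phi>(2) _ \<phi>(4)]) (use \<phi>(3) in blast)
  then have 1: "hsmall G z0 p (\<lambda>z. f z - poly Q (\<phi> z)) d"
    by (rule hsmall_mono) (use \<phi>(3) p in auto)
  have "(\<lambda>z. poly Q (\<phi> z)) \<in> hclos G z0 E" by (rule hclos_poly[OF \<phi>(1)])
  then obtain g where g: "g \<in> E" "hsmall G z0 p (\<lambda>z. poly Q (\<phi> z) - g z) d"
    using p d unfolding hclos_def by blast
  have "hsmall G z0 p (\<lambda>z. (f z - poly Q (\<phi> z)) + (poly Q (\<phi> z) - g z)) (2 powr p * (d + d))"
    using hsmall_add[OF 1 g(2)] p by simp
  moreover have "2 powr p * (d + d) = e" by (simp add: d_def)
  ultimately show thesis using that[OF g(1)] by simp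
qed

end

section \<open>Inversion of the Koenigs domain\<close>

text \<open>\<open>K\<close> is the image of the closure of the domain in the Riemann sphere under a
  Moebius map that sends infinity to 0 and the exterior point \<open>cnj e * c\<close> to infinity.
  The translates \<open>z0 + t\<close> run to infinity, so 0 adheres to the connected image of the
  closure and \<open>K\<close> is connected.\<close>

lemma inversion_of_domain:
  fixes \<Omega> :: "complex set" and e :: complex and c :: real
  assumes op: "open \<Omega>" and conn: "connected \<Omega>" and reg: "interior (closure \<Omega>) = \<Omega>"
    and compl: "connected (- closure \<Omega>)" and ne: "norm e = 1"
    and sep: "\<And>x z. x \<le> c \<Longrightarrow> z \<in> \<Omega> \<Longrightarrow> 3 \<le> norm (e * z - of_real x)"
    and z0: "z0 \<in> \<Omega>" and shift: "\<And>t. t \<ge> 0 \<Longrightarrow> z0 + of_real t \<in> \<Omega>"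
  defines "v \<equiv> \<lambda>z. 1 / (e * z - of_real c)"
  defines "K \<equiv> insert 0 (v ` closure \<Omega>)"
  shows "compact K" "connected K" "connected (- K)" "interior K = v ` \<Omega>" "v holomorphic_on \<Omega>"
    "\<And>z. z \<in> \<Omega> \<Longrightarrow> v z \<noteq> 0 \<and> cnj e * (of_real c + 1 / v z) = z"
proof -
  have ee: "cnj e * e = 1" using ne by (simp add: complex_norm_square[symmetric] mult.commute)
  have e0: "e \<noteq> 0" using ne by auto
  define vi where "vi w = cnj e * (of_real c + 1 / w)" for w
  define c' where "c' = cnj e * of_real c"
  have v_vi: "v (vi w) = w" if "w \<noteq> 0" for w
  proof -
    have "e * vi w = (cnj e * e) * (of_real c + 1 / w)" by (simp add: vi_def)
    then show ?thesis using that by (simp add: v_def ee)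
  qed
  have vi_v: "v z \<noteq> 0 \<and> vi (v z) = z" if "e * z \<noteq> of_real c" for z
  proof -
    have "vi (v z) = (cnj e * e) * z" by (simp add: vi_def v_def)
    then show ?thesis using that by (simp add: v_def ee)
  qed
  have ec': "e * z = of_real c \<longleftrightarrow> z = c'" for z
  proof -
    have "cnj e * (e * z) = z" "e * c' = of_real c" using ee by (simp_all add: c'_def mult.assoc[symmetric] mult.commute)
    then show ?thesis by (metis c'_def)
  qed
  have sepc: "3 \<le> norm (e * z - of_real x)" if "x \<le> c" "z \<in> closure \<Omega>" for x z
  proof -
    have "closed {z. 3 \<le> norm (e * z - of_real x)}" by (intro closed_Collect_le continuous_intros)
    then have "closure \<Omega> \<subseteq> {z. 3 \<le> norm (e * z - of_real x)}"
      using sep[OF that(1)] by (intro closure_minimal) auto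
    then show ?thesis using that(2) by blast
  qed
  have cne: "e * z \<noteq> of_real c" if "z \<in> closure \<Omega>" for z using sepc[OF order_refl that] by auto
  have holv: "v holomorphic_on S" if "c' \<notin> S" for S
    unfolding v_def using that ec' by (intro holomorphic_intros) auto
  have injv: "inj_on v S" if "c' \<notin> S" for S
  proof (rule inj_on_inverseI[of _ vi])
    fix z assume "z \<in> S"
    then have "z \<noteq> c'" using that by blast
    then show "vi (v z) = z" using vi_v ec' by blast
  qed
  have c'\<Omega>: "c' \<notin> \<Omega>" "c' \<notin> closure \<Omega>" using cne[of c'] ec'[of c'] closure_subset by blast+
  show "v holomorphic_on \<Omega>" by (rule holv[OF c'\<Omega>(1)])
  show "v z \<noteq> 0 \<and> cnj e * (of_real c + 1 / v z) = z" if "z \<in> \<Omega>" for z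
    using vi_v[OF cne] that closure_subset unfolding vi_def by blast
  have compl_eq: "- K = v ` (- closure \<Omega> - {c'})"
  proof (intro set_eqI iffI)
    fix w assume w: "w \<in> - K"
    then have w0: "w \<noteq> 0" by (auto simp: K_def)
    have "vi w \<noteq> c'"
      using w0 e0 by (simp add: vi_def c'_def)
    moreover have "vi w \<notin> closure \<Omega>" using w v_vi[OF w0] unfolding K_def by force
    ultimately show "w \<in> v ` (- closure \<Omega> - {c'})" using v_vi[OF w0] by force
  next
    fix w assume "w \<in> v ` (- closure \<Omega> - {c'})"
    then obtain z where z: "w = v z" "z \<notin> closure \<Omega>" "z \<noteq> c'" by blast
    have vz: "v z \<noteq> 0" "vi (v z) = z" using vi_v[of z] z(3) ec' by blast+
    have "v z \<noteq> v y" if "y \<in> closure \<Omega>" for y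
      using vi_v[OF cne[OF that]] vz z(2) that by metis
    then show "w \<in> - K" using vz z(1) by (auto simp: K_def)
  qed
  have opc: "open (- closure \<Omega> - {c'})" by (auto intro: open_Diff)
  have holc: "v holomorphic_on (- closure \<Omega> - {c'})" by (rule holv) simp
  have "open (- K)" unfolding compl_eq
    by (rule open_mapping_thm3[OF holc opc injv]) simp
  moreover have "norm w \<le> 1/3" if "w \<in> K" for w
    using that sepc[OF order_refl] by (auto simp: K_def v_def norm_divide divide_simps)
  then have "bounded K" by (rule boundedI)
  ultimately show "compact K" unfolding compact_eq_bounded_closed closed_def by blast
  \<comment> \<open>Only the pole of \<open>v\<close> is removed, and deleting a point leaves an
    open connected set in the plane connected.\<close>
  have "connected (- closure \<Omega> - {c'})"
    using compl by (intro connected_open_delete) auto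
  then show "connected (- K)" unfolding compl_eq
    by (intro connected_continuous_image holomorphic_on_imp_continuous_on holc)
  have con: "connected (v ` closure \<Omega>)"
    using conn by (intro connected_continuous_image holomorphic_on_imp_continuous_on holv c'\<Omega> connected_imp_connected_closure)
  have "0 \<in> closure (v ` closure \<Omega>)"
    unfolding closure_approachable
  proof (intro allI impI)
    fix r :: real assume r: "r > 0"
    define b where "b = norm (e * z0 - of_real c)"
    \<comment> \<open>Large enough that \<open>t - b > 1 / r\<close>, so that
      \<open>v (z0 + t)\<close> lies within \<open>r\<close> of 0.\<close>
    define t where "t = 1 / r + b + 1"
    have t: "t \<ge> 0" using r by (simp add: t_def b_def)
    have nt: "norm (e * of_real t) = t" using ne t by (simp add: norm_mult)
    have eq: "e * (z0 + of_real t) - of_real c = e * of_real t + (e * z0 - of_real c)" by (simp add: algebra_simps)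
    have "norm (e * (z0 + of_real t) - of_real c) \<ge> t - b"
      using norm_diff_ineq[of "e * of_real t" "e * z0 - of_real c"] unfolding eq nt b_def .
    then have N: "1 / r < norm (e * (z0 + of_real t) - of_real c)" by (simp add: t_def)
    moreover have "0 < 1 / r" using r by simp
    ultimately have "0 < norm (e * (z0 + of_real t) - of_real c)" by (rule less_trans[rotated])
    with N have "norm (v (z0 + of_real t)) < r"
      using r unfolding v_def norm_divide norm_one by (subst pos_divide_less_eq) (simp_all add: divide_less_eq mult.commute)
    moreover have "z0 + of_real t \<in> closure \<Omega>" using shift[OF t] closure_subset by blast
    ultimately show "\<exists>y\<in>v ` closure \<Omega>. dist y 0 < r" by auto
  qed
  then have "K \<subseteq> closure (v ` closure \<Omega>)"
    unfolding K_def using closure_subset[of "v ` closure \<Omega>"] by blast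
  then show "connected K"
    by (intro connected_intermediate_closure[OF con]) (auto simp: K_def)
  show "interior K = v ` \<Omega>"
  proof (intro subset_antisym)
    have "open (v ` \<Omega>)" by (rule open_mapping_thm3[OF holv[OF c'\<Omega>(1)] op injv[OF c'\<Omega>(1)]])
    moreover have "v ` \<Omega> \<subseteq> K" using closure_subset by (auto simp: K_def)
    ultimately show "v ` \<Omega> \<subseteq> interior K" by (rule interior_maximal[rotated])
    \<comment> \<open>A ball about 0 contains \<open>1 / (x - c)\<close> for \<open>x\<close> far to
      the left. Its preimage solves \<open>e * z = x\<close>, which the separation excludes on the
      closure.\<close>
    have 0: "0 \<notin> interior K"
    proof
      assume "0 \<in> interior K"
      then obtain r where r: "r > 0" "ball 0 r \<subseteq> K" using mem_interior by blast
      define x where "x = c - 2 / r"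
      define w where "w = 1 / complex_of_real (x - c)"
      have xc: "x \<le> c" "x - c \<noteq> 0" using r by (auto simp: x_def)
      have "norm w = r / 2" using r by (simp add: w_def x_def norm_divide del: of_real_diff)
      then have "w \<in> ball 0 r" "w \<noteq> 0" using r by auto
      then obtain z where z: "z \<in> closure \<Omega>" "w = v z" using r(2) unfolding K_def by blast
      have "e * z = of_real x"
        using z(2) cne[OF z(1)] xc(2) by (simp add: w_def v_def field_simps)
      then show False using sepc[OF xc(1) z(1)] by simp
    qed
    show "interior K \<subseteq> v ` \<Omega>"
    proof
      fix w assume w: "w \<in> interior K"
      then have w0: "w \<noteq> 0" using 0 by auto
      define B where "B = interior K - {0}"
      have "vi holomorphic_on B" unfolding vi_def B_def by (intro holomorphic_intros) auto
      moreover have "inj_on vi B" by (rule inj_on_inverseI[of _ v]) (auto simp: B_def v_vi)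
      moreover have "open B" by (auto simp: B_def)
      ultimately have "open (vi ` B)" using open_mapping_thm3 by blast
      moreover have "vi ` B \<subseteq> closure \<Omega>"
      proof
        fix z assume "z \<in> vi ` B"
        then obtain y where y: "y \<in> B" "z = vi y" by blast
        then have "y \<in> K" "y \<noteq> 0" using interior_subset by (auto simp: B_def)
        then obtain x where x: "x \<in> closure \<Omega>" "y = v x" by (auto simp: K_def)
        then show "z \<in> closure \<Omega>" using y vi_v[OF cne[OF x(1)]] by simp
      qed
      \<comment> \<open>An open subset of the closure lies in the interior of the closure, which is
        the domain itself by \<open>reg\<close>.\<close>
      ultimately have "vi ` B \<subseteq> \<Omega>" using reg interior_maximal by metis
      moreover have "w \<in> B" using w w0 by (simp add: B_def)
      ultimately have "vi w \<in> \<Omega>" by blast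
      then show "w \<in> v ` \<Omega>" using v_vi[OF w0] by (metis imageI)
    qed
  qed
qed

text \<open>Here \<open>e\<close> is the conjugate of the rotating factor of the theorem, so that
  \<open>e * z\<close> lies in the unrotated domain. The inversion supplies the bounded coordinate
  \<open>v\<close>, in which the Riemann map is approximated by polynomials.\<close>

lemma exp_span_dense_in_hardy:
  fixes \<Omega> :: "complex set" and e :: complex and c :: real
  assumes op: "open \<Omega>" and sc: "simply_connected \<Omega>" and reg: "interior (closure \<Omega>) = \<Omega>"
    and compl: "connected (- closure \<Omega>)" and ne: "norm e = 1"
    and sep: "\<And>x z. x \<le> c \<Longrightarrow> z \<in> \<Omega> \<Longrightarrow> 3 \<le> norm (e * z - of_real x)"
    and expb: "\<And>z. z \<in> \<Omega> \<Longrightarrow> norm (exp (- (e * z - of_real c))) \<le> 1 + norm (e * z - of_real c) / 4"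
    and shift: "\<And>z t. z \<in> \<Omega> \<Longrightarrow> t \<ge> 0 \<Longrightarrow> z + of_real t \<in> \<Omega>"
    and freq: "\<And>p s. p \<ge> 1 \<Longrightarrow> s \<ge> 0 \<Longrightarrow> - (of_real s * e) \<in> Lambda_p p \<Omega>"
    and p: "p \<ge> 1"
  shows "dense_in_hardy (exp_span {- (of_real s * e) | s::real. s \<ge> 0}) p \<Omega>"
  unfolding dense_in_hardy_def
proof (intro ballI allI impI)
  fix z0 f and \<epsilon> :: real assume z0: "z0 \<in> \<Omega>" and f: "f \<in> hardy p \<Omega>" and \<epsilon>: "\<epsilon> > 0"
  define S where "S = {- (of_real s * e) | s::real. s \<ge> 0}"
  define u where "u z = e * z - of_real c" for z
  have S_add: "a + b \<in> S" if ab: "a \<in> S" "b \<in> S" for a b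
  proof -
    obtain s t where st: "s \<ge> 0" "t \<ge> 0" "a = - (of_real s * e)" "b = - (of_real t * e)" using ab by (auto simp: S_def)
    then have "a + b = - (of_real (s + t) * e)" by (simp add: algebra_simps)
    then show ?thesis using st(1,2) unfolding S_def by (intro CollectI exI[of _ "s + t"]) simp
  qed
  have expS: "(\<lambda>z. k * exp (- (of_real s * e) * z)) \<in> exp_span S" if "s \<ge> 0" for s k
    by (rule exp_span_single) (use that in \<open>auto simp: S_def\<close>)
  interpret exp_generator \<Omega> z0 "exp_span S" u
  proof
    show "(\<lambda>z. f z + g z) \<in> exp_span S" if "f \<in> exp_span S" "g \<in> exp_span S" for f g
      by (rule exp_span_add[OF that(2,1)])
    show "(\<lambda>z. f z * g z) \<in> exp_span S" if "f \<in> exp_span S" "g \<in> exp_span S" for f g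
      by (rule exp_span_mult[OF that(2,1) S_add])
    show "(\<lambda>_. k) \<in> exp_span S" for k using expS[of 0 k] by simp
    show "hfin \<Omega> z0 f" if "f \<in> exp_span S" for f
      by (rule hfin_exp_span[OF op _ that]) (auto simp: S_def intro: freq)
    show "(\<lambda>z. exp (- (complex_of_real s * u z))) \<in> exp_span S" if "s \<ge> 0" for s
    proof -
      \<comment> \<open>The translation by \<open>c\<close> contributes only the constant factor
        \<open>exp (s * c)\<close>.\<close>
      have "(\<lambda>z. exp (- (complex_of_real s * u z))) = (\<lambda>z. exp (of_real (s * c)) * exp (- (of_real s * e) * z))"
        by (intro ext) (simp add: u_def exp_add[symmetric] algebra_simps)
      then show ?thesis using expS[OF that] by simp
    qed
    show "u holomorphic_on \<Omega>" unfolding u_def[abs_def] by (intro holomorphic_intros)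
  qed (use op z0 sep[OF order_refl] expb in \<open>auto simp: u_def\<close>)
  define v where "v = (\<lambda>z. 1 / (e * z - of_real c))"
  define K where "K = insert 0 (v ` closure \<Omega>)"
  have conn: "connected \<Omega>" using sc simply_connected_imp_connected by blast
  have K: "compact K" "connected K" "connected (- K)" "interior K = v ` \<Omega>" "v holomorphic_on \<Omega>"
    "\<And>z. z \<in> \<Omega> \<Longrightarrow> v z \<noteq> 0 \<and> cnj e * (of_real c + 1 / v z) = z"
    unfolding K_def v_def
    by (rule inversion_of_domain[OF op conn reg compl ne sep z0 shift[OF z0]] | assumption)+
  have "cnj e * of_real c \<notin> \<Omega>"
  proof
    assume "cnj e * of_real c \<in> \<Omega>"
    from sep[OF order_refl this] show False
      using ne by (simp add: mult.assoc[symmetric] complex_norm_square[symmetric])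
  qed
  then have nU: "\<Omega> \<noteq> UNIV" by blast
  obtain \<phi> \<kappa> where \<phi>: "\<phi> holomorphic_on \<Omega>" "\<And>z. z \<in> \<Omega> \<Longrightarrow> \<phi> z \<in> ball 0 1 \<and> \<kappa> (\<phi> z) = z"
    and \<kappa>: "\<kappa> holomorphic_on ball 0 (1::real)" "\<And>w. w \<in> ball 0 1 \<Longrightarrow> \<kappa> w \<in> \<Omega> \<and> \<phi> (\<kappa> w) = w"
    and norm0: "\<phi> z0 = 0" "\<kappa> 0 = z0"
    using riemann_map_normalized[OF op sc nU z0] by metis
  have \<kappa>\<Omega>: "\<kappa> ` ball 0 1 \<subseteq> \<Omega>" using \<kappa>(2) by blast
  define vi where "vi w = cnj e * (of_real c + 1 / w)" for w
  have vi: "vi (v z) = z" if "z \<in> \<Omega>" for z using K(6)[OF that] by (simp add: vi_def)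
  have vi\<Omega>: "vi ` (v ` \<Omega>) \<subseteq> \<Omega>" using vi by auto
  have holvi: "vi holomorphic_on v ` \<Omega>" unfolding vi_def using K(6) by (intro holomorphic_intros) auto
  \<comment> \<open>\<open>v \<circ> \<kappa>\<close> and \<open>\<phi> \<circ> vi\<close> are
    mutually inverse Riemann maps between the disc and the inverted domain.\<close>
  have hol1: "v \<circ> \<kappa> holomorphic_on ball 0 1" by (rule holomorphic_on_compose_gen[OF \<kappa>(1) K(5) \<kappa>\<Omega>])
  have hol2: "\<phi> \<circ> vi holomorphic_on v ` \<Omega>" by (rule holomorphic_on_compose_gen[OF holvi \<phi>(1) vi\<Omega>])
  have "\<phi> \<in> hclos \<Omega> z0 (exp_span S)"
  proof (rule riemann_map_in_hclos)
    show "v \<in> hclos \<Omega> z0 (exp_span S)" using inverse_in by (simp add: u_def v_def)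
    show "v ` \<Omega> \<subseteq> K" using K(4) interior_subset by metis
    fix \<eta> :: real assume \<eta>: "0 < \<eta>" "\<eta> < 1"
    obtain f q where fq: "f \<in> poly_closure K" "q holomorphic_on ball 0 (1::real)"
      "\<And>w. w \<in> ball 0 1 \<Longrightarrow> f ((v \<circ> \<kappa>) w) = w * q w" "\<And>w. w \<in> ball 0 1 \<Longrightarrow> norm (q w) \<le> 1" "Re (q 0) > 1 - \<eta>"
    proof (rule caratheodory_riemann_map_approx[OF K(1-4) hol1 _ hol2 _ refl \<eta>])
      show "(v \<circ> \<kappa>) w \<in> v ` \<Omega> \<and> (\<phi> \<circ> vi) ((v \<circ> \<kappa>) w) = w" if "w \<in> ball 0 1" for w
        using \<kappa>(2)[OF that] vi by simp
      show "(\<phi> \<circ> vi) y \<in> ball 0 1 \<and> (v \<circ> \<kappa>) ((\<phi> \<circ> vi) y) = y" if "y \<in> v ` \<Omega>" for y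
        using that vi \<phi>(2) by auto
    qed blast
    have "f (v z) = \<phi> z * q (\<phi> z)" if "z \<in> \<Omega>" for z
      using fq(3)[of "\<phi> z"] \<phi>(2)[OF that] by simp
    then show "\<exists>f q. f \<in> poly_closure K \<and> q holomorphic_on ball 0 (1::real) \<and>
       (\<forall>z\<in>\<Omega>. f (v z) = \<phi> z * q (\<phi> z)) \<and> (\<forall>w\<in>ball 0 1. norm (q w) \<le> 1) \<and> Re (q 0) > 1 - \<eta>"
      using fq by blast
  qed (use \<phi> norm0 in auto)
  then obtain g where "g \<in> exp_span S" "hsmall \<Omega> z0 p (\<lambda>z. f z - g z) \<epsilon>"
    using hardy_approx[OF _ \<phi> norm0(1) \<kappa>(1) \<kappa>\<Omega> f p \<epsilon>] by blast
  then show "\<exists>g\<in>exp_span {- (of_real s * e) | s::real. s \<ge> 0}. hardy_normp p \<Omega> z0 (\<lambda>z. f z - g z) < \<epsilon>"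
    using hardy_normp_less[OF z0] unfolding S_def by blast
qed

theorem theorem5p10:
  fixes \<phi> :: "real \<Rightarrow> complex \<Rightarrow> complex" and h :: "complex \<Rightarrow> complex"
    and D0 :: "complex set" and \<theta> :: real
  assumes "semigroup_disc \<phi>" and "non_elliptic \<phi>" and "koenigs_function \<phi> h"
    and "log_starlike_at_infinity D0" and "has_p_frequencies D0"
    and "h ` unit_disc \<subseteq> (\<lambda>z. exp (\<i> * of_real \<theta>) * z) ` D0"
    and "interior (closure (h ` unit_disc)) = h ` unit_disc"
    and "connected (- closure (h ` unit_disc))"
  shows "\<forall>p::real. 1 \<le> p \<longrightarrow>
           dense_in_hardy (E_p p ((\<lambda>z. exp (\<i> * of_real \<theta>) * z) ` D0)) p (h ` unit_disc) \<and>
           dense_in_hardy (E_p p (h ` unit_disc)) p (h ` unit_disc)"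
proof (intro allI impI)
  fix p :: real assume p: "1 \<le> p"
  define \<Omega> where "\<Omega> = h ` unit_disc"
  define e where "e = exp (\<i> * complex_of_real \<theta>)"
  define D where "D = (\<lambda>z. e * z) ` D0"
  have ne: "norm e = 1" by (simp add: e_def)
  have ee: "cnj e * e = 1" using ne by (simp add: complex_norm_square[symmetric] mult.commute)
  have h: "h holomorphic_on ball 0 1" "inj_on h (ball 0 1)"
    "\<And>t z. t \<ge> 0 \<Longrightarrow> z \<in> ball 0 1 \<Longrightarrow> h (\<phi> t z) = h z + of_real t"
    using assms(3) unfolding koenigs_function_def unit_disc_def by blast+
  have \<phi>: "\<phi> t z \<in> ball 0 1" if "t \<ge> 0" "z \<in> ball 0 1" for t z
    using assms(1) that unfolding semigroup_disc_def unit_disc_def by blast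
  have \<Omega>h: "\<Omega> = h ` ball 0 1" by (simp add: \<Omega>_def unit_disc_def)
  have op: "open \<Omega>" unfolding \<Omega>h by (rule open_mapping_thm3[OF h(1) open_ball h(2)])
  obtain g where g: "g holomorphic_on \<Omega>" "\<And>z. z \<in> ball 0 1 \<Longrightarrow> g (h z) = z"
    using holomorphic_has_inverse[OF h(1) open_ball h(2)] unfolding \<Omega>h by metis
  \<comment> \<open>The Riemann mapping theorem is an equivalence; here it is read backwards, with
    \<open>h\<close> and its inverse \<open>g\<close> as the biholomorphism.\<close>
  have "open \<Omega> \<and> simply_connected \<Omega>"
    unfolding Riemann_mapping_theorem
    by (intro disjI2 exI[of _ g] exI[of _ h]) (use g h \<Omega>h in auto)
  then have sc: "simply_connected \<Omega>" by blast
  have \<Omega>D: "\<Omega> \<subseteq> D" using assms(6) by (simp add: \<Omega>_def D_def e_def)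
  have \<Omega>D0: "cnj e * z \<in> D0" if "z \<in> \<Omega>" for z
    using \<Omega>D that ee unfolding D_def by (auto simp: mult.assoc[symmetric])
  obtain c :: real where c: "\<And>x z. x \<le> c \<Longrightarrow> z \<in> D0 \<Longrightarrow> 3 \<le> norm (z - of_real x)"
    "\<And>x z. x \<le> c \<Longrightarrow> z \<in> D0 \<Longrightarrow> norm (exp (- (z - of_real x))) \<le> 1 + norm (z - of_real x) / 4"
    using log_starlike_separation[OF assms(4)] by blast
  have L: "- (of_real s * cnj e) \<in> Lambda_p p D" if "p \<ge> 1" "s \<ge> 0" for p s
    unfolding D_def by (rule p_frequencies_rotated[OF assms(5) that ne])
  have LL: "Lambda_p p D \<subseteq> Lambda_p p \<Omega>" for p
    unfolding Lambda_p_def using hardy_subset[OF _ op \<Omega>D] by blast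
  have dense: "dense_in_hardy (exp_span {- (of_real s * cnj e) | s::real. s \<ge> 0}) p \<Omega>"
  proof (rule exp_span_dense_in_hardy[OF op sc])
    show "interior (closure \<Omega>) = \<Omega>" "connected (- closure \<Omega>)" using assms(7,8) by (simp_all add: \<Omega>_def)
    show "norm (cnj e) = 1" using ne by simp
    show "3 \<le> norm (cnj e * z - of_real x)" if "x \<le> c" "z \<in> \<Omega>" for x z
      using c(1)[OF that(1) \<Omega>D0[OF that(2)]] .
    show "norm (exp (- (cnj e * z - of_real c))) \<le> 1 + norm (cnj e * z - of_real c) / 4" if "z \<in> \<Omega>" for z
      using c(2)[OF order_refl \<Omega>D0[OF that]] .
    \<comment> \<open>The functional equation of the Koenigs function makes the domain invariant
      under translation to the right.\<close>
    show "z + of_real t \<in> \<Omega>" if "z \<in> \<Omega>" "t \<ge> 0" for z t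
    proof -
      obtain w where w: "w \<in> ball 0 1" "z = h w" using \<open>z \<in> \<Omega>\<close> \<Omega>h by blast
      then have "z + of_real t = h (\<phi> t w)" using h(3)[OF that(2) w(1)] by simp
      then show ?thesis using \<phi>[OF that(2) w(1)] \<Omega>h by blast
    qed
    show "- (of_real s * cnj e) \<in> Lambda_p p \<Omega>" if "p \<ge> 1" "s \<ge> 0" for p s
      using L[OF that] LL by blast
  qed (rule p)
  \<comment> \<open>The frequencies used are admissible on \<open>D\<close> for every exponent, and
    those of \<open>D\<close> on the smaller domain, so density passes to the larger spans.\<close>
  have sub: "exp_span {- (of_real s * cnj e) | s::real. s \<ge> 0} \<subseteq> E_p p D"
    unfolding E_p_def using L[OF p] by (intro exp_span_mono) blast
  have sub2: "E_p p D \<subseteq> E_p p \<Omega>" unfolding E_p_def by (intro exp_span_mono LL)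
  have "dense_in_hardy (E_p p D) p \<Omega>" by (rule dense_in_hardy_mono[OF dense sub])
  moreover from this have "dense_in_hardy (E_p p \<Omega>) p \<Omega>" by (rule dense_in_hardy_mono[OF _ sub2])
  ultimately show "dense_in_hardy (E_p p ((\<lambda>z. exp (\<i> * of_real \<theta>) * z) ` D0)) p (h ` unit_disc) \<and>
           dense_in_hardy (E_p p (h ` unit_disc)) p (h ` unit_disc)"
    by (simp only: \<Omega>_def D_def e_def)
qed

end
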